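(* Let $g_t$ be the hypoelliptic Brownian motion on $\mathbb{H}$ and $g^\ast_1=\max_{0\le s\le 1}|g_s|$. Then the limit \[ \lim_{\varepsilon\to0}-\varepsilon^2\log\mathbb{P}\left(g^{\ast}_1<\varepsilon\right) \] exists and equals $c^2$, where $c\in(0,\infty)$ is the almost sure constant value of $\liminf_{t\to\infty}\sqrt{\frac{\log\log t}{t}}\,\max_{0\le s\le t}|g_s|$.
   Context: The Heisenberg group $\mathbb{H}$ is $\mathbb{R}^2\times\mathbb{R}$ with multiplication $(\mathbf{v}_1,z_1)\cdot(\mathbf{v}_2,z_2)=(\mathbf{v}_1+\mathbf{v}_2,\ z_1+z_2+\tfrac12\omega(\mathbf{v}_1,\mathbf{v}_2))$, where $\omega((x_1,y_1),(x_2,y_2))=x_1y_2-x_2y_1$. The homogeneous norm on $\mathbb{H}$ is $|(\mathbf{x},z)|:=\left(\|\mathbf{x}\|_{\mathbb{R}^2}^4+z^2\right)^{1/4}$. Let $\bm{W}_t=(W_1(t),W_2(t))$ be a standard two-dimensional Brownian motion. The hypoelliptic Brownian motion on $\mathbb{H}$ is $g_t:=(\bm{W}_t,A_t)$ with $A_t:=\frac12\int_0^t (W_1(s)\,dW_2(s)-W_2(s)\,dW_1(s))$ (Lévy's stochastic area, Itô integral). *)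

theory Defs
  imports "HOL-Probability.Probability"
begin

definition omega2 :: "real \<times> real \<Rightarrow> real \<times> real \<Rightarrow> real" where
  "omega2 v w = fst v * snd w - fst w * snd v"

definition heis_mult :: "(real \<times> real) \<times> real \<Rightarrow> (real \<times> real) \<times> real \<Rightarrow> (real \<times> real) \<times> real" where
  "heis_mult g h = (fst g + fst h, snd g + snd h + omega2 (fst g) (fst h) / 2)"

definition heis_norm :: "(real \<times> real) \<times> real \<Rightarrow> real" where
  "heis_norm g = (((fst (fst g))\<^sup>2 + (snd (fst g))\<^sup>2)\<^sup>2 + (snd g)\<^sup>2) powr (1/4)"

definition brownian_motion_2d :: "'a measure \<Rightarrow> (real \<Rightarrow> 'a \<Rightarrow> real \<times> real) \<Rightarrow> bool" where
  "brownian_motion_2d M W \<longleftrightarrow>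
     prob_space M \<and>
     (\<forall>t. W t \<in> borel_measurable M) \<and>
     (\<forall>\<omega>\<in>space M. W 0 \<omega> = (0, 0)) \<and>
     (\<forall>\<omega>\<in>space M. continuous_on {0..} (\<lambda>t. W t \<omega>)) \<and>
     (\<forall>(ts :: nat \<Rightarrow> real) n. 0 \<le> ts 0 \<and> (\<forall>i<n. ts i < ts (Suc i)) \<longrightarrow>
        prob_space.indep_vars M (\<lambda>_. borel) (\<lambda>i \<omega>. W (ts (Suc i)) \<omega> - W (ts i) \<omega>) {..<n}) \<and>
     (\<forall>s t. 0 \<le> s \<and> s < t \<longrightarrow>
        distributed M (lborel \<Otimes>\<^sub>M lborel) (\<lambda>\<omega>. W t \<omega> - W s \<omega>)
          (\<lambda>(x, y). ennreal (normal_density 0 (sqrt (t - s)) x * normal_density 0 (sqrt (t - s)) y)))"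

text \<open>Left-point Riemann sum of  int_0^t (W1 dW2 - W2 dW1)  along the dyadic partition
  t_k = k t / 2^n.\<close>
definition levy_riemann_sum :: "(real \<Rightarrow> 'a \<Rightarrow> real \<times> real) \<Rightarrow> real \<Rightarrow> nat \<Rightarrow> 'a \<Rightarrow> real" where
  "levy_riemann_sum W t n \<omega> =
     (\<Sum>k<2^n. let a = W (real k * t / 2^n) \<omega>; b = W (real (Suc k) * t / 2^n) \<omega> in
        fst a * (snd b - snd a) - snd a * (fst b - fst a))"

text \<open>A is (a continuous version of) Levy's stochastic area
  A_t = 1/2 int_0^t (W1 dW2 - W2 dW1) (Ito integral): for each t \<ge> 0, 2 A_t is the limit in
  probability of the left-point Riemann sums (which is the Ito integral of the continuous
  adapted integrands), and the paths of A are continuous.\<close>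
definition levy_area :: "'a measure \<Rightarrow> (real \<Rightarrow> 'a \<Rightarrow> real \<times> real) \<Rightarrow> (real \<Rightarrow> 'a \<Rightarrow> real) \<Rightarrow> bool" where
  "levy_area M W A \<longleftrightarrow>
     (\<forall>t. A t \<in> borel_measurable M) \<and>
     (\<forall>\<omega>\<in>space M. continuous_on {0..} (\<lambda>t. A t \<omega>)) \<and>
     (\<forall>t\<ge>0. \<forall>\<delta>>0. (\<lambda>n. measure M {\<omega>\<in>space M. \<bar>levy_riemann_sum W t n \<omega> - 2 * A t \<omega>\<bar> > \<delta>})
                       \<longlonglongrightarrow> 0)"

definition heis_running_max :: "(real \<Rightarrow> 'a \<Rightarrow> real \<times> real) \<Rightarrow> (real \<Rightarrow> 'a \<Rightarrow> real) \<Rightarrow> real \<Rightarrow> 'a \<Rightarrow> real" where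
  "heis_running_max W A t \<omega> = Sup ((\<lambda>s. heis_norm (W s \<omega>, A s \<omega>)) ` {0..t})"

end

theory Submission
  imports Defs
begin

text \<open>
  The homogeneous norm is subadditive for the group law, and the increments \<open>g\<^sub>s\<^sup>-\<^sup>1 g\<^sub>t\<close> are independent,
  stationary and scale under the group dilations. For increments on a grid this follows from an
  \<open>L\<^sup>2\<close> bound on the Riemann sums of the area, which shows that the limit does not depend on the partition.

  Let \<open>q(T)\<close> be the supremum over starting points of the probability of staying in the closed unit ball up to
  time \<open>T\<close>. By the Markov property \<open>q\<close> is submultiplicative, so \<open>- ln q(T) / T\<close> has a limit \<open>L\<close>. Horizontal
  segments are followed with positive probability, small square loops move along the centre, and hence, by compactness,
  every point of the unit ball is approached from \<open>0\<close> with uniformly positive probability without leaving a ball of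
  radius \<open>1 + \<eta>\<close>. Applied to \<open>x\<^sup>-\<^sup>1\<close> this bounds \<open>q\<close> from below, so that \<open>L\<close> is finite; and it shows that starting from
  \<open>0\<close> in a ball of radius \<open>1 + \<eta>\<close> is, up to a constant, as good as starting from the best point in the unit ball.
  Scaling and \<open>\<eta> \<rightarrow> 0\<close> give the small ball asymptotics \<open>- \<epsilon>\<^sup>2 ln P(g\<^sup>*\<^sub>1 < \<epsilon>) \<longrightarrow> L\<close>, and the two Borel--Cantelli arguments
  along \<open>t = r\<^sup>k\<close> and \<open>t = (k!)\<^sup>2\<close> identify the almost sure lower limit as \<open>\<surd>L\<close>.
\<close>

subsection \<open>The Heisenberg group and its homogeneous norm\<close>

text \<open>The homogeneous distance is only left invariant, and this shapes the estimates: when a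
  path misses a target by \<open>k\<close> and then continues with \<open>c\<close>, the error
  enters as the conjugate \<open>- c \<odot> k \<odot> c\<close>, of size
  \<open>\<delta> + sqrt (\<delta> * r)\<close>. It is small only while the later piece
  \<open>c\<close> is bounded, which confinement to a ball ensures. The supremum over starting
  points makes the Markov recursion close; the price is that \<open>q\<close> gives no lower bound
  for the start at \<open>0\<close> until it is compared with a slightly larger ball. The area is
  given only through limits in probability of dyadic sums, so laws and independence are proved for
  products of horizontal steps and then passed to the limit. Confinement is always to closed sets,
  so that it is decided at dyadic times, and times that are combined are rational so as to lie on
  one grid. The times \<open>(k!)^2\<close> have ratio \<open>(k + 1)^2\<close>: large enough that
  the past up to \<open>\<tau> k\<close> is negligible with summable error by a mere fourth moment
  bound, while their logarithm grows only like \<open>k ln k\<close>, so that the block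
  probabilities dominate a harmonic series.\<close>

type_synonym heis = "(real \<times> real) \<times> real"

notation heis_mult (infixl "\<odot>" 70)

definition heis_dil :: "real \<Rightarrow> heis \<Rightarrow> heis" where
  "heis_dil r g = (r *\<^sub>R fst g, r\<^sup>2 * snd g)"

lemma omega2_linear:
  "omega2 (v + v') w = omega2 v w + omega2 v' w" "omega2 v (w + w') = omega2 v w + omega2 v w'"
  "omega2 (v - v') w = omega2 v w - omega2 v' w" "omega2 v (w - w') = omega2 v w - omega2 v w'"
  by (auto simp: omega2_def algebra_simps)

lemma omega2_simps [simp]:
  "omega2 (- v) w = - omega2 v w" "omega2 v (- w) = - omega2 v w"
  "omega2 (r *\<^sub>R v) w = r * omega2 v w" "omega2 v (r *\<^sub>R w) = r * omega2 v w"
  "omega2 v v = 0" "omega2 0 v = 0" "omega2 v 0 = 0"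
  by (auto simp: omega2_def algebra_simps)

lemma omega2_swap: "omega2 w v = - omega2 v w"
  by (simp add: omega2_def)

lemma omega2_sum_right: "omega2 v (\<Sum>i\<in>I. f i) = (\<Sum>i\<in>I. omega2 v (f i))"
  by (induction I rule: infinite_finite_induct) (auto simp: omega2_linear)

lemma norm_real_pair: "norm (v :: real \<times> real) = sqrt ((fst v)\<^sup>2 + (snd v)\<^sup>2)"
  by (simp add: norm_prod_def)

lemma abs_omega2_le: "\<bar>omega2 v w\<bar> \<le> norm v * norm w"
proof -
  have "(omega2 v w)\<^sup>2 \<le> ((fst v)\<^sup>2 + (snd v)\<^sup>2) * ((fst w)\<^sup>2 + (snd w)\<^sup>2)"
  proof -
    have "((fst v)\<^sup>2 + (snd v)\<^sup>2) * ((fst w)\<^sup>2 + (snd w)\<^sup>2) - (omega2 v w)\<^sup>2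
        = (fst v * fst w + snd v * snd w)\<^sup>2"
      by (simp add: omega2_def power2_eq_square algebra_simps)
    then show ?thesis by (smt (verit) zero_le_power2)
  qed
  then have "sqrt ((omega2 v w)\<^sup>2) \<le> norm v * norm w"
    unfolding norm_real_pair real_sqrt_mult[symmetric] by (rule real_sqrt_le_mono)
  then show ?thesis by simp
qed

lemma fst_heis_mult [simp]: "fst (g \<odot> h) = fst g + fst h"
  and snd_heis_mult [simp]: "snd (g \<odot> h) = snd g + snd h + omega2 (fst g) (fst h) / 2"
  by (simp_all add: heis_mult_def)

lemma fst_heis_dil [simp]: "fst (heis_dil r g) = r *\<^sub>R fst g"
  and snd_heis_dil [simp]: "snd (heis_dil r g) = r\<^sup>2 * snd g"
  by (simp_all add: heis_dil_def)

lemma heis_mult_assoc: "g \<odot> h \<odot> k = g \<odot> (h \<odot> k)"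
  by (rule prod_eqI) (auto simp: omega2_linear algebra_simps add_divide_distrib)

lemma heis_mult_0 [simp]: "0 \<odot> g = g" "g \<odot> 0 = g"
  by (rule prod_eqI; simp)+

text \<open>The form vanishes on the diagonal, so the group inverse is coordinate negation. Hence
  \<open>- g \<odot> h\<close> is the group increment from \<open>g\<close> to \<open>h\<close>
  throughout.\<close>

lemma heis_mult_uminus [simp]: "- g \<odot> g = 0" "g \<odot> - g = 0"
  by (rule prod_eqI; simp)+

lemma heis_mult_uminus_cancel [simp]: "- g \<odot> (g \<odot> h) = h" "g \<odot> (- g \<odot> h) = h"
  by (simp_all add: heis_mult_assoc[symmetric])

lemma heis_uminus_mult: "- (g \<odot> h) = - h \<odot> - g"
  by (rule prod_eqI) (auto simp: omega2_swap[of "fst h"] algebra_simps)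

lemma heis_dil_mult: "heis_dil r (g \<odot> h) = heis_dil r g \<odot> heis_dil r h"
  by (rule prod_eqI) (auto simp: algebra_simps power2_eq_square)

lemma heis_dil_0 [simp]: "heis_dil r 0 = 0"
  by (rule prod_eqI) auto

lemma heis_dil_dil: "heis_dil r (heis_dil s g) = heis_dil (r * s) g"
  by (rule prod_eqI) (auto simp: power_mult_distrib)

lemma heis_dil_1 [simp]: "heis_dil 1 g = g"
  by (rule prod_eqI) auto

text \<open>Nested square roots replace \<open>powr\<close>: continuity, also at the origin, and
  comparison of fourth powers become immediate.\<close>

lemma heis_norm_eq: "heis_norm g = sqrt (sqrt (norm (fst g) ^ 4 + (snd g)\<^sup>2))"
proof -
  have *: "((fst (fst g))\<^sup>2 + (snd (fst g))\<^sup>2)\<^sup>2 = norm (fst g) ^ 4"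
  proof -
    have "norm (fst g) ^ 4 = ((norm (fst g))\<^sup>2)\<^sup>2" by simp
    then show ?thesis by (simp add: norm_real_pair)
  qed
  have "heis_norm g = (norm (fst g) ^ 4 + (snd g)\<^sup>2) powr (1/2 * (1/2))"
    unfolding heis_norm_def * by simp
  also have "\<dots> = sqrt (sqrt (norm (fst g) ^ 4 + (snd g)\<^sup>2))"
    unfolding powr_powr[symmetric] by (simp add: powr_half_sqrt)
  finally show ?thesis .
qed

lemma heis_norm_nonneg [simp]: "0 \<le> heis_norm g"
  by (simp add: heis_norm_eq)

lemma heis_norm_pow4: "heis_norm g ^ 4 = norm (fst g) ^ 4 + (snd g)\<^sup>2"
proof -
  have "heis_norm g ^ 4 = ((heis_norm g)\<^sup>2)\<^sup>2" by simp
  then show ?thesis by (simp add: heis_norm_eq)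
qed

text \<open>Reading the squared norm as the modulus of \<open>|v|^2 + i z\<close> reduces
  subadditivity to the triangle inequality in the complex plane.\<close>

lemma heis_norm_power2: "(heis_norm g)\<^sup>2 = cmod (Complex ((norm (fst g))\<^sup>2) (snd g))"
  by (simp add: heis_norm_eq cmod_def)

lemma heis_norm_0 [simp]: "heis_norm 0 = 0"
  by (simp add: heis_norm_eq)

lemma heis_norm_uminus [simp]: "heis_norm (- g) = heis_norm g"
  by (simp add: heis_norm_eq)

lemma heis_norm_dil [simp]: "heis_norm (heis_dil r g) = \<bar>r\<bar> * heis_norm g"
proof -
  have "heis_norm (heis_dil r g) ^ 4 = (\<bar>r\<bar> * heis_norm g) ^ 4"
    by (simp add: heis_norm_pow4 power_mult_distrib algebra_simps flip: power_mult)
  then show ?thesis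
    by (rule power_eq_imp_eq_base) auto
qed

lemma norm_fst_le_heis_norm: "norm (fst g) \<le> heis_norm g"
  by (rule power_le_imp_le_base[of _ 3]) (auto simp: heis_norm_pow4)

lemma abs_snd_le_heis_norm: "\<bar>snd g\<bar> \<le> (heis_norm g)\<^sup>2"
proof (rule power_le_imp_le_base[of _ 1])
  have "((heis_norm g)\<^sup>2)\<^sup>2 = heis_norm g ^ 4" by simp
  then show "\<bar>snd g\<bar> ^ Suc 1 \<le> ((heis_norm g)\<^sup>2) ^ Suc 1"
    by (simp add: heis_norm_pow4 flip: power2_eq_square)
qed auto

text \<open>The complex number attached to a product is the sum of those of the factors plus the
  cross term \<open>2 d + i \<omega> / 2\<close>, with \<open>d\<close> the inner product and
  \<open>\<omega>\<close> the symplectic form of the horizontal parts. Its modulus is at most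
  \<open>2 |x| |y|\<close>, so the right side completes to a square.\<close>

lemma heis_norm_triangle: "heis_norm (g \<odot> h) \<le> heis_norm g + heis_norm h"
proof (rule power2_le_imp_le)
  let ?x = "fst g" and ?y = "fst h"
  define d where "d = fst ?x * fst ?y + snd ?x * snd ?y"
  have "(norm (?x + ?y))\<^sup>2 = (norm ?x)\<^sup>2 + (norm ?y)\<^sup>2 + 2 * d"
    by (simp add: norm_real_pair d_def) (simp add: power2_eq_square algebra_simps)
  then have "Complex ((norm (fst (g \<odot> h)))\<^sup>2) (snd (g \<odot> h))
     = Complex ((norm ?x)\<^sup>2) (snd g) + Complex ((norm ?y)\<^sup>2) (snd h) + Complex (2 * d) (omega2 ?x ?y / 2)"
    by (simp add: complex_eq_iff)
  then have "(heis_norm (g \<odot> h))\<^sup>2 \<le> (heis_norm g)\<^sup>2 + (heis_norm h)\<^sup>2 + cmod (Complex (2 * d) (omega2 ?x ?y / 2))"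
    unfolding heis_norm_power2 by (metis norm_triangle_mono norm_triangle_ineq order_refl)
  also have "cmod (Complex (2 * d) (omega2 ?x ?y / 2)) \<le> 2 * (norm ?x * norm ?y)"
  proof -
    \<comment> \<open>Lagrange's identity in the plane.\<close>
    have "d\<^sup>2 + (omega2 ?x ?y)\<^sup>2 = ((fst ?x)\<^sup>2 + (snd ?x)\<^sup>2) * ((fst ?y)\<^sup>2 + (snd ?y)\<^sup>2)"
      by (simp add: d_def omega2_def power2_eq_square algebra_simps)
    also have "\<dots> = (norm ?x * norm ?y)\<^sup>2"
      by (simp add: norm_real_pair power_mult_distrib)
    finally have eq: "d\<^sup>2 + (omega2 ?x ?y)\<^sup>2 = (norm ?x * norm ?y)\<^sup>2" .
    have "(2 * d)\<^sup>2 + (omega2 ?x ?y / 2)\<^sup>2 \<le> 4 * (d\<^sup>2 + (omega2 ?x ?y)\<^sup>2)"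
      by (simp add: power_mult_distrib[of 2] power_divide)
    then have "(2 * d)\<^sup>2 + (omega2 ?x ?y / 2)\<^sup>2 \<le> (2 * (norm ?x * norm ?y))\<^sup>2"
      by (simp add: eq power_mult_distrib[of 2])
    then have "sqrt ((2 * d)\<^sup>2 + (omega2 ?x ?y / 2)\<^sup>2) \<le> 2 * (norm ?x * norm ?y)"
      by (intro real_le_lsqrt) auto
    then show ?thesis by (simp add: cmod_def)
  qed
  also have "norm ?x * norm ?y \<le> heis_norm g * heis_norm h"
    by (intro mult_mono norm_fst_le_heis_norm) auto
  finally show "(heis_norm (g \<odot> h))\<^sup>2 \<le> (heis_norm g + heis_norm h)\<^sup>2"
    by (simp add: power2_sum)
qed simp

lemma heis_norm_horizontal [simp]: "heis_norm (w, 0) = norm w"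
proof -
  have "heis_norm (w, 0) ^ 4 = norm w ^ 4" by (simp add: heis_norm_pow4)
  then show ?thesis by (rule power_eq_imp_eq_base) auto
qed

lemma heis_norm_vertical [simp]: "heis_norm (0, z) = sqrt \<bar>z\<bar>"
  by (simp add: heis_norm_eq)

lemma heis_norm_le: "heis_norm g \<le> norm (fst g) + sqrt \<bar>snd g\<bar>"
proof -
  have "g = (fst g, 0) \<odot> (0, snd g)" by (rule prod_eqI) auto
  then show ?thesis
    using heis_norm_triangle[of "(fst g, 0)" "(0, snd g)"] by simp
qed

text \<open>Conjugation by \<open>c\<close> fixes the horizontal part of \<open>k\<close> and moves
  only the centre, by the form of the two horizontal parts. A central shift \<open>z\<close> has
  norm \<open>sqrt |z|\<close>, hence the square root.\<close>

lemma heis_norm_conj_le: "heis_norm (- c \<odot> k \<odot> c) \<le> heis_norm k + sqrt (heis_norm k * heis_norm c)"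
proof -
  have "- c \<odot> k \<odot> c = k \<odot> (0, omega2 (fst k) (fst c))"
    by (rule prod_eqI) (auto simp: omega2_linear omega2_swap[of "fst c"])
  then have "heis_norm (- c \<odot> k \<odot> c) \<le> heis_norm k + sqrt \<bar>omega2 (fst k) (fst c)\<bar>"
    using heis_norm_triangle[of k "(0, omega2 (fst k) (fst c))"] by simp
  also have "\<bar>omega2 (fst k) (fst c)\<bar> \<le> norm (fst k) * norm (fst c)"
    by (rule abs_omega2_le)
  also have "\<dots> \<le> heis_norm k * heis_norm c"
    by (intro mult_mono norm_fst_le_heis_norm) auto
  finally show ?thesis by simp
qed

text \<open>An error \<open>k\<close> inserted between \<open>x\<close> and \<open>c\<close> is
  pushed to the far right, where it becomes a conjugate. This is the cost of continuing a path from
  a slightly wrong point.\<close>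

lemma heis_norm_mult_perturb:
  assumes "heis_norm k \<le> \<delta>" "heis_norm c \<le> r"
  shows "heis_norm (x \<odot> k \<odot> c) \<le> heis_norm (x \<odot> c) + \<delta> + sqrt (\<delta> * r)"
proof -
  have "x \<odot> k \<odot> c = (x \<odot> c) \<odot> (- c \<odot> k \<odot> c)" by (simp add: heis_mult_assoc)
  then have "heis_norm (x \<odot> k \<odot> c) \<le> heis_norm (x \<odot> c) + heis_norm (- c \<odot> k \<odot> c)"
    using heis_norm_triangle by metis
  also have "heis_norm (- c \<odot> k \<odot> c) \<le> heis_norm k + sqrt (heis_norm k * heis_norm c)"
    by (rule heis_norm_conj_le)
  also have "heis_norm k * heis_norm c \<le> \<delta> * r"
    using assms by (intro mult_mono) (auto intro: order_trans[OF heis_norm_nonneg])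
  finally show ?thesis using assms by simp
qed

lemma continuous_on_omega2 [continuous_intros]:
  "continuous_on S f \<Longrightarrow> continuous_on S g \<Longrightarrow> continuous_on S (\<lambda>x. omega2 (f x) (g x))"
  unfolding omega2_def by (intro continuous_intros)

lemma continuous_on_heis_mult [continuous_intros]:
  "continuous_on S f \<Longrightarrow> continuous_on S g \<Longrightarrow> continuous_on S (\<lambda>x. f x \<odot> g x)"
  unfolding heis_mult_def by (intro continuous_intros) auto

lemma continuous_on_heis_norm [continuous_intros]:
  "continuous_on S f \<Longrightarrow> continuous_on S (\<lambda>x. heis_norm (f x))"
  unfolding heis_norm_eq by (intro continuous_intros)

lemma continuous_on_heis_dil [continuous_intros]:
  "continuous_on S f \<Longrightarrow> continuous_on S (\<lambda>x. heis_dil r (f x))"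
  unfolding heis_dil_def by (intro continuous_intros)

lemma borel_measurable_heis_mult [measurable (raw)]:
  fixes f g :: "'b \<Rightarrow> heis"
  assumes "f \<in> borel_measurable N" "g \<in> borel_measurable N"
  shows "(\<lambda>x. f x \<odot> g x) \<in> borel_measurable N"
  by (rule borel_measurable_continuous_Pair[OF assms]) (intro continuous_intros)

lemma borel_measurable_heis_norm [measurable]: "heis_norm \<in> borel_measurable borel"
  by (intro borel_measurable_continuous_onI continuous_intros)

lemma borel_measurable_heis_dil [measurable]: "heis_dil r \<in> borel_measurable borel"
  by (intro borel_measurable_continuous_onI continuous_intros)

lemma closed_heis_norm_le: "continuous_on UNIV f \<Longrightarrow> closed {x. heis_norm (f x) \<le> r}"
  by (intro closed_Collect_le continuous_intros) auto

lemma compact_heis_cball: "compact {g. heis_norm g \<le> r}"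
proof (cases "0 \<le> r")
  case True
  have "bounded {g. heis_norm g \<le> r}"
  proof (rule boundedI)
    fix g assume "g \<in> {g. heis_norm g \<le> r}"
    then have g: "heis_norm g \<le> r" by simp
    have "norm g \<le> norm (fst g) + norm (snd g)"
      by (metis norm_Pair_le prod.collapse)
    also have "\<dots> \<le> r + r\<^sup>2"
      using norm_fst_le_heis_norm[of g] abs_snd_le_heis_norm[of g] g power_mono[OF g, of 2] by simp
    finally show "norm g \<le> r + r\<^sup>2" .
  qed
  then show ?thesis
    using closed_heis_norm_le[of "\<lambda>x. x" r] by (auto simp: compact_eq_bounded_closed)
next
  case False
  then have "\<not> heis_norm g \<le> r" for g using heis_norm_nonneg[of g] by linarith
  then have "{g. heis_norm g \<le> r} = {}" by blast
  then show ?thesis by (simp only: compact_empty)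
qed

text \<open>The group is not commutative, so the order counts: new factors go to the right, as
  increments of a path do, and \<open>heis_prod_telescope\<close> rebuilds the path.\<close>

primrec heis_prod :: "(nat \<Rightarrow> heis) \<Rightarrow> nat \<Rightarrow> heis" where
  "heis_prod x 0 = 0"
| "heis_prod x (Suc n) = heis_prod x n \<odot> x n"

lemma heis_prod_cong: "(\<And>i. i < n \<Longrightarrow> x i = y i) \<Longrightarrow> heis_prod x n = heis_prod y n"
  by (induction n) auto

lemma heis_dil_prod: "heis_dil r (heis_prod x n) = heis_prod (\<lambda>i. heis_dil r (x i)) n"
  by (induction n) (auto simp: heis_dil_mult)

lemma heis_prod_telescope: "heis_prod (\<lambda>i. - f i \<odot> f (Suc i)) n = - f 0 \<odot> f n"
  by (induction n) (auto simp: heis_mult_assoc)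

lemma borel_measurable_heis_prod [measurable (raw)]:
  assumes "\<And>i. i < n \<Longrightarrow> (\<lambda>\<omega>. x \<omega> i) \<in> borel_measurable N"
  shows "(\<lambda>\<omega>. heis_prod (x \<omega>) n) \<in> borel_measurable N"
  using assms by (induction n) auto

subsection \<open>Convergence in probability, independence and laws\<close>

text \<open>Lipschitz approximation of the indicator of a closed set, which makes convergence in
  probability usable for laws. The empty set is treated apart because \<open>infdist x {}\<close> is
  \<open>0\<close> by convention, which would give the value 1.\<close>

definition closed_cutoff :: "'b::metric_space set \<Rightarrow> nat \<Rightarrow> 'b \<Rightarrow> real" where
  "closed_cutoff F m x = (if F = {} then 0 else max 0 (1 - real m * infdist x F))"

lemma closed_cutoff_bounds: "0 \<le> closed_cutoff F m x" "closed_cutoff F m x \<le> 1"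
  by (auto simp: closed_cutoff_def infdist_nonneg)

lemma closed_cutoff_Lipschitz: "\<bar>closed_cutoff F m x - closed_cutoff F m y\<bar> \<le> real m * dist x y"
proof -
  have "\<bar>real m * infdist x F - real m * infdist y F\<bar> \<le> real m * dist x y"
    using infdist_triangle_abs[of x F y]
    by (simp add: abs_mult mult_left_mono flip: right_diff_distrib)
  moreover have "0 \<le> real m * dist x y" by simp
  ultimately show ?thesis unfolding closed_cutoff_def max_def by (auto split: if_splits)
qed

lemma closed_cutoff_measurable [measurable]:
  "closed_cutoff (F :: 'b::{metric_space, second_countable_topology} set) m \<in> borel_measurable borel"
proof -
  have "continuous_on UNIV (\<lambda>x. closed_cutoff F m x)"
    unfolding closed_cutoff_def by (cases "F = {}") (auto intro!: continuous_intros)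
  then show ?thesis by (rule borel_measurable_continuous_onI)
qed

lemma closed_cutoff_tendsto:
  assumes "closed F"
  shows "(\<lambda>m. closed_cutoff F m x) \<longlonglongrightarrow> indicator F x"
proof (cases "x \<in> F \<or> F = {}")
  case True
  then have "closed_cutoff F m x = indicator F x" for m
    by (auto simp: closed_cutoff_def)
  then show ?thesis by simp
next
  case False
  then have pos: "0 < infdist x F"
    using in_closed_iff_infdist_zero[OF assms, of x] infdist_nonneg[of x F] by auto
  obtain m0 :: nat where m0: "1 / infdist x F < real m0"
    using reals_Archimedean2 by blast
  have "closed_cutoff F m x = indicator F x" if "m0 \<le> m" for m
  proof -
    have "1 / infdist x F \<le> real m" using m0 that by linarith
    then have "1 \<le> real m * infdist x F" using pos by (simp add: field_simps)
    then show ?thesis using False by (auto simp: closed_cutoff_def)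
  qed
  then show ?thesis
    by (intro tendsto_eventually eventually_sequentiallyI[of m0]) auto
qed

context prob_space
begin

definition tendsto_prob ::
  "(nat \<Rightarrow> 'a \<Rightarrow> 'b::{metric_space, second_countable_topology}) \<Rightarrow> ('a \<Rightarrow> 'b) \<Rightarrow> bool" where
  "tendsto_prob X Y \<longleftrightarrow> (\<forall>\<delta>>0. (\<lambda>k. prob {\<omega> \<in> space M. dist (X k \<omega>) (Y \<omega>) > \<delta>}) \<longlonglongrightarrow> 0)"

lemma tendsto_prob_mono:
  assumes "tendsto_prob X Y" "0 < c"
    and [measurable]: "\<And>k. X k \<in> borel_measurable M" "Y \<in> borel_measurable M"
    and le: "\<And>k \<omega>. \<omega> \<in> space M \<Longrightarrow> dist (X' k \<omega>) (Y' \<omega>) \<le> c * dist (X k \<omega>) (Y \<omega>)"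
  shows "tendsto_prob X' Y'"
  unfolding tendsto_prob_def
proof (intro allI impI)
  fix \<delta> :: real assume "0 < \<delta>"
  have "(\<lambda>k. prob {\<omega> \<in> space M. dist (X k \<omega>) (Y \<omega>) > \<delta> / c}) \<longlonglongrightarrow> 0"
    using assms(1) \<open>0 < c\<close> \<open>0 < \<delta>\<close> by (auto simp: tendsto_prob_def)
  then show "(\<lambda>k. prob {\<omega> \<in> space M. dist (X' k \<omega>) (Y' \<omega>) > \<delta>}) \<longlonglongrightarrow> 0"
  proof (rule tendsto_sandwich[OF _ _ tendsto_const, rotated -1], goal_cases)
    case 2
    show ?case
    proof (intro always_eventually allI finite_measure_mono)
      fix k
      show "{\<omega> \<in> space M. dist (X' k \<omega>) (Y' \<omega>) > \<delta>} \<subseteq> {\<omega> \<in> space M. dist (X k \<omega>) (Y \<omega>) > \<delta> / c}"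
      proof safe
        fix \<omega> assume "\<omega> \<in> space M" "dist (X' k \<omega>) (Y' \<omega>) > \<delta>"
        with le[of \<omega> k] have "\<delta> < c * dist (X k \<omega>) (Y \<omega>)" by linarith
        then show "dist (X k \<omega>) (Y \<omega>) > \<delta> / c" using \<open>0 < c\<close> by (simp add: field_simps)
      qed
    qed measurable
  qed auto
qed

lemma tendsto_prob_diff:
  fixes X X' :: "nat \<Rightarrow> 'a \<Rightarrow> real"
  assumes X: "tendsto_prob X Y" and X': "tendsto_prob X' Y'"
    and [measurable]: "\<And>k. X k \<in> borel_measurable M" "Y \<in> borel_measurable M"
      "\<And>k. X' k \<in> borel_measurable M" "Y' \<in> borel_measurable M"
  shows "tendsto_prob (\<lambda>k \<omega>. X k \<omega> - X' k \<omega>) (\<lambda>\<omega>. Y \<omega> - Y' \<omega>)"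
  unfolding tendsto_prob_def
proof (intro allI impI)
  fix \<delta> :: real assume "0 < \<delta>"
  let ?p = "\<lambda>k. prob {\<omega> \<in> space M. dist (X k \<omega>) (Y \<omega>) > \<delta> / 2} + prob {\<omega> \<in> space M. dist (X' k \<omega>) (Y' \<omega>) > \<delta> / 2}"
  have "?p \<longlonglongrightarrow> 0 + 0"
    using X[unfolded tendsto_prob_def, rule_format, of "\<delta> / 2"]
      X'[unfolded tendsto_prob_def, rule_format, of "\<delta> / 2"] \<open>0 < \<delta>\<close> by (intro tendsto_add) auto
  then have "?p \<longlonglongrightarrow> 0" by simp
  then show "(\<lambda>k. prob {\<omega> \<in> space M. dist (X k \<omega> - X' k \<omega>) (Y \<omega> - Y' \<omega>) > \<delta>}) \<longlonglongrightarrow> 0"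
  proof (rule tendsto_sandwich[OF _ _ tendsto_const, rotated -1], goal_cases)
    case 2
    show ?case
    proof (intro always_eventually allI)
      fix k
      have "{\<omega> \<in> space M. dist (X k \<omega> - X' k \<omega>) (Y \<omega> - Y' \<omega>) > \<delta>} \<subseteq>
         {\<omega> \<in> space M. dist (X k \<omega>) (Y \<omega>) > \<delta> / 2} \<union> {\<omega> \<in> space M. dist (X' k \<omega>) (Y' \<omega>) > \<delta> / 2}"
        by (auto simp: dist_real_def abs_if split: if_splits)
      then have "prob {\<omega> \<in> space M. dist (X k \<omega> - X' k \<omega>) (Y \<omega> - Y' \<omega>) > \<delta>} \<le>
        prob ({\<omega> \<in> space M. dist (X k \<omega>) (Y \<omega>) > \<delta> / 2} \<union> {\<omega> \<in> space M. dist (X' k \<omega>) (Y' \<omega>) > \<delta> / 2})"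
        by (intro finite_measure_mono) measurable
      also have "\<dots> \<le> ?p k" by (intro measure_Un_le) measurable
      finally show "prob {\<omega> \<in> space M. dist (X k \<omega> - X' k \<omega>) (Y \<omega> - Y' \<omega>) > \<delta>} \<le> ?p k" .
    qed
  qed auto
qed

lemma tendsto_prob_L2:
  fixes X :: "nat \<Rightarrow> 'a \<Rightarrow> real"
  assumes [measurable]: "\<And>k. X k \<in> borel_measurable M"
    and int: "\<And>k. integrable M (\<lambda>\<omega>. (X k \<omega>)\<^sup>2)" and lim: "(\<lambda>k. expectation (\<lambda>\<omega>. (X k \<omega>)\<^sup>2)) \<longlonglongrightarrow> 0"
  shows "tendsto_prob X (\<lambda>_. 0)"
  unfolding tendsto_prob_def
proof (intro allI impI)
  fix \<delta> :: real assume "0 < \<delta>"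
  have "(\<lambda>k. expectation (\<lambda>\<omega>. (X k \<omega>)\<^sup>2) / \<delta>\<^sup>2) \<longlonglongrightarrow> 0 / \<delta>\<^sup>2"
    using \<open>0 < \<delta>\<close> by (intro tendsto_divide lim) auto
  then have "(\<lambda>k. expectation (\<lambda>\<omega>. (X k \<omega>)\<^sup>2) / \<delta>\<^sup>2) \<longlonglongrightarrow> 0" by simp
  then show "(\<lambda>k. prob {\<omega> \<in> space M. dist (X k \<omega>) 0 > \<delta>}) \<longlonglongrightarrow> 0"
  proof (rule tendsto_sandwich[OF _ _ tendsto_const, rotated -1], goal_cases)
    case 2
    show ?case
    proof (intro always_eventually allI)
      fix k
      have "prob {\<omega> \<in> space M. dist (X k \<omega>) 0 > \<delta>} \<le> prob {\<omega> \<in> space M. \<delta>\<^sup>2 \<le> (X k \<omega>)\<^sup>2}"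
        using \<open>0 < \<delta>\<close> by (intro finite_measure_mono) (auto simp: abs_le_square_iff[symmetric])
      also have "\<dots> \<le> expectation (\<lambda>\<omega>. (X k \<omega>)\<^sup>2) / \<delta>\<^sup>2"
        using int[of k] \<open>0 < \<delta>\<close> by (intro integral_Markov_inequality_measure[where A="space M"]) auto
      finally show "prob {\<omega> \<in> space M. dist (X k \<omega>) 0 > \<delta>} \<le> expectation (\<lambda>\<omega>. (X k \<omega>)\<^sup>2) / \<delta>\<^sup>2" .
    qed
  qed auto
qed

text \<open>Where the two variables are \<open>\<delta>\<close>-close the Lipschitz bound applies;
  elsewhere the difference is at most 1 and the probability tends to 0.\<close>

lemma tendsto_prob_expectation_cutoff:
  fixes Y :: "'a \<Rightarrow> 'b::{metric_space, second_countable_topology}"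
  assumes X: "tendsto_prob X Y"
    and [measurable]: "\<And>k. X k \<in> borel_measurable M" "Y \<in> borel_measurable M"
  shows "(\<lambda>k. expectation (\<lambda>\<omega>. \<bar>closed_cutoff F m (X k \<omega>) - closed_cutoff F m (Y \<omega>)\<bar>)) \<longlonglongrightarrow> 0"
proof (rule LIMSEQ_I)
  let ?D = "\<lambda>k \<omega>. \<bar>closed_cutoff F m (X k \<omega>) - closed_cutoff F m (Y \<omega>)\<bar>"
  fix e :: real assume "0 < e"
  \<comment> \<open>The \<open>+ 1\<close> keeps the denominator positive when
    \<open>m = 0\<close>.\<close>
  define \<delta> where "\<delta> = e / (2 * (real m + 1))"
  have \<delta>: "0 < \<delta>" using \<open>0 < e\<close> by (simp add: \<delta>_def)
  have m\<delta>: "real m * \<delta> < e / 2" using \<open>0 < e\<close> by (simp add: \<delta>_def field_simps)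
  let ?B = "\<lambda>k. {\<omega> \<in> space M. dist (X k \<omega>) (Y \<omega>) > \<delta>}"
  obtain k0 where k0: "\<And>k. k \<ge> k0 \<Longrightarrow> norm (prob (?B k) - 0) < e / 2"
    using X \<delta> \<open>0 < e\<close> LIMSEQ_D[of "\<lambda>k. prob (?B k)" 0 "e / 2"] unfolding tendsto_prob_def by auto
  have D1: "?D k \<omega> \<le> 1" for k \<omega>
    using closed_cutoff_bounds[of F m "X k \<omega>"] closed_cutoff_bounds[of F m "Y \<omega>"] by (auto simp: abs_if)
  then have int: "integrable M (?D k)" for k
    by (intro integrable_const_bound[of _ 1] AE_I2) auto
  show "\<exists>k0. \<forall>k\<ge>k0. norm (expectation (?D k) - 0) < e"
  proof (intro exI allI impI)
    fix k assume "k0 \<le> k"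
    have "expectation (?D k) \<le> expectation (\<lambda>\<omega>. real m * \<delta> + indicator (?B k) \<omega>)"
    proof (rule integral_mono[OF int])
      show "integrable M (\<lambda>\<omega>. real m * \<delta> + indicator (?B k) \<omega>)"
        by (intro Bochner_Integration.integrable_add integrable_real_indicator) (auto simp: less_top[symmetric])
      fix \<omega> assume "\<omega> \<in> space M"
      show "?D k \<omega> \<le> real m * \<delta> + indicator (?B k) \<omega>"
      proof (cases "dist (X k \<omega>) (Y \<omega>) > \<delta>")
        case True
        then show ?thesis using D1[of k \<omega>] \<open>\<omega> \<in> space M\<close> \<delta> by (auto intro: add_increasing)
      next
        case False
        then have "real m * dist (X k \<omega>) (Y \<omega>) \<le> real m * \<delta>" by (intro mult_left_mono) auto
        then show ?thesis using closed_cutoff_Lipschitz[of F m "X k \<omega>" "Y \<omega>"] False by auto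
      qed
    qed
    also have "\<dots> = real m * \<delta> + prob (?B k)"
      by (subst Bochner_Integration.integral_add) (auto simp: less_top[symmetric] prob_space)
    also have "\<dots> < e" using k0[OF \<open>k0 \<le> k\<close>] m\<delta> by simp
    finally show "norm (expectation (?D k) - 0) < e"
      by (simp add: integral_nonneg_AE)
  qed
qed

lemma integrable_closed_cutoff:
  assumes [measurable]: "(Y :: 'a \<Rightarrow> 'b::{metric_space, second_countable_topology}) \<in> borel_measurable M"
  shows "integrable M (\<lambda>\<omega>. closed_cutoff F m (Y \<omega>))"
  using closed_cutoff_bounds[of F m] by (intro integrable_const_bound[of _ 1]) auto

lemma closed_cutoff_prod_expectation_tendsto:
  fixes Y :: "'i \<Rightarrow> 'a \<Rightarrow> 'b::{metric_space, second_countable_topology}"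
  assumes I: "finite I" and Y [measurable]: "\<And>i. i \<in> I \<Longrightarrow> Y i \<in> borel_measurable M"
    and F: "\<And>i. i \<in> I \<Longrightarrow> closed (F i)"
  shows "(\<lambda>m. expectation (\<lambda>\<omega>. \<Prod>i\<in>I. closed_cutoff (F i) m (Y i \<omega>))) \<longlonglongrightarrow> prob {\<omega> \<in> space M. \<forall>i\<in>I. Y i \<omega> \<in> F i}"
proof -
  have [measurable]: "i \<in> I \<Longrightarrow> F i \<in> sets borel" for i using F by auto
  have "(\<lambda>m. expectation (\<lambda>\<omega>. \<Prod>i\<in>I. closed_cutoff (F i) m (Y i \<omega>))) \<longlonglongrightarrow> expectation (\<lambda>\<omega>. \<Prod>i\<in>I. indicator (F i) (Y i \<omega>))"
  proof (rule integral_dominated_convergence[where w="\<lambda>_. 1"])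
    show "AE \<omega> in M. (\<lambda>m. \<Prod>i\<in>I. closed_cutoff (F i) m (Y i \<omega>)) \<longlonglongrightarrow> (\<Prod>i\<in>I. indicator (F i) (Y i \<omega>))"
      by (intro AE_I2 tendsto_prod closed_cutoff_tendsto F)
    show "AE \<omega> in M. norm (\<Prod>i\<in>I. closed_cutoff (F i) m (Y i \<omega>)) \<le> 1" for m
      by (intro AE_I2) (auto simp: abs_prod closed_cutoff_bounds intro!: prod_le_1)
  qed auto
  also have "expectation (\<lambda>\<omega>. \<Prod>i\<in>I. indicator (F i) (Y i \<omega>) :: real) = expectation (indicator {\<omega> \<in> space M. \<forall>i\<in>I. Y i \<omega> \<in> F i})"
  proof (rule Bochner_Integration.integral_cong[OF refl])
    fix \<omega> assume "\<omega> \<in> space M"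
    show "(\<Prod>i\<in>I. indicator (F i) (Y i \<omega>)) = (indicator {\<omega> \<in> space M. \<forall>i\<in>I. Y i \<omega> \<in> F i} \<omega> :: real)"
    proof (cases "\<forall>i\<in>I. Y i \<omega> \<in> F i")
      case False
      then obtain i where "i \<in> I" "indicator (F i) (Y i \<omega>) = (0::real)" by auto
      then have "(\<Prod>i\<in>I. indicator (F i) (Y i \<omega>)) = (0::real)" using I by (intro prod_zero) auto
      then show ?thesis using False by simp
    qed (auto simp: \<open>\<omega> \<in> space M\<close>)
  qed
  also have "\<dots> = prob {\<omega> \<in> space M. \<forall>i\<in>I. Y i \<omega> \<in> F i}"
    using I by simp
  finally show ?thesis .
qed

text \<open>For factors in the unit interval the difference of two products is at most the sum of
  the differences of the factors, so the one-variable case suffices.\<close>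

lemma tendsto_prob_cutoff_prod:
  fixes Y :: "'i \<Rightarrow> 'a \<Rightarrow> 'b::{metric_space, second_countable_topology}"
  assumes I: "finite I" and X: "\<And>i. i \<in> I \<Longrightarrow> tendsto_prob (\<lambda>k. X k i) (Y i)"
    and [measurable]: "\<And>k i. i \<in> I \<Longrightarrow> X k i \<in> borel_measurable M" "\<And>i. i \<in> I \<Longrightarrow> Y i \<in> borel_measurable M"
  shows "(\<lambda>k. expectation (\<lambda>\<omega>. \<Prod>i\<in>I. closed_cutoff (F i) m (X k i \<omega>)))
           \<longlonglongrightarrow> expectation (\<lambda>\<omega>. \<Prod>i\<in>I. closed_cutoff (F i) m (Y i \<omega>))"
proof (rule LIM_zero_cancel, rule tendsto_rabs_zero_cancel)
  let ?D = "\<lambda>k i \<omega>. \<bar>closed_cutoff (F i) m (X k i \<omega>) - closed_cutoff (F i) m (Y i \<omega>)\<bar>"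
  have int: "integrable M (\<lambda>\<omega>. \<Prod>i\<in>I. closed_cutoff (F i) m (Z i \<omega>))"
    if [measurable]: "\<And>i. i \<in> I \<Longrightarrow> Z i \<in> borel_measurable M" for Z
    by (intro integrable_const_bound[of _ 1] AE_I2) (auto simp: abs_prod closed_cutoff_bounds intro!: prod_le_1)
  have "(\<lambda>k. \<Sum>i\<in>I. expectation (?D k i)) \<longlonglongrightarrow> (\<Sum>i\<in>I. 0)"
    by (intro tendsto_sum tendsto_prob_expectation_cutoff X) auto
  then have lim: "(\<lambda>k. \<Sum>i\<in>I. expectation (?D k i)) \<longlonglongrightarrow> 0" by simp
  show "(\<lambda>k. \<bar>expectation (\<lambda>\<omega>. \<Prod>i\<in>I. closed_cutoff (F i) m (X k i \<omega>)) - expectation (\<lambda>\<omega>. \<Prod>i\<in>I. closed_cutoff (F i) m (Y i \<omega>))\<bar>) \<longlonglongrightarrow> 0"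
  proof (rule tendsto_sandwich[OF _ _ tendsto_const lim])
    show "\<forall>\<^sub>F k in sequentially. \<bar>expectation (\<lambda>\<omega>. \<Prod>i\<in>I. closed_cutoff (F i) m (X k i \<omega>)) - expectation (\<lambda>\<omega>. \<Prod>i\<in>I. closed_cutoff (F i) m (Y i \<omega>))\<bar> \<le> (\<Sum>i\<in>I. expectation (?D k i))"
    proof (intro always_eventually allI)
      fix k
      let ?d = "\<lambda>\<omega>. (\<Prod>i\<in>I. closed_cutoff (F i) m (X k i \<omega>)) - (\<Prod>i\<in>I. closed_cutoff (F i) m (Y i \<omega>))"
      have "\<bar>expectation ?d\<bar> \<le> expectation (\<lambda>\<omega>. \<bar>?d \<omega>\<bar>)"
        by (rule integral_abs_bound)
      also have "\<dots> \<le> expectation (\<lambda>\<omega>. \<Sum>i\<in>I. ?D k i \<omega>)"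
      proof (rule integral_mono)
        fix \<omega>
        show "\<bar>?d \<omega>\<bar> \<le> (\<Sum>i\<in>I. ?D k i \<omega>)"
          using norm_prod_diff[of I "\<lambda>i. closed_cutoff (F i) m (X k i \<omega>)" "\<lambda>i. closed_cutoff (F i) m (Y i \<omega>)"]
          by (auto simp: closed_cutoff_bounds)
      qed (auto intro!: int integrable_closed_cutoff Bochner_Integration.integrable_diff integrable_abs Bochner_Integration.integrable_sum)
      also have "\<dots> = (\<Sum>i\<in>I. expectation (?D k i))"
        by (intro Bochner_Integration.integral_sum integrable_abs Bochner_Integration.integrable_diff integrable_closed_cutoff) auto
      finally show "\<bar>expectation (\<lambda>\<omega>. \<Prod>i\<in>I. closed_cutoff (F i) m (X k i \<omega>)) - expectation (\<lambda>\<omega>. \<Prod>i\<in>I. closed_cutoff (F i) m (Y i \<omega>))\<bar> \<le> (\<Sum>i\<in>I. expectation (?D k i))"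
        by (subst (asm) Bochner_Integration.integral_diff) (auto intro!: int)
    qed
  qed auto
qed

text \<open>Closed sets form an intersection-stable generator, so only they are compared. The limits
  are taken in turn: first in \<open>k\<close> with the cutoff fixed, then in the sharpness
  \<open>m\<close>.\<close>

lemma distr_eq_tendsto_prob:
  fixes Y Y' :: "'a \<Rightarrow> 'b::{metric_space, second_countable_topology}"
  assumes X: "tendsto_prob X Y" and X': "tendsto_prob X' Y'"
    and [measurable]: "\<And>k. X k \<in> borel_measurable M" "\<And>k. X' k \<in> borel_measurable M"
      "Y \<in> borel_measurable M" "Y' \<in> borel_measurable M"
    and eq: "\<And>k. distr M borel (X k) = distr M borel (X' k)"
  shows "distr M borel Y = distr M borel Y'"
proof (rule measure_eqI_generator_eq[where E="Collect closed" and \<Omega>=UNIV and A="\<lambda>_. UNIV"])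
  interpret Y: prob_space "distr M borel Y" by (rule prob_space_distr) simp
  show "emeasure (distr M borel Y) UNIV \<noteq> \<infinity>" by simp
  fix F :: "'b set" assume "F \<in> Collect closed"
  then have F: "closed F" by simp
  then have [measurable]: "F \<in> sets borel" by simp
  have *: "expectation (\<lambda>\<omega>. closed_cutoff F m (Y \<omega>)) = expectation (\<lambda>\<omega>. closed_cutoff F m (Y' \<omega>))" for m
  proof (rule LIMSEQ_unique)
    show "(\<lambda>k. expectation (\<lambda>\<omega>. closed_cutoff F m (X k \<omega>))) \<longlonglongrightarrow> expectation (\<lambda>\<omega>. closed_cutoff F m (Y \<omega>))"
      using tendsto_prob_cutoff_prod[of "{()}" "\<lambda>k _. X k" "\<lambda>_. Y" "\<lambda>_. F" m] X by simp
    have "expectation (\<lambda>\<omega>. closed_cutoff F m (X k \<omega>)) = expectation (\<lambda>\<omega>. closed_cutoff F m (X' k \<omega>))" for k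
      using integral_distr[of "X k" M borel "closed_cutoff F m"] integral_distr[of "X' k" M borel "closed_cutoff F m"] eq[of k] by simp
    then show "(\<lambda>k. expectation (\<lambda>\<omega>. closed_cutoff F m (X k \<omega>))) \<longlonglongrightarrow> expectation (\<lambda>\<omega>. closed_cutoff F m (Y' \<omega>))"
      using tendsto_prob_cutoff_prod[of "{()}" "\<lambda>k _. X' k" "\<lambda>_. Y'" "\<lambda>_. F" m] X' by simp
  qed
  have "prob {\<omega> \<in> space M. Y \<omega> \<in> F} = prob {\<omega> \<in> space M. Y' \<omega> \<in> F}"
    using closed_cutoff_prod_expectation_tendsto[of "{()}" "\<lambda>_. Y" "\<lambda>_. F"]
      closed_cutoff_prod_expectation_tendsto[of "{()}" "\<lambda>_. Y'" "\<lambda>_. F"] F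
    by (simp add: * LIMSEQ_unique)
  then show "emeasure (distr M borel Y) F = emeasure (distr M borel Y') F"
    by (simp add: emeasure_distr emeasure_eq_measure vimage_def Int_def conj_commute)
qed (auto simp: borel_eq_closed sets_measure_of Int_stable_def)

text \<open>The product formula for expectations of cutoffs survives both limits and becomes the
  product formula for closed sets. It carries independence over to increments of the area, which are
  only limits of functions of Brownian increments.\<close>

lemma indep_vars_tendsto_prob:
  fixes Y :: "'i \<Rightarrow> 'a \<Rightarrow> 'b::{metric_space, second_countable_topology}"
  assumes I: "finite I" and X: "\<And>i. i \<in> I \<Longrightarrow> tendsto_prob (\<lambda>k. X k i) (Y i)"
    and Y [measurable]: "\<And>i. i \<in> I \<Longrightarrow> Y i \<in> borel_measurable M"
    and ind: "\<And>k. indep_vars (\<lambda>_. borel) (X k) I"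
  shows "indep_vars (\<lambda>_. borel) Y I"
proof (cases "I = {}")
  case False
  have [measurable]: "i \<in> I \<Longrightarrow> X k i \<in> borel_measurable M" for k i
    using ind[of k] by (auto simp: indep_vars_def)
  have eq: "prob {\<omega> \<in> space M. \<forall>i\<in>I. Y i \<omega> \<in> F i} = (\<Prod>i\<in>I. prob {\<omega> \<in> space M. Y i \<omega> \<in> F i})"
    if F: "\<And>i. i \<in> I \<Longrightarrow> closed (F i)" for F
  proof -
    have *: "expectation (\<lambda>\<omega>. \<Prod>i\<in>I. closed_cutoff (F i) m (Y i \<omega>)) = (\<Prod>i\<in>I. expectation (\<lambda>\<omega>. closed_cutoff (F i) m (Y i \<omega>)))" for m
    proof (rule LIMSEQ_unique)
      show "(\<lambda>k. expectation (\<lambda>\<omega>. \<Prod>i\<in>I. closed_cutoff (F i) m (X k i \<omega>))) \<longlonglongrightarrow> expectation (\<lambda>\<omega>. \<Prod>i\<in>I. closed_cutoff (F i) m (Y i \<omega>))"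
        by (intro tendsto_prob_cutoff_prod I X) auto
      have "expectation (\<lambda>\<omega>. \<Prod>i\<in>I. closed_cutoff (F i) m (X k i \<omega>)) = (\<Prod>i\<in>I. expectation (\<lambda>\<omega>. closed_cutoff (F i) m (X k i \<omega>)))" for k
        by (intro indep_vars_lebesgue_integral I integrable_closed_cutoff)
           (auto intro!: indep_vars_compose2[OF ind])
      moreover have "(\<lambda>k. expectation (\<lambda>\<omega>. closed_cutoff (F i) m (X k i \<omega>))) \<longlonglongrightarrow> expectation (\<lambda>\<omega>. closed_cutoff (F i) m (Y i \<omega>))" if "i \<in> I" for i
        using tendsto_prob_cutoff_prod[of "{i}" "\<lambda>k i. X k i" Y F m] X that by simp
      ultimately show "(\<lambda>k. expectation (\<lambda>\<omega>. \<Prod>i\<in>I. closed_cutoff (F i) m (X k i \<omega>))) \<longlonglongrightarrow> (\<Prod>i\<in>I. expectation (\<lambda>\<omega>. closed_cutoff (F i) m (Y i \<omega>)))"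
        by (auto intro!: tendsto_prod)
    qed
    show ?thesis
    proof (rule LIMSEQ_unique)
      show "(\<lambda>m. expectation (\<lambda>\<omega>. \<Prod>i\<in>I. closed_cutoff (F i) m (Y i \<omega>))) \<longlonglongrightarrow> prob {\<omega> \<in> space M. \<forall>i\<in>I. Y i \<omega> \<in> F i}"
        by (intro closed_cutoff_prod_expectation_tendsto I F) auto
      have "(\<lambda>m. expectation (\<lambda>\<omega>. closed_cutoff (F i) m (Y i \<omega>))) \<longlonglongrightarrow> prob {\<omega> \<in> space M. Y i \<omega> \<in> F i}" if "i \<in> I" for i
        using closed_cutoff_prod_expectation_tendsto[of "{i}" Y F] F that by simp
      then show "(\<lambda>m. expectation (\<lambda>\<omega>. \<Prod>i\<in>I. closed_cutoff (F i) m (Y i \<omega>))) \<longlonglongrightarrow> (\<Prod>i\<in>I. prob {\<omega> \<in> space M. Y i \<omega> \<in> F i})"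
        unfolding * by (rule tendsto_prod)
    qed
  qed
  show ?thesis
  proof (subst indep_vars_finite[where E="\<lambda>_. Collect closed"])
    show "\<forall>A\<in>\<Pi> i\<in>I. Collect closed. prob (\<Inter>j\<in>I. Y j -` A j \<inter> space M) = (\<Prod>j\<in>I. prob (Y j -` A j \<inter> space M))"
    proof
      fix A :: "'i \<Rightarrow> 'b set" assume A: "A \<in> (\<Pi> i\<in>I. Collect closed)"
      have "(\<Inter>j\<in>I. Y j -` A j \<inter> space M) = {\<omega> \<in> space M. \<forall>i\<in>I. Y i \<omega> \<in> A i}" using False by auto
      moreover have "Y j -` A j \<inter> space M = {\<omega> \<in> space M. Y j \<omega> \<in> A j}" for j by auto
      ultimately show "prob (\<Inter>j\<in>I. Y j -` A j \<inter> space M) = (\<Prod>j\<in>I. prob (Y j -` A j \<inter> space M))"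
        using eq[of A] A by (auto simp: Pi_iff)
    qed
  qed (use False I Y in \<open>auto simp: borel_eq_closed sets_measure_of Int_stable_def\<close>)
qed (simp add: indep_vars_def indep_sets_def)

text \<open>The joint law of an independent family is the product of its marginals, so it suffices
  to match these. Stationarity and scaling of the lifted path are both obtained with a product of
  increments as \<open>\<Phi>\<close>.\<close>

lemma distr_indep_cong:
  assumes X: "indep_vars N X I" and Y: "indep_vars N Y I"
    and eq: "\<And>i. i \<in> I \<Longrightarrow> distr M (N i) (X i) = distr M (N i) (Y i)"
    and \<Phi> [measurable]: "\<Phi> \<in> measurable (PiM I N) K"
  shows "distr M K (\<lambda>\<omega>. \<Phi> (\<lambda>i\<in>I. X i \<omega>)) = distr M K (\<lambda>\<omega>. \<Phi> (\<lambda>i\<in>I. Y i \<omega>))"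
proof (cases "I = {}")
  case True
  have "(\<lambda>\<omega>. \<Phi> (\<lambda>i\<in>I. X i \<omega>)) = (\<lambda>\<omega>. \<Phi> (\<lambda>i\<in>I. Y i \<omega>))" by (simp add: True restrict_def)
  then show ?thesis by simp
next
  case False
  have rX [measurable]: "i \<in> I \<Longrightarrow> X i \<in> measurable M (N i)" and rY [measurable]: "i \<in> I \<Longrightarrow> Y i \<in> measurable M (N i)" for i
    using X Y by (auto simp: indep_vars_def)
  have "distr M (PiM I N) (\<lambda>\<omega>. \<lambda>i\<in>I. X i \<omega>) = PiM I (\<lambda>i. distr M (N i) (X i))"
    using X indep_vars_iff_distr_eq_PiM'[OF False rX] by auto
  also have "\<dots> = PiM I (\<lambda>i. distr M (N i) (Y i))"
    using eq by (intro PiM_cong) auto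
  also have "\<dots> = distr M (PiM I N) (\<lambda>\<omega>. \<lambda>i\<in>I. Y i \<omega>)"
    using Y indep_vars_iff_distr_eq_PiM'[OF False rY] by auto
  finally have "distr (distr M (PiM I N) (\<lambda>\<omega>. \<lambda>i\<in>I. X i \<omega>)) K \<Phi> = distr (distr M (PiM I N) (\<lambda>\<omega>. \<lambda>i\<in>I. Y i \<omega>)) K \<Phi>"
    by simp
  then show ?thesis
    by (simp add: distr_distr comp_def)
qed

end

subsection \<open>Planar Brownian motion and its area increments\<close>

lemma borel_measurable_fst_snd [measurable]:
  "fst \<in> borel_measurable (borel :: ('b::topological_space \<times> 'c::topological_space) measure)"
  "snd \<in> borel_measurable (borel :: ('b \<times> 'c) measure)"
  by (auto intro!: borel_measurable_continuous_onI continuous_intros)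

definition normal_measure :: "real \<Rightarrow> real measure" where
  "normal_measure \<sigma> = density lborel (\<lambda>x. ennreal (normal_density 0 \<sigma> x))"

lemma sets_normal_measure [simp, measurable_cong]: "sets (normal_measure \<sigma>) = sets borel"
  and space_normal_measure [simp]: "space (normal_measure \<sigma>) = UNIV"
  by (simp_all add: normal_measure_def)

lemma prob_space_normal_measure: "0 < \<sigma> \<Longrightarrow> prob_space (normal_measure \<sigma>)"
  unfolding normal_measure_def by (rule prob_space_normal_density)

lemma normal_measure_scale:
  assumes "0 < \<sigma>" "0 < r"
  shows "normal_measure (r * \<sigma>) = distr (normal_measure \<sigma>) borel (\<lambda>x. r * x)"
proof -
  interpret prob_space "normal_measure \<sigma>" using assms(1) by (rule prob_space_normal_measure)
  have "distr (normal_measure \<sigma>) lborel (\<lambda>x. x) = distr (normal_measure \<sigma>) (normal_measure \<sigma>) (\<lambda>x. x)"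
    by (intro distr_cong) auto
  then have "distributed (normal_measure \<sigma>) lborel (\<lambda>x. x) (\<lambda>x. ennreal (normal_density 0 \<sigma> x))"
    unfolding distributed_def by (auto simp: distr_id2 normal_measure_def)
  from normal_density_affine[OF this, of r 0] assms
  have "distr (normal_measure \<sigma>) lborel (\<lambda>x. r * x) = normal_measure (r * \<sigma>)"
    by (simp add: distributed_def normal_measure_def)
  moreover have "distr (normal_measure \<sigma>) lborel (\<lambda>x. r * x) = distr (normal_measure \<sigma>) borel (\<lambda>x. r * x)"
    by (intro distr_cong) auto
  ultimately show ?thesis by simp
qed

lemma (in prob_space) normal_distributed_moments:
  assumes \<sigma>: "0 < \<sigma>" and X: "distributed M lborel X (\<lambda>x. ennreal (normal_density 0 \<sigma> x))"
  shows "integrable M X" "expectation X = 0"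
    and "integrable M (\<lambda>\<omega>. (X \<omega>)\<^sup>2)" "expectation (\<lambda>\<omega>. (X \<omega>)\<^sup>2) = \<sigma>\<^sup>2"
    and "integrable M (\<lambda>\<omega>. (X \<omega>) ^ 4)" "expectation (\<lambda>\<omega>. (X \<omega>) ^ 4) = 3 * \<sigma> ^ 4"
proof -
  have m1: "has_bochner_integral lborel (\<lambda>x. normal_density 0 \<sigma> x * x) 0"
    using normal_moment_odd[where \<mu>=0 and \<sigma>=\<sigma> and k=0] \<sigma> by simp
  have m2: "has_bochner_integral lborel (\<lambda>x. normal_density 0 \<sigma> x * x\<^sup>2) (\<sigma>\<^sup>2)"
  proof -
    have "fact (2 * 1) / ((2 / \<sigma>\<^sup>2) ^ 1 * fact 1) = \<sigma>\<^sup>2"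
      using \<sigma> by (simp add: field_simps)
    then show ?thesis using normal_moment_even[of \<sigma> 0 1] \<sigma> by simp
  qed
  have m4: "has_bochner_integral lborel (\<lambda>x. normal_density 0 \<sigma> x * x ^ 4) (3 * \<sigma> ^ 4)"
  proof -
    have "fact (2 * 2) / ((2 / \<sigma>\<^sup>2) ^ 2 * fact 2) = 3 * \<sigma> ^ 4"
      using \<sigma> by (simp add: field_simps fact_numeral)
    then show ?thesis using normal_moment_even[of \<sigma> 0 2] \<sigma> by simp
  qed
  note * = distributed_integrable[OF X] distributed_integral[OF X]
  show "integrable M X" "expectation X = 0"
    using m1 *(1)[of "\<lambda>x. x"] *(2)[of "\<lambda>x. x"] by (auto simp: has_bochner_integral_iff)
  show "integrable M (\<lambda>\<omega>. (X \<omega>)\<^sup>2)" "expectation (\<lambda>\<omega>. (X \<omega>)\<^sup>2) = \<sigma>\<^sup>2"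
    using m2 *(1)[of "\<lambda>x. x\<^sup>2"] *(2)[of "\<lambda>x. x\<^sup>2"] by (auto simp: has_bochner_integral_iff)
  show "integrable M (\<lambda>\<omega>. (X \<omega>) ^ 4)" "expectation (\<lambda>\<omega>. (X \<omega>) ^ 4) = 3 * \<sigma> ^ 4"
    using m4 *(1)[of "\<lambda>x. x ^ 4"] *(2)[of "\<lambda>x. x ^ 4"] by (auto simp: has_bochner_integral_iff)
qed

locale planar_bm =
  fixes M :: "'a measure" and W :: "real \<Rightarrow> 'a \<Rightarrow> real \<times> real"
  assumes bm: "brownian_motion_2d M W"
begin

sublocale prob_space M
  using bm by (simp add: brownian_motion_2d_def)

lemma W_meas [measurable]: "W t \<in> borel_measurable M"
  and W_0: "\<omega> \<in> space M \<Longrightarrow> W 0 \<omega> = 0"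
  and W_cont: "\<omega> \<in> space M \<Longrightarrow> continuous_on {0..} (\<lambda>t. W t \<omega>)"
  using bm by (auto simp: brownian_motion_2d_def zero_prod_def)

lemma W_indep:
  assumes "0 < h" "0 \<le> a"
  shows "indep_vars (\<lambda>_. borel) (\<lambda>i \<omega>. W (a + real (Suc i) * h) \<omega> - W (a + real i * h) \<omega>) {..<n}"
proof -
  have "\<forall>(ts :: nat \<Rightarrow> real) n. 0 \<le> ts 0 \<and> (\<forall>i<n. ts i < ts (Suc i)) \<longrightarrow>
        indep_vars (\<lambda>_. borel) (\<lambda>i \<omega>. W (ts (Suc i)) \<omega> - W (ts i) \<omega>) {..<n}"
    using bm by (simp add: brownian_motion_2d_def)
  from this[rule_format, of "\<lambda>i. a + real i * h" n] show ?thesis using assms by auto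
qed

lemma distr_increment:
  assumes "0 \<le> s" "s < t"
  shows "distr M (borel \<Otimes>\<^sub>M borel) (\<lambda>\<omega>. W t \<omega> - W s \<omega>) = normal_measure (sqrt (t - s)) \<Otimes>\<^sub>M normal_measure (sqrt (t - s))"
proof -
  let ?\<sigma> = "sqrt (t - s)" and ?\<nu> = "normal_measure (sqrt (t - s))"
  interpret N: prob_space ?\<nu> using assms by (intro prob_space_normal_measure) simp
  have "distributed M (lborel \<Otimes>\<^sub>M lborel) (\<lambda>\<omega>. W t \<omega> - W s \<omega>)
          (\<lambda>(x, y). ennreal (normal_density 0 ?\<sigma> x * normal_density 0 ?\<sigma> y))"
    using bm assms by (simp add: brownian_motion_2d_def)
  then have "distr M (lborel \<Otimes>\<^sub>M lborel) (\<lambda>\<omega>. W t \<omega> - W s \<omega>)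
     = density (lborel \<Otimes>\<^sub>M lborel) (\<lambda>(x, y). ennreal (normal_density 0 ?\<sigma> x * normal_density 0 ?\<sigma> y))"
    by (rule distributed_distr_eq_density)
  also have "\<dots> = density (lborel \<Otimes>\<^sub>M lborel) (\<lambda>(x, y). ennreal (normal_density 0 ?\<sigma> x) * ennreal (normal_density 0 ?\<sigma> y))"
    by (simp add: ennreal_mult)
  also have "\<dots> = ?\<nu> \<Otimes>\<^sub>M ?\<nu>"
    unfolding normal_measure_def
    by (intro pair_measure_density[symmetric] lborel.sigma_finite_measure_axioms)
      (auto intro: N.sigma_finite_measure_axioms[unfolded normal_measure_def])
  finally show ?thesis
    by (subst distr_cong[OF refl _ refl, of _ "lborel \<Otimes>\<^sub>M lborel"]) (auto intro!: sets_pair_measure_cong)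
qed

lemma distr_increment_scale:
  assumes "0 \<le> s" "s < t" "0 \<le> s'" "s' < t'" "0 < r" "t - s = r\<^sup>2 * (t' - s')"
  shows "distr M borel (\<lambda>\<omega>. W t \<omega> - W s \<omega>) = distr M borel (\<lambda>\<omega>. r *\<^sub>R (W t' \<omega> - W s' \<omega>))"
proof -
  let ?\<nu> = "normal_measure (sqrt (t - s))" and ?\<nu>' = "normal_measure (sqrt (t' - s'))"
  interpret N: prob_space ?\<nu> using assms by (intro prob_space_normal_measure) simp
  interpret N': prob_space ?\<nu>' using assms by (intro prob_space_normal_measure) simp
  have \<sigma>: "sqrt (t - s) = r * sqrt (t' - s')" using assms by (simp add: real_sqrt_mult)
  have eq: "?\<nu> = distr ?\<nu>' borel (\<lambda>x. r * x)"
    unfolding \<sigma> using assms by (intro normal_measure_scale) auto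
  have W: "(\<lambda>\<omega>. W t' \<omega> - W s' \<omega>) \<in> measurable M (borel \<Otimes>\<^sub>M borel)"
    unfolding borel_prod by measurable
  have "distr M (borel \<Otimes>\<^sub>M borel) (\<lambda>\<omega>. r *\<^sub>R (W t' \<omega> - W s' \<omega>))
      = distr (distr M (borel \<Otimes>\<^sub>M borel) (\<lambda>\<omega>. W t' \<omega> - W s' \<omega>)) (borel \<Otimes>\<^sub>M borel) (\<lambda>(x, y). (r * x, r * y))"
    using W by (subst distr_distr) (auto simp: comp_def scaleR_prod_def split_beta)
  also have "\<dots> = distr (?\<nu>' \<Otimes>\<^sub>M ?\<nu>') (borel \<Otimes>\<^sub>M borel) (\<lambda>(x, y). (r * x, r * y))"
    using assms by (simp add: distr_increment)
  also have "\<dots> = distr ?\<nu>' borel (\<lambda>x. r * x) \<Otimes>\<^sub>M distr ?\<nu>' borel (\<lambda>x. r * x)"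
    using eq N.sigma_finite_measure_axioms by (intro pair_measure_distr[symmetric]) auto
  also have "\<dots> = distr M (borel \<Otimes>\<^sub>M borel) (\<lambda>\<omega>. W t \<omega> - W s \<omega>)"
    using assms by (simp add: distr_increment flip: eq)
  finally show ?thesis by (simp add: borel_prod)
qed

lemma distributed_increment:
  assumes "0 \<le> s" "s < t"
  shows "distributed M lborel (\<lambda>\<omega>. fst (W t \<omega> - W s \<omega>)) (\<lambda>x. ennreal (normal_density 0 (sqrt (t - s)) x))" (is ?A)
    and "distributed M lborel (\<lambda>\<omega>. snd (W t \<omega> - W s \<omega>)) (\<lambda>x. ennreal (normal_density 0 (sqrt (t - s)) x))" (is ?B)
proof -
  let ?\<nu> = "normal_measure (sqrt (t - s))"
  interpret N: prob_space ?\<nu> using assms by (intro prob_space_normal_measure) simp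
  interpret NN: pair_prob_space ?\<nu> ?\<nu> ..
  have W: "(\<lambda>\<omega>. W t \<omega> - W s \<omega>) \<in> measurable M (borel \<Otimes>\<^sub>M borel)"
    unfolding borel_prod by measurable
  have "distr M borel (\<lambda>\<omega>. fst (W t \<omega> - W s \<omega>)) = ?\<nu>"
  proof (rule measure_eqI)
    fix B assume "B \<in> sets (distr M borel (\<lambda>\<omega>. fst (W t \<omega> - W s \<omega>)))"
    then have [measurable]: "B \<in> sets borel" by simp
    have "emeasure (distr M borel (\<lambda>\<omega>. fst (W t \<omega> - W s \<omega>))) B
       = emeasure (distr M (borel \<Otimes>\<^sub>M borel) (\<lambda>\<omega>. W t \<omega> - W s \<omega>)) (B \<times> UNIV)"
      using W by (subst (1 2) emeasure_distr) (simp_all add: vimage_def mem_Times_iff)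
    also have "\<dots> = emeasure ?\<nu> B"
      using assms N.emeasure_space_1 by (simp add: distr_increment N.emeasure_pair_measure_Times)
    finally show "emeasure (distr M borel (\<lambda>\<omega>. fst (W t \<omega> - W s \<omega>))) B = emeasure ?\<nu> B" .
  qed simp
  moreover have "distr M lborel (\<lambda>\<omega>. fst (W t \<omega> - W s \<omega>)) = distr M borel (\<lambda>\<omega>. fst (W t \<omega> - W s \<omega>))"
    by (intro distr_cong) auto
  ultimately show ?A unfolding distributed_def by (auto simp: normal_measure_def)
  have "distr M borel (\<lambda>\<omega>. snd (W t \<omega> - W s \<omega>)) = ?\<nu>"
  proof (rule measure_eqI)
    fix B assume "B \<in> sets (distr M borel (\<lambda>\<omega>. snd (W t \<omega> - W s \<omega>)))"
    then have [measurable]: "B \<in> sets borel" by simp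
    have "emeasure (distr M borel (\<lambda>\<omega>. snd (W t \<omega> - W s \<omega>))) B
       = emeasure (distr M (borel \<Otimes>\<^sub>M borel) (\<lambda>\<omega>. W t \<omega> - W s \<omega>)) (UNIV \<times> B)"
      using W by (subst (1 2) emeasure_distr) (simp_all add: vimage_def mem_Times_iff)
    also have "\<dots> = emeasure ?\<nu> B"
      using assms N.emeasure_space_1 by (simp add: distr_increment N.emeasure_pair_measure_Times)
    finally show "emeasure (distr M borel (\<lambda>\<omega>. snd (W t \<omega> - W s \<omega>))) B = emeasure ?\<nu> B" .
  qed simp
  moreover have "distr M lborel (\<lambda>\<omega>. snd (W t \<omega> - W s \<omega>)) = distr M borel (\<lambda>\<omega>. snd (W t \<omega> - W s \<omega>))"
    by (intro distr_cong) auto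
  ultimately show ?B unfolding distributed_def by (auto simp: normal_measure_def)
qed

lemma increment_moments:
  assumes "0 \<le> s" "s \<le> t"
  shows "integrable M (\<lambda>\<omega>. fst (W t \<omega> - W s \<omega>))" "expectation (\<lambda>\<omega>. fst (W t \<omega> - W s \<omega>)) = 0"
    "integrable M (\<lambda>\<omega>. snd (W t \<omega> - W s \<omega>))" "expectation (\<lambda>\<omega>. snd (W t \<omega> - W s \<omega>)) = 0"
    "integrable M (\<lambda>\<omega>. (fst (W t \<omega> - W s \<omega>))\<^sup>2)" "expectation (\<lambda>\<omega>. (fst (W t \<omega> - W s \<omega>))\<^sup>2) = t - s"
    "integrable M (\<lambda>\<omega>. (snd (W t \<omega> - W s \<omega>))\<^sup>2)" "expectation (\<lambda>\<omega>. (snd (W t \<omega> - W s \<omega>))\<^sup>2) = t - s"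
proof -
  have "integrable M (\<lambda>\<omega>. fst (W t \<omega> - W s \<omega>)) \<and> expectation (\<lambda>\<omega>. fst (W t \<omega> - W s \<omega>)) = 0 \<and>
    integrable M (\<lambda>\<omega>. snd (W t \<omega> - W s \<omega>)) \<and> expectation (\<lambda>\<omega>. snd (W t \<omega> - W s \<omega>)) = 0 \<and>
    integrable M (\<lambda>\<omega>. (fst (W t \<omega> - W s \<omega>))\<^sup>2) \<and> expectation (\<lambda>\<omega>. (fst (W t \<omega> - W s \<omega>))\<^sup>2) = t - s \<and>
    integrable M (\<lambda>\<omega>. (snd (W t \<omega> - W s \<omega>))\<^sup>2) \<and> expectation (\<lambda>\<omega>. (snd (W t \<omega> - W s \<omega>))\<^sup>2) = t - s"
  proof (cases "s = t")
    case False
    then have "s < t" using assms by simp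
    then show ?thesis
      using normal_distributed_moments(1-4)[OF _ distributed_increment(1)[OF assms(1) \<open>s < t\<close>]]
        normal_distributed_moments(1-4)[OF _ distributed_increment(2)[OF assms(1) \<open>s < t\<close>]]
      by (intro conjI) auto
  qed auto
  then show "integrable M (\<lambda>\<omega>. fst (W t \<omega> - W s \<omega>))" "expectation (\<lambda>\<omega>. fst (W t \<omega> - W s \<omega>)) = 0"
    "integrable M (\<lambda>\<omega>. snd (W t \<omega> - W s \<omega>))" "expectation (\<lambda>\<omega>. snd (W t \<omega> - W s \<omega>)) = 0"
    "integrable M (\<lambda>\<omega>. (fst (W t \<omega> - W s \<omega>))\<^sup>2)" "expectation (\<lambda>\<omega>. (fst (W t \<omega> - W s \<omega>))\<^sup>2) = t - s"
    "integrable M (\<lambda>\<omega>. (snd (W t \<omega> - W s \<omega>))\<^sup>2)" "expectation (\<lambda>\<omega>. (snd (W t \<omega> - W s \<omega>))\<^sup>2) = t - s"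
    by blast+
qed

lemma increment_fourth_moment:
  "integrable M (\<lambda>\<omega>. fst (W 1 \<omega>) ^ 4)" "expectation (\<lambda>\<omega>. fst (W 1 \<omega>) ^ 4) = 3"
  "integrable M (\<lambda>\<omega>. snd (W 1 \<omega>) ^ 4)" "expectation (\<lambda>\<omega>. snd (W 1 \<omega>) ^ 4) = 3"
  using normal_distributed_moments(5,6)[OF _ distributed_increment(1)[of 0 1]]
    normal_distributed_moments(5,6)[OF _ distributed_increment(2)[of 0 1]]
  by (simp_all add: W_0 cong: Bochner_Integration.integrable_cong Bochner_Integration.integral_cong)

text \<open>The Gaussian density is positive everywhere, so the square of side
  \<open>\<delta>\<close> centred at \<open>w\<close>, which lies in the disc, has positive
  mass.\<close>

lemma W_1_support:
  assumes "0 < \<delta>"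
  shows "0 < prob {\<omega> \<in> space M. norm (W 1 \<omega> - w) < \<delta>}"
proof -
  define I where "I c = {c - \<delta> / 2 <..< c + \<delta> / 2}" for c :: real
  interpret N: prob_space "normal_measure 1" by (intro prob_space_normal_measure) simp
  have pos: "0 < emeasure (normal_measure 1) (I c)" for c
  proof -
    have "\<not> (AE x in lborel. ennreal (normal_density 0 1 x) * indicator (I c) x = 0)"
    proof
      assume "AE x in lborel. ennreal (normal_density 0 1 x) * indicator (I c) x = 0"
      then have "AE x in lborel. x \<notin> I c"
        by eventually_elim (use normal_density_pos[of 1 0] in \<open>auto simp: indicator_def less_le split: if_splits\<close>)
      then have "emeasure lborel (I c) = 0"
        by (subst (asm) AE_iff_measurable[of "I c"]) (auto simp: I_def)
      then show False using assms by (simp add: I_def)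
    qed
    then have "emeasure (normal_measure 1) (I c) \<noteq> 0"
      unfolding normal_measure_def
      by (subst emeasure_density) (auto simp: I_def nn_integral_0_iff_AE)
    then show ?thesis by (simp add: zero_less_iff_neq_zero)
  qed
  have W1: "(\<lambda>\<omega>. W 1 \<omega> - W 0 \<omega>) \<in> measurable M (borel \<Otimes>\<^sub>M borel)"
    unfolding borel_prod by measurable
  have "0 < emeasure (normal_measure 1) (I (fst w)) * emeasure (normal_measure 1) (I (snd w))"
    using pos by (simp add: ennreal_zero_less_mult_iff)
  also have "\<dots> = emeasure (normal_measure 1 \<Otimes>\<^sub>M normal_measure 1) (I (fst w) \<times> I (snd w))"
    by (intro N.emeasure_pair_measure_Times[symmetric]) (auto simp: I_def)
  also have "\<dots> = emeasure (distr M (borel \<Otimes>\<^sub>M borel) (\<lambda>\<omega>. W 1 \<omega> - W 0 \<omega>)) (I (fst w) \<times> I (snd w))"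
    using distr_increment[of 0 1] by simp
  also have "\<dots> = emeasure M ((\<lambda>\<omega>. W 1 \<omega> - W 0 \<omega>) -` (I (fst w) \<times> I (snd w)) \<inter> space M)"
    by (intro emeasure_distr W1) (auto simp: I_def)
  also have "\<dots> \<le> emeasure M {\<omega> \<in> space M. norm (W 1 \<omega> - w) < \<delta>}"
  proof (rule emeasure_mono)
    show "(\<lambda>\<omega>. W 1 \<omega> - W 0 \<omega>) -` (I (fst w) \<times> I (snd w)) \<inter> space M \<subseteq> {\<omega> \<in> space M. norm (W 1 \<omega> - w) < \<delta>}"
    proof
      fix \<omega> assume "\<omega> \<in> (\<lambda>\<omega>. W 1 \<omega> - W 0 \<omega>) -` (I (fst w) \<times> I (snd w)) \<inter> space M"
      then have \<omega>: "\<omega> \<in> space M" "W 1 \<omega> - W 0 \<omega> \<in> I (fst w) \<times> I (snd w)" by simp_all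
      then have "\<bar>fst (W 1 \<omega> - w)\<bar> < \<delta> / 2" "\<bar>snd (W 1 \<omega> - w)\<bar> < \<delta> / 2"
        by (auto simp: W_0 I_def mem_Times_iff abs_if)
      moreover have "norm (W 1 \<omega> - w) \<le> norm (fst (W 1 \<omega> - w)) + norm (snd (W 1 \<omega> - w))"
        by (metis norm_Pair_le prod.collapse)
      ultimately show "\<omega> \<in> {\<omega> \<in> space M. norm (W 1 \<omega> - w) < \<delta>}" using \<omega> by simp
    qed
  qed measurable
  finally show ?thesis by (simp add: emeasure_eq_measure)
qed

end

lemma borel_measurable_omega2 [measurable (raw)]:
  fixes f g :: "'b \<Rightarrow> real \<times> real"
  assumes "f \<in> borel_measurable N" "g \<in> borel_measurable N"
  shows "(\<lambda>x. omega2 (f x) (g x)) \<in> borel_measurable N"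
  by (rule borel_measurable_continuous_Pair[OF assms]) (intro continuous_intros)

section \<open>Riemann sums of the area in \<open>L^2\<close>\<close>

context planar_bm
begin

abbreviation W_incr :: "real \<Rightarrow> nat \<Rightarrow> 'a \<Rightarrow> real \<times> real" where
  "W_incr h l \<omega> \<equiv> W (real (Suc l) * h) \<omega> - W (real l * h) \<omega>"

lemma sum_W_incr: "c \<le> l \<Longrightarrow> (\<Sum>i\<in>{c..<l}. W_incr h i \<omega>) = W (real l * h) \<omega> - W (real c * h) \<omega>"
  using sum_Suc_diff'[of c l "\<lambda>i. W (real i * h) \<omega>"] by simp

lemma indep_past_W_incr:
  assumes "0 < h" and [measurable]: "\<psi> \<in> borel_measurable (PiM {..<n} (\<lambda>_. borel))" "\<phi> \<in> borel_measurable borel"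
  shows "indep_var borel (\<lambda>\<omega>. \<psi> (\<lambda>i\<in>{..<n}. W_incr h i \<omega>) :: real) borel (\<lambda>\<omega>. \<phi> (W_incr h n \<omega>) :: real)"
proof -
  have "indep_vars (\<lambda>_. borel) (W_incr h) {..<Suc n}"
    using W_indep[of h 0 "Suc n"] assms(1) by simp
  then have "indep_var (PiM {..<n} (\<lambda>_. borel)) (\<lambda>\<omega>. restrict (\<lambda>i. W_incr h i \<omega>) {..<n})
     (PiM {n} (\<lambda>_. borel)) (\<lambda>\<omega>. restrict (\<lambda>i. W_incr h i \<omega>) {n})"
    by (rule indep_var_restrict) auto
  from indep_var_compose[OF this, of \<psi> borel "\<lambda>v. \<phi> (v n)" borel]
  show ?thesis by (simp add: comp_def)
qed

text \<open>Martingale differences: each summand is bilinear in an increment and an independent past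
  increment, so the second moments add up.\<close>

lemma area_sum_L2:
  assumes h: "0 < h" and c: "\<And>l. c l \<le> l"
  defines "D \<equiv> \<lambda>n \<omega>. \<Sum>l<n. omega2 (W (real l * h) \<omega> - W (real (c l) * h) \<omega>) (W_incr h l \<omega>)"
  shows "integrable M (\<lambda>\<omega>. (D n \<omega>)\<^sup>2) \<and> expectation (\<lambda>\<omega>. (D n \<omega>)\<^sup>2) \<le> (\<Sum>l<n. 4 * (real l - real (c l)) * h\<^sup>2)"
proof (induction n)
  case 0
  then show ?case by (simp add: D_def)
next
  case (Suc n)
  define d where "d = D n"
  define r where "r \<omega> = fst (W (real n * h) \<omega> - W (real (c n) * h) \<omega>)" for \<omega>
  define s where "s \<omega> = snd (W (real n * h) \<omega> - W (real (c n) * h) \<omega>)" for \<omega>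
  define x where "x \<omega> = fst (W_incr h n \<omega>)" for \<omega>
  define y where "y \<omega> = snd (W_incr h n \<omega>)" for \<omega>
  define e where "e \<omega> = r \<omega> * y \<omega> - s \<omega> * x \<omega>" for \<omega>
  have [measurable]: "d \<in> borel_measurable M" "r \<in> borel_measurable M" "s \<in> borel_measurable M"
    "x \<in> borel_measurable M" "y \<in> borel_measurable M" "e \<in> borel_measurable M"
    unfolding d_def D_def r_def s_def x_def y_def e_def by measurable
  have int_d: "integrable M (\<lambda>\<omega>. (d \<omega>)\<^sup>2)" using Suc.IH by (simp add: d_def)
  have cn: "real (c n) * h \<le> real n * h" using c[of n] h by (intro mult_right_mono) auto
  note rs = increment_moments(5-8)[of "real (c n) * h" "real n * h", OF _ cn]
  have int_r: "integrable M (\<lambda>\<omega>. (r \<omega>)\<^sup>2)" and E_r: "expectation (\<lambda>\<omega>. (r \<omega>)\<^sup>2) = real n * h - real (c n) * h"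
   and int_s: "integrable M (\<lambda>\<omega>. (s \<omega>)\<^sup>2)" and E_s: "expectation (\<lambda>\<omega>. (s \<omega>)\<^sup>2) = real n * h - real (c n) * h"
    using rs h by (simp_all add: r_def s_def)
  have nS: "real n * h \<le> real (Suc n) * h" using h by (intro mult_right_mono) auto
  note xy = increment_moments[of "real n * h" "real (Suc n) * h", OF _ nS]
  have xy1: "integrable M x" "expectation x = 0" "integrable M y" "expectation y = 0"
    and xy2: "integrable M (\<lambda>\<omega>. (x \<omega>)\<^sup>2)" "expectation (\<lambda>\<omega>. (x \<omega>)\<^sup>2) = h" "integrable M (\<lambda>\<omega>. (y \<omega>)\<^sup>2)" "expectation (\<lambda>\<omega>. (y \<omega>)\<^sup>2) = h"
    using xy h by (simp_all add: x_def [abs_def] y_def [abs_def] algebra_simps)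
  \<comment> \<open>\<open>P\<close> and \<open>\<Delta>\<close> rewrite \<open>r\<close>,
    \<open>s\<close> and \<open>d\<close> as functions of the first \<open>n\<close> increments, so
    that the next increment is independent of all three jointly.\<close>
  define P where "P v l = (\<Sum>i\<in>{c l..<l}. v i :: real \<times> real)" for v :: "nat \<Rightarrow> real \<times> real" and l
  have P: "P (\<lambda>i\<in>{..<n}. W_incr h i \<omega>) l = W (real l * h) \<omega> - W (real (c l) * h) \<omega>" if "l \<le> n" for \<omega> l
    using that c[of l] by (simp add: P_def sum_W_incr del: of_nat_Suc)
  define \<Delta> where "\<Delta> v = (\<Sum>l<n. omega2 (P v l) (v l))" for v
  have \<Delta>: "\<Delta> (\<lambda>i\<in>{..<n}. W_incr h i \<omega>) = d \<omega>" for \<omega>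
    unfolding \<Delta>_def d_def D_def by (intro sum.cong refl) (auto simp: P simp del: of_nat_Suc)
  have v_meas [measurable]: "(\<lambda>v. v i) \<in> borel_measurable (PiM {..<n} (\<lambda>_. borel))" if "i < n" for i
    using that by (intro measurable_component_singleton) auto
  have P_meas: "(\<lambda>v. P v l) \<in> borel_measurable (PiM {..<n} (\<lambda>_. borel))" if "l \<le> n" for l
    unfolding P_def using that by (intro borel_measurable_sum v_meas) auto
  have \<Delta>_meas [measurable]: "\<Delta> \<in> borel_measurable (PiM {..<n} (\<lambda>_. borel))"
    unfolding \<Delta>_def by (intro borel_measurable_sum borel_measurable_omega2 P_meas v_meas) auto
  have ind: "indep_var borel (\<lambda>\<omega>. \<psi> (d \<omega>) (r \<omega>) (s \<omega>)) borel (\<lambda>\<omega>. \<phi> (x \<omega>) (y \<omega>))"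
    if [measurable]: "(\<lambda>(a, b, c). \<psi> a b c) \<in> borel_measurable (borel \<Otimes>\<^sub>M borel \<Otimes>\<^sub>M borel)"
      "(\<lambda>(a, b). \<phi> a b) \<in> borel_measurable (borel \<Otimes>\<^sub>M borel)" for \<psi> :: "real \<Rightarrow> real \<Rightarrow> real \<Rightarrow> real" and \<phi> :: "real \<Rightarrow> real \<Rightarrow> real"
  proof -
    have "(\<lambda>v. (\<Delta> v, fst (P v n), snd (P v n))) \<in> measurable (PiM {..<n} (\<lambda>_. borel)) (borel \<Otimes>\<^sub>M borel \<Otimes>\<^sub>M borel)"
      by (intro measurable_Pair \<Delta>_meas measurable_compose[OF P_meas[OF order_refl] borel_measurable_fst_snd(1)]
         measurable_compose[OF P_meas[OF order_refl] borel_measurable_fst_snd(2)])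
    from measurable_compose[OF this that(1)]
    have m1: "(\<lambda>v. \<psi> (\<Delta> v) (fst (P v n)) (snd (P v n))) \<in> borel_measurable (PiM {..<n} (\<lambda>_. borel))" by (simp add: case_prod_beta)
    from measurable_compose[OF measurable_Pair[OF borel_measurable_fst_snd] that(2)]
    have m2: "(\<lambda>w. \<phi> (fst w) (snd w)) \<in> borel_measurable borel" by (simp add: case_prod_beta)
    have "indep_var borel (\<lambda>\<omega>. (\<lambda>v. \<psi> (\<Delta> v) (fst (P v n)) (snd (P v n))) (\<lambda>i\<in>{..<n}. W_incr h i \<omega>)) borel (\<lambda>\<omega>. (\<lambda>w. \<phi> (fst w) (snd w)) (W_incr h n \<omega>))"
      by (rule indep_past_W_incr[OF h m1 m2])
    then show ?thesis by (simp only: \<Delta> P[OF order_refl] r_def s_def x_def y_def)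
  qed
  \<comment> \<open>\<open>d\<close> and \<open>r\<close> are dependent, so integrability of the
    product comes from the two second moments.\<close>
  have int_dr: "integrable M (\<lambda>\<omega>. d \<omega> * r \<omega>)" and int_ds: "integrable M (\<lambda>\<omega>. d \<omega> * s \<omega>)"
  proof -
    have *: "\<bar>a * b\<bar> \<le> \<bar>a\<^sup>2 + b\<^sup>2\<bar>" for a b :: real
    proof -
      have "2 * (\<bar>a\<bar> * \<bar>b\<bar>) \<le> a\<^sup>2 + b\<^sup>2" using sum_squares_bound[of "\<bar>a\<bar>" "\<bar>b\<bar>"] by simp
      moreover have "0 \<le> \<bar>a\<bar> * \<bar>b\<bar>" by simp
      ultimately have "\<bar>a\<bar> * \<bar>b\<bar> \<le> a\<^sup>2 + b\<^sup>2" by linarith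
      then show ?thesis by (simp add: abs_mult)
    qed
    show "integrable M (\<lambda>\<omega>. d \<omega> * r \<omega>)"
      using * by (intro Bochner_Integration.integrable_bound[OF Bochner_Integration.integrable_add[OF int_d int_r]]) auto
    show "integrable M (\<lambda>\<omega>. d \<omega> * s \<omega>)"
      using * by (intro Bochner_Integration.integrable_bound[OF Bochner_Integration.integrable_add[OF int_d int_s]]) auto
  qed
  have i1: "indep_var borel (\<lambda>\<omega>. d \<omega> * r \<omega>) borel y" by (rule ind[of "\<lambda>a b c. a * b" "\<lambda>a b. b"]) measurable
  have i2: "indep_var borel (\<lambda>\<omega>. d \<omega> * s \<omega>) borel x" by (rule ind[of "\<lambda>a b c. a * c" "\<lambda>a b. a"]) measurable
  have i3: "indep_var borel (\<lambda>\<omega>. (r \<omega>)\<^sup>2) borel (\<lambda>\<omega>. (y \<omega>)\<^sup>2)" by (rule ind[of "\<lambda>a b c. b\<^sup>2" "\<lambda>a b. b\<^sup>2"]) measurable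
  have i4: "indep_var borel (\<lambda>\<omega>. (s \<omega>)\<^sup>2) borel (\<lambda>\<omega>. (x \<omega>)\<^sup>2)" by (rule ind[of "\<lambda>a b c. c\<^sup>2" "\<lambda>a b. a\<^sup>2"]) measurable
  note c1 = indep_var_integrable[OF i1 int_dr xy1(3)] indep_var_lebesgue_integral[OF i1 int_dr xy1(3)]
  note c2 = indep_var_integrable[OF i2 int_ds xy1(1)] indep_var_lebesgue_integral[OF i2 int_ds xy1(1)]
  note c3 = indep_var_integrable[OF i3 int_r xy2(3)] indep_var_lebesgue_integral[OF i3 int_r xy2(3)]
  note c4 = indep_var_integrable[OF i4 int_s xy2(1)] indep_var_lebesgue_integral[OF i4 int_s xy2(1)]
  \<comment> \<open>Dropping the mixed term \<open>r y s x\<close> by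
    \<open>(p - q)^2 \<le> 2 p^2 + 2 q^2\<close> avoids computing its expectation and costs only a
    factor 2.\<close>
  have e_le: "(e \<omega>)\<^sup>2 \<le> 2 * ((r \<omega>)\<^sup>2 * (y \<omega>)\<^sup>2) + 2 * ((s \<omega>)\<^sup>2 * (x \<omega>)\<^sup>2)" for \<omega>
  proof -
    have "0 \<le> (r \<omega> * y \<omega> + s \<omega> * x \<omega>)\<^sup>2" by simp
    then show ?thesis unfolding e_def by (simp add: power2_eq_square algebra_simps)
  qed
  have int_b: "integrable M (\<lambda>\<omega>. 2 * ((r \<omega>)\<^sup>2 * (y \<omega>)\<^sup>2) + 2 * ((s \<omega>)\<^sup>2 * (x \<omega>)\<^sup>2))"
    using c3(1) c4(1) by auto
  have int_e: "integrable M (\<lambda>\<omega>. (e \<omega>)\<^sup>2)"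
    by (rule Bochner_Integration.integrable_bound[OF int_b]) (use e_le in \<open>auto intro: order_trans[OF _ abs_ge_self]\<close>)
  have "expectation (\<lambda>\<omega>. (e \<omega>)\<^sup>2) \<le> expectation (\<lambda>\<omega>. 2 * ((r \<omega>)\<^sup>2 * (y \<omega>)\<^sup>2) + 2 * ((s \<omega>)\<^sup>2 * (x \<omega>)\<^sup>2))"
    by (rule integral_mono[OF int_e int_b e_le])
  also have "\<dots> = 2 * ((real n * h - real (c n) * h) * h) + 2 * ((real n * h - real (c n) * h) * h)"
    using c3 c4 E_r E_s xy2 by simp
  finally have E_e: "expectation (\<lambda>\<omega>. (e \<omega>)\<^sup>2) \<le> 4 * (real n - real (c n)) * h\<^sup>2"
    by (simp add: algebra_simps power2_eq_square)
  have D: "(D (Suc n) \<omega>)\<^sup>2 = (d \<omega>)\<^sup>2 + 2 * (d \<omega> * r \<omega> * y \<omega>) - 2 * (d \<omega> * s \<omega> * x \<omega>) + (e \<omega>)\<^sup>2" for \<omega>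
  proof -
    have *: "D (Suc n) \<omega> = d \<omega> + e \<omega>"
      by (simp add: D_def d_def e_def r_def s_def x_def y_def omega2_def algebra_simps)
    show ?thesis unfolding * power2_sum by (simp add: e_def algebra_simps)
  qed
  have "integrable M (\<lambda>\<omega>. (D (Suc n) \<omega>)\<^sup>2)"
    unfolding D using int_d c1(1) c2(1) int_e by auto
  \<comment> \<open>The cross terms vanish: \<open>x\<close> and \<open>y\<close> are centred and
    independent of \<open>d r\<close> and \<open>d s\<close>.\<close>
  moreover have "expectation (\<lambda>\<omega>. (D (Suc n) \<omega>)\<^sup>2) = expectation (\<lambda>\<omega>. (d \<omega>)\<^sup>2) + expectation (\<lambda>\<omega>. (e \<omega>)\<^sup>2)"
    unfolding D using int_d c1 c2 int_e xy1 by simp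
  moreover have "expectation (\<lambda>\<omega>. (d \<omega>)\<^sup>2) \<le> (\<Sum>l<n. 4 * (real l - real (c l)) * h\<^sup>2)"
    using Suc.IH by (simp add: d_def)
  ultimately show ?case using E_e by simp
qed

text \<open>Riemann sum for twice the area. \<open>N\<close> is not confined to powers of two,
  because the sums up to different times \<open>i h\<close> must share the mesh
  \<open>h / 2 ^ k\<close> and then have \<open>i * 2 ^ k\<close> steps.\<close>

definition area_sum :: "nat \<Rightarrow> real \<Rightarrow> 'a \<Rightarrow> real" where
  "area_sum N t \<omega> = (\<Sum>k<N. omega2 (W (real k * t / real N) \<omega>)
      (W (real (Suc k) * t / real N) \<omega> - W (real k * t / real N) \<omega>))"

lemma area_sum_meas [measurable]: "area_sum N t \<in> borel_measurable M"
  unfolding area_sum_def omega2_def by measurable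

lemma levy_riemann_sum_eq: "levy_riemann_sum W t n = area_sum (2 ^ n) t"
  by (auto simp: levy_riemann_sum_def area_sum_def omega2_def Let_def algebra_simps intro!: ext sum.cong)

lemma area_sum_grid: "0 < N \<Longrightarrow> area_sum N (real N * h) \<omega> = (\<Sum>k<N. omega2 (W (real k * h) \<omega>) (W_incr h k \<omega>))"
  by (simp add: area_sum_def)

lemma area_sum_L2_bound:
  assumes "0 < t" "0 < N"
  shows "integrable M (\<lambda>\<omega>. (area_sum N t \<omega>)\<^sup>2)" "expectation (\<lambda>\<omega>. (area_sum N t \<omega>)\<^sup>2) \<le> 4 * t\<^sup>2"
proof -
  define h where "h = t / real N"
  have h: "0 < h" "t = real N * h" using assms by (auto simp: h_def)
  let ?D = "\<lambda>\<omega>. \<Sum>l<N. omega2 (W (real l * h) \<omega> - W (real (0::nat) * h) \<omega>) (W_incr h l \<omega>)"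
  have eq: "area_sum N t \<omega> = ?D \<omega>" if "\<omega> \<in> space M" for \<omega>
    using assms that by (simp add: h(2) area_sum_grid W_0)
  note L2 = area_sum_L2[OF h(1), of "\<lambda>_. 0" N]
  show "integrable M (\<lambda>\<omega>. (area_sum N t \<omega>)\<^sup>2)"
    using L2 by (subst Bochner_Integration.integrable_cong[OF refl, where g="\<lambda>\<omega>. (?D \<omega>)\<^sup>2"]) (auto simp: eq)
  have "expectation (\<lambda>\<omega>. (area_sum N t \<omega>)\<^sup>2) = expectation (\<lambda>\<omega>. (?D \<omega>)\<^sup>2)"
    by (intro Bochner_Integration.integral_cong) (auto simp: eq)
  also have "\<dots> \<le> (\<Sum>l<N. 4 * (real l - real (0::nat)) * h\<^sup>2)" using L2 by simp
  also have "\<dots> \<le> (\<Sum>l<N. 4 * real N * h\<^sup>2)"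
    by (intro sum_mono mult_right_mono) auto
  also have "\<dots> = 4 * t\<^sup>2" by (simp add: h(2) power2_eq_square)
  finally show "expectation (\<lambda>\<omega>. (area_sum N t \<omega>)\<^sup>2) \<le> 4 * t\<^sup>2" .
qed

text \<open>On the fine grid the coarse sum uses the value of \<open>W\<close> at the start of the
  coarse block. The difference is thus a sum as in \<open>area_sum_L2\<close> whose lag is at most
  \<open>m\<close> fine steps.\<close>

lemma area_sum_refine:
  assumes t: "0 < t" and N: "0 < N" and m: "0 < m"
  shows "integrable M (\<lambda>\<omega>. (area_sum N t \<omega> - area_sum (N * m) t \<omega>)\<^sup>2)"
    "expectation (\<lambda>\<omega>. (area_sum N t \<omega> - area_sum (N * m) t \<omega>)\<^sup>2) \<le> 4 * t\<^sup>2 / real N"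
proof -
  define h where "h = t / real (N * m)"
  have h: "0 < h" "t = real (N * m) * h" using assms by (auto simp: h_def)
  \<comment> \<open>Left end of the coarse block that contains the fine index
    \<open>l\<close>.\<close>
  define c where "c l = m * (l div m)" for l
  have c: "c l \<le> l" for l by (simp add: c_def)
  let ?D = "\<lambda>\<omega>. \<Sum>l<N * m. omega2 (W (real l * h) \<omega> - W (real (c l) * h) \<omega>) (W_incr h l \<omega>)"
  have fine: "area_sum (N * m) t \<omega> = (\<Sum>l<N * m. omega2 (W (real l * h) \<omega>) (W_incr h l \<omega>))" for \<omega>
    unfolding h(2) using N m by (intro area_sum_grid) auto
  have coarse: "area_sum N t \<omega> = (\<Sum>l<N * m. omega2 (W (real (c l) * h) \<omega>) (W_incr h l \<omega>))" for \<omega>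
  proof -
    have th: "t = real N * (real m * h)" by (simp add: h(2))
    have "area_sum N t \<omega> = (\<Sum>k<N. omega2 (W (real k * (real m * h)) \<omega>) (W_incr (real m * h) k \<omega>))"
      unfolding th using N by (intro area_sum_grid)
    also have "\<dots> = (\<Sum>k<N. \<Sum>l\<in>{k * m..<k * m + m}. omega2 (W (real (c l) * h) \<omega>) (W_incr h l \<omega>))"
    proof (intro sum.cong refl)
      fix k
      have "(\<Sum>l\<in>{k * m..<k * m + m}. omega2 (W (real (c l) * h) \<omega>) (W_incr h l \<omega>))
          = (\<Sum>l\<in>{k * m..<k * m + m}. omega2 (W (real k * (real m * h)) \<omega>) (W_incr h l \<omega>))"
      proof (intro sum.cong refl)
        fix l assume "l \<in> {k * m..<k * m + m}"
        then have "k * m \<le> l" "l < Suc k * m" by auto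
        then have "l div m = k" by (metis div_nat_eqI mult.commute)
        then show "omega2 (W (real (c l) * h) \<omega>) (W_incr h l \<omega>) = omega2 (W (real k * (real m * h)) \<omega>) (W_incr h l \<omega>)"
          by (simp add: c_def ac_simps)
      qed
      also have "\<dots> = omega2 (W (real k * (real m * h)) \<omega>) (\<Sum>l\<in>{k * m..<k * m + m}. W_incr h l \<omega>)"
        by (simp only: omega2_sum_right)
      also have "(\<Sum>l\<in>{k * m..<k * m + m}. W_incr h l \<omega>) = W_incr (real m * h) k \<omega>"
        by (subst sum_W_incr) (auto simp: algebra_simps)
      finally show "omega2 (W (real k * (real m * h)) \<omega>) (W_incr (real m * h) k \<omega>)
          = (\<Sum>l\<in>{k * m..<k * m + m}. omega2 (W (real (c l) * h) \<omega>) (W_incr h l \<omega>))" by simp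
    qed
    also have "\<dots> = (\<Sum>l<N * m. omega2 (W (real (c l) * h) \<omega>) (W_incr h l \<omega>))"
      by (rule sum.nat_group)
    finally show ?thesis .
  qed
  have eq: "(area_sum N t \<omega> - area_sum (N * m) t \<omega>)\<^sup>2 = (?D \<omega>)\<^sup>2" for \<omega>
    unfolding fine coarse by (subst power2_commute) (simp only: omega2_linear(3) sum_subtractf)
  note L2 = area_sum_L2[OF h(1) c, of "N * m"]
  show "integrable M (\<lambda>\<omega>. (area_sum N t \<omega> - area_sum (N * m) t \<omega>)\<^sup>2)"
    unfolding eq using L2 by simp
  have "expectation (\<lambda>\<omega>. (area_sum N t \<omega> - area_sum (N * m) t \<omega>)\<^sup>2) \<le> (\<Sum>l<N * m. 4 * (real l - real (c l)) * h\<^sup>2)"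
    unfolding eq using L2 by simp
  also have "\<dots> \<le> (\<Sum>l<N * m. 4 * real m * h\<^sup>2)"
  proof (intro sum_mono mult_right_mono mult_left_mono)
    fix l
    have "l < c l + m" using m by (simp add: c_def) (metis add.commute add_less_cancel_left mod_less_divisor mult_div_mod_eq)
    then show "real l - real (c l) \<le> real m" by simp
  qed auto
  also have "\<dots> = 4 * t\<^sup>2 / real N" using N by (simp add: h(2) power2_eq_square)
  finally show "expectation (\<lambda>\<omega>. (area_sum N t \<omega> - area_sum (N * m) t \<omega>)\<^sup>2) \<le> 4 * t\<^sup>2 / real N" .
qed

end

text \<open>\<open>A_0\<close> is required at every outcome, whereas \<open>levy_area\<close> yields
  it only almost surely. The locale is therefore entered with \<open>A t - A 0\<close>.\<close>

locale levy_bm = planar_bm +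
  fixes A :: "real \<Rightarrow> 'a \<Rightarrow> real"
  assumes A_meas [measurable]: "\<And>t. A t \<in> borel_measurable M"
    and A_cont: "\<And>\<omega>. \<omega> \<in> space M \<Longrightarrow> continuous_on {0..} (\<lambda>t. A t \<omega>)"
    and A_0: "\<And>\<omega>. \<omega> \<in> space M \<Longrightarrow> A 0 \<omega> = 0"
    and A_lim: "\<And>t. 0 \<le> t \<Longrightarrow> tendsto_prob (\<lambda>n. area_sum (2 ^ n) t) (\<lambda>\<omega>. 2 * A t \<omega>)"
begin

definition heis_path :: "real \<Rightarrow> 'a \<Rightarrow> heis" where
  "heis_path t \<omega> = (W t \<omega>, A t \<omega>)"

lemma heis_path_meas [measurable]: "heis_path t \<in> borel_measurable M"
  unfolding heis_path_def [abs_def] by (intro borel_measurable_Pair W_meas A_meas)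

text \<open>The definition of the area supplies only \<open>2 ^ k\<close> steps up to each time, so
  the meshes at different times \<open>i h\<close> would differ. Refining each step into
  \<open>i\<close> parts gives the common mesh \<open>h / 2 ^ k\<close> and changes the sum by
  \<open>O(2^(-k))\<close> in second moment.\<close>

lemma area_sum_tendsto:
  assumes h: "0 < h"
  shows "tendsto_prob (\<lambda>k. area_sum (i * 2 ^ k) (real i * h)) (\<lambda>\<omega>. 2 * A (real i * h) \<omega>)"
proof (cases "i = 0")
  case True
  then show ?thesis by (simp add: tendsto_prob_def area_sum_def A_0 cong: conj_cong)
next
  case False
  define t where "t = real i * h"
  have t: "0 < t" using False h by (simp add: t_def)
  let ?R = "\<lambda>k \<omega>. area_sum (2 ^ k) t \<omega> - area_sum (2 ^ k * i) t \<omega>"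
  have "tendsto_prob ?R (\<lambda>_. 0)"
  proof (rule tendsto_prob_L2)
    show "integrable M (\<lambda>\<omega>. (?R k \<omega>)\<^sup>2)" for k using False t by (intro area_sum_refine) auto
    show "(\<lambda>k. expectation (\<lambda>\<omega>. (?R k \<omega>)\<^sup>2)) \<longlonglongrightarrow> 0"
    proof (rule tendsto_sandwich[OF _ _ tendsto_const])
      show "\<forall>\<^sub>F k in sequentially. expectation (\<lambda>\<omega>. (?R k \<omega>)\<^sup>2) \<le> 4 * t\<^sup>2 / real (2 ^ k)"
        using False t by (intro always_eventually allI area_sum_refine) auto
      have "(\<lambda>k. 4 * t\<^sup>2 * (1 / 2) ^ k) \<longlonglongrightarrow> 4 * t\<^sup>2 * 0"
        by (intro tendsto_mult tendsto_const LIMSEQ_power_zero) auto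
      then show "(\<lambda>k. 4 * t\<^sup>2 / real (2 ^ k)) \<longlonglongrightarrow> 0" by (simp add: power_divide)
    qed auto
  qed measurable
  from tendsto_prob_diff[OF A_lim[of t] this] t show ?thesis
    by (simp add: t_def mult.commute)
qed

text \<open>Lift of the polygonal interpolation of \<open>W\<close> over the \<open>i\<close>-th
  interval, as a product of horizontal steps. It depends on the Brownian increments of that interval
  alone.\<close>

definition approx_incr :: "real \<Rightarrow> nat \<Rightarrow> nat \<Rightarrow> 'a \<Rightarrow> heis" where
  "approx_incr h k i \<omega> = heis_prod (\<lambda>j. (W_incr (h / 2 ^ k) (i * 2 ^ k + j) \<omega>, 0)) (2 ^ k)"

text \<open>The central coordinate gathered by horizontal steps is the signed area swept as seen
  from the starting point.\<close>

lemma heis_prod_horizontal: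
  "heis_prod (\<lambda>j. (V (Suc j) - V j, 0)) n = (V n - V 0, (\<Sum>j<n. omega2 (V j - V 0) (V (Suc j) - V j)) / 2)"
proof (induction n)
  case (Suc n)
  then show ?case by (intro prod_eqI) (simp_all add: add_divide_distrib)
qed (simp add: zero_prod_def)

lemma approx_incr_eq:
  assumes h: "0 < h"
  shows "approx_incr h k i \<omega> = (W_incr h i \<omega>,
    (area_sum (Suc i * 2 ^ k) (real (Suc i) * h) \<omega> - area_sum (i * 2 ^ k) (real i * h) \<omega>
      - omega2 (W (real i * h) \<omega>) (W (real (Suc i) * h) \<omega>)) / 2)"
proof -
  define h' where "h' = h / 2 ^ k"
  define V where "V j = W (real (i * 2 ^ k + j) * h') \<omega>" for j
  have hh: "h = 2 ^ k * h'" by (simp add: h'_def)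
  have sum: "area_sum (n * 2 ^ k) (real n * h) \<omega> = (\<Sum>l<n * 2 ^ k. omega2 (W (real l * h') \<omega>) (W_incr h' l \<omega>))" for n
  proof (cases "n = 0")
    case False
    then show ?thesis using area_sum_grid[of "n * 2 ^ k" h' \<omega>] by (simp add: hh ac_simps)
  qed (simp add: area_sum_def)
  have "approx_incr h k i \<omega> = heis_prod (\<lambda>j. (V (Suc j) - V j, 0)) (2 ^ k)"
    by (simp add: approx_incr_def V_def h'_def)
  also have "\<dots> = (V (2 ^ k) - V 0, (\<Sum>j<2 ^ k. omega2 (V j - V 0) (V (Suc j) - V j)) / 2)"
    by (rule heis_prod_horizontal)
  also have "(\<Sum>j<2 ^ k. omega2 (V j - V 0) (V (Suc j) - V j))
     = (\<Sum>j<2 ^ k. omega2 (V j) (V (Suc j) - V j)) - omega2 (V 0) (\<Sum>j<2 ^ k. V (Suc j) - V j)"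
    by (subst omega2_sum_right) (simp only: omega2_linear(3) sum_subtractf)
  also have "(\<Sum>j<2 ^ k. V (Suc j) - V j) = V (2 ^ k) - V 0"
    by (rule sum_lessThan_telescope)
  also have "(\<Sum>j<2 ^ k. omega2 (V j) (V (Suc j) - V j))
     = (\<Sum>l = i * 2 ^ k..<Suc i * 2 ^ k. omega2 (W (real l * h') \<omega>) (W_incr h' l \<omega>))"
    using sum.shift_bounds_nat_ivl[of "\<lambda>l. omega2 (W (real l * h') \<omega>) (W_incr h' l \<omega>)" 0 "i * 2 ^ k" "2 ^ k"]
    by (simp add: V_def atLeast0LessThan add.commute)
  \<comment> \<open>The common mesh makes both sums run over one sequence, so the sum over the block
    is their difference.\<close>
  also have "\<dots> = area_sum (Suc i * 2 ^ k) (real (Suc i) * h) \<omega> - area_sum (i * 2 ^ k) (real i * h) \<omega>"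
    unfolding sum by (subst sum_diff_nat_ivl[of 0, unfolded atLeast0LessThan, symmetric]) (auto simp: lessThan_atLeast0)
  finally have *: "approx_incr h k i \<omega> = (V (2 ^ k) - V 0,
      (area_sum (Suc i * 2 ^ k) (real (Suc i) * h) \<omega> - area_sum (i * 2 ^ k) (real i * h) \<omega> - omega2 (V 0) (V (2 ^ k) - V 0)) / 2)" .
  have V: "V (2 ^ k) = W (real (Suc i) * h) \<omega>" "V 0 = W (real i * h) \<omega>"
    by (simp_all add: V_def hh algebra_simps)
  show ?thesis
    unfolding * V by (simp add: omega2_linear)
qed

end

section \<open>Independence, law and tail of the group increments\<close>

context levy_bm
begin

abbreviation heis_incr :: "real \<Rightarrow> nat \<Rightarrow> 'a \<Rightarrow> heis" where
  "heis_incr h i \<omega> \<equiv> - heis_path (real i * h) \<omega> \<odot> heis_path (real (Suc i) * h) \<omega>"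

lemma heis_incr_eq: "heis_incr h i \<omega> = (W_incr h i \<omega>,
    (2 * A (real (Suc i) * h) \<omega> - 2 * A (real i * h) \<omega> - omega2 (W (real i * h) \<omega>) (W (real (Suc i) * h) \<omega>)) / 2)"
  by (rule prod_eqI) (auto simp: heis_path_def field_simps)

lemma heis_incr_meas [measurable]: "heis_incr h i \<in> borel_measurable M"
  by measurable

lemma approx_incr_meas [measurable]: "approx_incr h k i \<in> borel_measurable M"
  unfolding approx_incr_def [abs_def] by measurable

lemma approx_incr_tendsto:
  assumes "0 < h"
  shows "tendsto_prob (\<lambda>k. approx_incr h k i) (heis_incr h i)"
proof (rule tendsto_prob_mono[OF tendsto_prob_diff[OF area_sum_tendsto[OF assms, of "Suc i"] area_sum_tendsto[OF assms, of i]], of 1])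
  fix k \<omega>
  \<comment> \<open>The horizontal parts and the correction \<open>omega2\<close> agree exactly;
    only the error of the Riemann sums remains.\<close>
  have *: "\<bar>\<bar>(a - b - c) / 2 - (d - e - c) / 2\<bar>\<bar> \<le> 1 * \<bar>a - b - (d - e)\<bar>" for a b c d e :: real
    by (auto simp: abs_if field_simps)
  show "dist (approx_incr h k i \<omega>) (heis_incr h i \<omega>) \<le> 1 *
    dist (area_sum (Suc i * 2 ^ k) (real (Suc i) * h) \<omega> - area_sum (i * 2 ^ k) (real i * h) \<omega>)
         (2 * A (real (Suc i) * h) \<omega> - 2 * A (real i * h) \<omega>)"
    unfolding approx_incr_eq[OF assms] heis_incr_eq
    by (simp only: dist_Pair_Pair dist_self dist_real_def zero_power2 add_0 real_sqrt_abs *)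
qed measurable

text \<open>The polygonal increments are functions of disjoint blocks of Brownian increments, hence
  independent, and independence passes to their limits in probability.\<close>

lemma indep_heis_incr:
  assumes h: "0 < h"
  shows "indep_vars (\<lambda>_. borel) (heis_incr h) {..<n}"
proof (rule indep_vars_tendsto_prob[where X="\<lambda>k. approx_incr h k"])
  fix k
  let ?K = "\<lambda>i. {i * 2 ^ k..<i * 2 ^ k + 2 ^ k}"
  have "indep_vars (\<lambda>_. borel) (W_incr (h / 2 ^ k)) {..<n * 2 ^ k}"
    using W_indep[of "h / 2 ^ k" 0 "n * 2 ^ k"] h by simp
  then have "indep_vars (\<lambda>i. PiM (?K i) (\<lambda>_. borel)) (\<lambda>i \<omega>. restrict (\<lambda>l. W_incr (h / 2 ^ k) l \<omega>) (?K i)) {..<n}"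
  proof (rule indep_vars_restrict)
    fix i assume "i \<in> {..<n}"
    then have "Suc i * 2 ^ k \<le> n * 2 ^ k" by (intro mult_right_mono) auto
    then show "?K i \<subseteq> {..<n * 2 ^ k}" by auto
  next
    show "disjoint_family_on ?K {..<n}"
      unfolding disjoint_family_on_def
    proof (intro ballI impI)
      fix i j :: nat assume "i \<noteq> j"
      then have "Suc i * 2 ^ k \<le> j * 2 ^ k \<or> Suc j * 2 ^ k \<le> i * 2 ^ k"
        by (metis Suc_leI mult_le_mono1 nat_neq_iff)
      then show "?K i \<inter> ?K j = {}" by auto
    qed
  qed
  then have "indep_vars (\<lambda>_. borel) (\<lambda>i \<omega>. heis_prod (\<lambda>j. (restrict (\<lambda>l. W_incr (h / 2 ^ k) l \<omega>) (?K i) (i * 2 ^ k + j), 0)) (2 ^ k)) {..<n}"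
    by (rule indep_vars_compose2[where Y="\<lambda>i v. heis_prod (\<lambda>j. (v (i * 2 ^ k + j), 0)) (2 ^ k)"])
       (auto intro!: borel_measurable_heis_prod borel_measurable_Pair measurable_component_singleton)
  then show "indep_vars (\<lambda>_. borel) (approx_incr h k) {..<n}"
    by (subst indep_vars_cong[OF refl _ refl]) (auto simp: approx_incr_def [abs_def] intro!: heis_prod_cong)
qed (auto simp del: of_nat_Suc intro: approx_incr_tendsto[OF h])

text \<open>The Brownian steps on both sides are independent with matching Gaussian laws, and the
  factor \<open>sqrt h\<close> can be taken out of the product because dilations are
  automorphisms.\<close>

lemma distr_approx_incr:
  assumes h: "0 < h"
  shows "distr M borel (approx_incr h k i) = distr M borel (\<lambda>\<omega>. heis_dil (sqrt h) (approx_incr 1 k 0 \<omega>))"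
proof -
  let ?\<Phi> = "\<lambda>v. heis_prod (\<lambda>j. (v j, 0)) (2 ^ k)"
  define X where "X j = W_incr (h / 2 ^ k) (i * 2 ^ k + j)" for j
  define Y where "Y j \<omega> = sqrt h *\<^sub>R W_incr (1 / 2 ^ k) j \<omega>" for j \<omega>
  have "distr M borel (\<lambda>\<omega>. ?\<Phi> (\<lambda>j\<in>{..<2 ^ k}. X j \<omega>)) = distr M borel (\<lambda>\<omega>. ?\<Phi> (\<lambda>j\<in>{..<2 ^ k}. Y j \<omega>))"
  proof (rule distr_indep_cong)
    show "indep_vars (\<lambda>_. borel) X {..<2 ^ k}"
      using W_indep[of "h / 2 ^ k" "real i * h" "2 ^ k"] h
      by (simp add: X_def [abs_def] field_simps)
    have "indep_vars (\<lambda>_. borel) (W_incr (1 / 2 ^ k)) {..<2 ^ k}"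
      using W_indep[of "1 / 2 ^ k" 0 "2 ^ k"] by simp
    then show "indep_vars (\<lambda>_. borel) Y {..<2 ^ k}"
      unfolding Y_def [abs_def] by (rule indep_vars_compose2) auto
    show "distr M borel (X j) = distr M borel (Y j)" for j
      unfolding X_def Y_def [abs_def] using h
      by (intro distr_increment_scale) (auto simp: field_simps)
  qed (auto intro!: borel_measurable_heis_prod borel_measurable_Pair measurable_component_singleton)
  moreover have "?\<Phi> (\<lambda>j\<in>{..<2 ^ k}. X j \<omega>) = approx_incr h k i \<omega>" for \<omega>
    by (auto simp: approx_incr_def X_def intro!: heis_prod_cong)
  moreover have "?\<Phi> (\<lambda>j\<in>{..<2 ^ k}. Y j \<omega>) = heis_dil (sqrt h) (approx_incr 1 k 0 \<omega>)" for \<omega>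
    unfolding approx_incr_def heis_dil_prod
    by (auto simp: Y_def heis_dil_def intro!: heis_prod_cong)
  ultimately show ?thesis by simp
qed

lemma distr_heis_incr:
  assumes h: "0 < h"
  shows "distr M borel (heis_incr h i) = distr M borel (\<lambda>\<omega>. heis_dil (sqrt h) (heis_path 1 \<omega>))"
proof -
  have "distr M borel (heis_incr h i) = distr M borel (\<lambda>\<omega>. heis_dil (sqrt h) (heis_incr 1 0 \<omega>))"
  proof (rule distr_eq_tendsto_prob[OF approx_incr_tendsto[OF h]])
    show "tendsto_prob (\<lambda>k \<omega>. heis_dil (sqrt h) (approx_incr 1 k 0 \<omega>)) (\<lambda>\<omega>. heis_dil (sqrt h) (heis_incr 1 0 \<omega>))"
    proof (rule tendsto_prob_mono[OF approx_incr_tendsto[of 1 0]])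
      fix k \<omega>
      \<comment> \<open>With equal horizontal parts only the centre contributes to the distance, and
        there the dilation by \<open>sqrt h\<close> multiplies by \<open>h\<close>.\<close>
      have "fst (approx_incr 1 k 0 \<omega>) = fst (heis_incr 1 0 \<omega>)"
        using approx_incr_eq[of 1 k 0 \<omega>] by (simp add: heis_path_def)
      then show "dist (heis_dil (sqrt h) (approx_incr 1 k 0 \<omega>)) (heis_dil (sqrt h) (heis_incr 1 0 \<omega>)) \<le> h * dist (approx_incr 1 k 0 \<omega>) (heis_incr 1 0 \<omega>)"
        using h by (simp add: dist_prod_def heis_dil_def dist_real_def abs_mult flip: right_diff_distrib)
    qed (use h in measurable)
  qed (use h in \<open>auto intro: distr_approx_incr\<close>)
  also have "\<dots> = distr M borel (\<lambda>\<omega>. heis_dil (sqrt h) (heis_path 1 \<omega>))"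
    by (intro distr_cong) (auto simp: heis_path_def W_0 A_0 zero_prod_def[symmetric])
  finally show ?thesis .
qed

lemma heis_path_support:
  "0 < \<delta> \<Longrightarrow> 0 < prob {\<omega> \<in> space M. norm (fst (heis_path 1 \<omega>) - w) < \<delta>}"
  using W_1_support by (simp add: heis_path_def)

text \<open>The uniform second moment of the Riemann sums passes to the limit as a tail bound:
  Markov's inequality at level \<open>R / 2\<close> costs \<open>4 / (R / 2)^2\<close>, and the
  remaining \<open>R / 2\<close> is absorbed by convergence in probability.\<close>

lemma A_1_tail:
  assumes "0 < R"
  shows "prob {\<omega> \<in> space M. R < \<bar>2 * A 1 \<omega>\<bar>} \<le> 16 / R\<^sup>2"
proof (rule LIMSEQ_le_const)
  have "(\<lambda>n. prob {\<omega> \<in> space M. R / 2 < dist (area_sum (2 ^ n) 1 \<omega>) (2 * A 1 \<omega>)}) \<longlonglongrightarrow> 0"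
    using A_lim[of 1, unfolded tendsto_prob_def, rule_format, of "R / 2"] assms by simp
  from tendsto_add[OF tendsto_const[of "16 / R\<^sup>2"] this]
  show "(\<lambda>n. 16 / R\<^sup>2 + prob {\<omega> \<in> space M. R / 2 < dist (area_sum (2 ^ n) 1 \<omega>) (2 * A 1 \<omega>)}) \<longlonglongrightarrow> 16 / R\<^sup>2"
    by simp
  show "\<exists>N. \<forall>n\<ge>N. prob {\<omega> \<in> space M. R < \<bar>2 * A 1 \<omega>\<bar>} \<le> 16 / R\<^sup>2 + prob {\<omega> \<in> space M. R / 2 < dist (area_sum (2 ^ n) 1 \<omega>) (2 * A 1 \<omega>)}"
  proof (intro exI allI impI)
    fix n
    let ?U = "{\<omega> \<in> space M. (R / 2)\<^sup>2 \<le> (area_sum (2 ^ n) 1 \<omega>)\<^sup>2}" and ?V = "{\<omega> \<in> space M. R / 2 < dist (area_sum (2 ^ n) 1 \<omega>) (2 * A 1 \<omega>)}"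
    have "prob {\<omega> \<in> space M. R < \<bar>2 * A 1 \<omega>\<bar>} \<le> prob (?U \<union> ?V)"
    proof (rule finite_measure_mono)
      show "{\<omega> \<in> space M. R < \<bar>2 * A 1 \<omega>\<bar>} \<subseteq> ?U \<union> ?V"
      proof safe
        fix \<omega> assume "R < \<bar>2 * A 1 \<omega>\<bar>" "\<not> R / 2 < dist (area_sum (2 ^ n) 1 \<omega>) (2 * A 1 \<omega>)"
        then have "\<bar>R / 2\<bar> \<le> \<bar>area_sum (2 ^ n) 1 \<omega>\<bar>" using assms by (simp add: dist_real_def abs_if split: if_splits)
        then show "(R / 2)\<^sup>2 \<le> (area_sum (2 ^ n) 1 \<omega>)\<^sup>2" by (simp only: abs_le_square_iff)
      qed
    qed measurable
    also have "\<dots> \<le> prob ?U + prob ?V" by (intro measure_Un_le) measurable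
    also have "prob ?U \<le> expectation (\<lambda>\<omega>. (area_sum (2 ^ n) 1 \<omega>)\<^sup>2) / (R / 2)\<^sup>2"
      using assms area_sum_L2_bound(1)[of 1 "2 ^ n"] by (intro integral_Markov_inequality_measure[where A="space M"]) auto
    also have "\<dots> \<le> 4 / (R / 2)\<^sup>2"
      using area_sum_L2_bound(2)[of 1 "2 ^ n"] by (intro divide_right_mono) auto
    also have "\<dots> = 16 / R\<^sup>2" by (simp add: power_divide)
    finally show "prob {\<omega> \<in> space M. R < \<bar>2 * A 1 \<omega>\<bar>} \<le> 16 / R\<^sup>2 + prob ?V" by simp
  qed
qed

text \<open>The fourth power of the norm is \<open>|W|^4 + A^2\<close>, so one summand exceeds
  \<open>R^4 / 2\<close>. Fourth moments of the Gaussian coordinates give \<open>24 / R^4\<close>,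
  and the area gives \<open>8 / R^4\<close>.\<close>

lemma heis_path_tail:
  assumes R: "0 < R"
  shows "prob {\<omega> \<in> space M. R < heis_norm (heis_path 1 \<omega>)} \<le> 32 / R ^ 4"
proof -
  let ?Y = "\<lambda>\<omega>. 2 * fst (W 1 \<omega>) ^ 4 + 2 * snd (W 1 \<omega>) ^ 4"
  let ?U = "{\<omega> \<in> space M. R ^ 4 / 2 \<le> ?Y \<omega>}" and ?V = "{\<omega> \<in> space M. sqrt 2 * R\<^sup>2 < \<bar>2 * A 1 \<omega>\<bar>}"
  have "prob {\<omega> \<in> space M. R < heis_norm (heis_path 1 \<omega>)} \<le> prob (?U \<union> ?V)"
  proof (rule finite_measure_mono)
    show "{\<omega> \<in> space M. R < heis_norm (heis_path 1 \<omega>)} \<subseteq> ?U \<union> ?V"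
    proof safe
      fix \<omega> assume *: "R < heis_norm (heis_path 1 \<omega>)" and n: "\<not> sqrt 2 * R\<^sup>2 < \<bar>2 * A 1 \<omega>\<bar>"
      have "R ^ 4 < heis_norm (heis_path 1 \<omega>) ^ 4" using * R by (intro power_strict_mono) auto
      then have 1: "R ^ 4 < norm (W 1 \<omega>) ^ 4 + (A 1 \<omega>)\<^sup>2" by (simp add: heis_norm_pow4 heis_path_def)
      have "\<bar>2 * A 1 \<omega>\<bar>\<^sup>2 \<le> (sqrt 2 * R\<^sup>2)\<^sup>2" using n R by (intro power_mono) auto
      then have 2: "(A 1 \<omega>)\<^sup>2 \<le> R ^ 4 / 2" by (simp add: power_mult_distrib)
      have "norm (W 1 \<omega>) ^ 4 = ((norm (W 1 \<omega>))\<^sup>2)\<^sup>2" by simp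
      also have "\<dots> = ((fst (W 1 \<omega>))\<^sup>2 + (snd (W 1 \<omega>))\<^sup>2)\<^sup>2" by (simp add: norm_real_pair)
      also have "\<dots> \<le> 2 * ((fst (W 1 \<omega>))\<^sup>2)\<^sup>2 + 2 * ((snd (W 1 \<omega>))\<^sup>2)\<^sup>2"
        using sum_squares_bound[of "(fst (W 1 \<omega>))\<^sup>2" "(snd (W 1 \<omega>))\<^sup>2"] by (simp add: power2_sum)
      finally show "R ^ 4 / 2 \<le> ?Y \<omega>" using 1 2 by simp
    qed
  qed measurable
  also have "\<dots> \<le> prob ?U + prob ?V" by (intro measure_Un_le) measurable
  also have "prob ?U \<le> expectation ?Y / (R ^ 4 / 2)"
    using R increment_fourth_moment by (intro integral_Markov_inequality_measure[where A="space M"]) auto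
  also have "expectation ?Y = 12" using increment_fourth_moment by simp
  also have "prob ?V \<le> 16 / (sqrt 2 * R\<^sup>2)\<^sup>2" using R by (intro A_1_tail) auto
  also have "\<dots> = 8 / R ^ 4" by (simp add: power_mult_distrib)
  finally show ?thesis by (simp add: field_simps)
qed

end

subsection \<open>Markov property of a Heisenberg Brownian motion\<close>

lemma (in prob_space) indep_vars_reindex_inj:
  assumes ind: "indep_vars N X (f ` I)" and inj: "inj_on f I"
  shows "indep_vars (\<lambda>i. N (f i)) (\<lambda>i. X (f i)) I"
  unfolding indep_vars_def2
proof (intro conjI ballI indep_setsI)
  show "random_variable (N (f i)) (X (f i))" if "i \<in> I" for i
    using ind that by (auto simp: indep_vars_def2)
  show "{X (f i) -` A \<inter> space M |A. A \<in> sets (N (f i))} \<subseteq> events" if "i \<in> I" for i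
    using ind that by (auto simp: indep_vars_def2 indep_sets_def)
  fix A J assume J: "J \<noteq> {}" "J \<subseteq> I" "finite J" "\<forall>j\<in>J. A j \<in> {X (f j) -` A \<inter> space M |A. A \<in> sets (N (f j))}"
  have inj': "inj_on f J" using inj J(2) by (rule inj_on_subset)
  define B where "B k = A (the_inv_into J f k)" for k
  have B: "B (f j) = A j" if "j \<in> J" for j using the_inv_into_f_f[OF inj' that] by (simp add: B_def)
  have "prob (\<Inter>k\<in>f ` J. B k) = (\<Prod>k\<in>f ` J. prob (B k))"
    using ind J B unfolding indep_vars_def2 by (intro indep_setsD[of _ "f ` I"]) auto
  then show "prob (\<Inter>j\<in>J. A j) = (\<Prod>j\<in>J. prob (A j))"
    using B by (simp add: prod.reindex[OF inj'])
qed

text \<open>Everything that the rest of the proof uses about the path; \<open>W\<close> and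
  \<open>A\<close> no longer occur. The support condition concerns the horizontal part alone,
  because vertical motion will be produced by loops.\<close>

locale heis_bm = prob_space M for M :: "'a measure" +
  fixes g :: "real \<Rightarrow> 'a \<Rightarrow> heis"
  assumes g_meas [measurable]: "\<And>t. g t \<in> borel_measurable M"
    and g_cont: "\<And>\<omega>. \<omega> \<in> space M \<Longrightarrow> continuous_on {0..} (\<lambda>t. g t \<omega>)"
    and g_0: "\<And>\<omega>. \<omega> \<in> space M \<Longrightarrow> g 0 \<omega> = 0"
    and g_indep: "\<And>h n. 0 < h \<Longrightarrow>
      indep_vars (\<lambda>_. borel) (\<lambda>i \<omega>. - g (real i * h) \<omega> \<odot> g (real (Suc i) * h) \<omega>) {..<n}"
    and g_law: "\<And>h i. 0 < h \<Longrightarrow>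
      distr M borel (\<lambda>\<omega>. - g (real i * h) \<omega> \<odot> g (real (Suc i) * h) \<omega>) = distr M borel (\<lambda>\<omega>. heis_dil (sqrt h) (g 1 \<omega>))"
    and g_support: "\<And>\<delta> w. 0 < \<delta> \<Longrightarrow> 0 < prob {\<omega> \<in> space M. norm (fst (g 1 \<omega>) - w) < \<delta>}"
    and g_tail: "\<And>R. 0 < R \<Longrightarrow> prob {\<omega> \<in> space M. R < heis_norm (g 1 \<omega>)} \<le> 32 / R ^ 4"
begin

abbreviation incr :: "real \<Rightarrow> nat \<Rightarrow> 'a \<Rightarrow> heis" where
  "incr h i \<omega> \<equiv> - g (real i * h) \<omega> \<odot> g (real (Suc i) * h) \<omega>"

abbreviation grid_space :: "nat \<Rightarrow> (nat \<Rightarrow> heis) measure" where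
  "grid_space n \<equiv> PiM {..n} (\<lambda>_. borel)"

definition future :: "real \<Rightarrow> nat \<Rightarrow> nat \<Rightarrow> 'a \<Rightarrow> nat \<Rightarrow> heis" where
  "future h m n \<omega> = (\<lambda>j\<in>{..n}. - g (real m * h) \<omega> \<odot> g (real (m + j) * h) \<omega>)"

definition past :: "real \<Rightarrow> nat \<Rightarrow> 'a \<Rightarrow> nat \<Rightarrow> heis" where
  "past h m \<omega> = (\<lambda>j\<in>{..m}. g (real j * h) \<omega>)"

lemma future_meas [measurable]: "future h m n \<in> measurable M (grid_space n)"
  unfolding future_def [abs_def] by measurable

lemma past_meas [measurable]: "past h m \<in> measurable M (grid_space m)"
  unfolding past_def [abs_def] by measurable

lemma heis_prod_incr: "heis_prod (\<lambda>i. incr h (m + i) \<omega>) j = - g (real m * h) \<omega> \<odot> g (real (m + j) * h) \<omega>"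
  using heis_prod_telescope[of "\<lambda>i. g (real (m + i) * h) \<omega>" j] by simp

lemma heis_prod_incr_0:
  assumes "\<omega> \<in> space M" "j \<le> n"
  shows "heis_prod (\<lambda>i\<in>{..<n}. incr h i \<omega>) j = g (real j * h) \<omega>"
proof -
  have "heis_prod (\<lambda>i\<in>{..<n}. incr h i \<omega>) j = heis_prod (\<lambda>i. incr h i \<omega>) j"
    using assms by (intro heis_prod_cong) auto
  also have "\<dots> = - g (real 0 * h) \<omega> \<odot> g (real j * h) \<omega>"
    by (rule heis_prod_telescope)
  finally show ?thesis using assms by (simp add: g_0)
qed

lemma heis_prod_PiM_meas:
  assumes "\<And>i. i < n \<Longrightarrow> f i \<in> I"
  shows "(\<lambda>v. \<lambda>j\<in>{..n}. heis_prod (\<lambda>i. v (f i)) j) \<in> measurable (PiM I (\<lambda>_. borel)) (grid_space n)"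
  using assms by (intro measurable_restrict borel_measurable_heis_prod measurable_component_singleton) auto

lemma distr_incr_eq: "0 < h \<Longrightarrow> distr M borel (incr h i) = distr M borel (incr h j)"
  by (simp only: g_law)

text \<open>Both sides are the same product functional of independent increments with equal laws, on
  shifted index sets.\<close>

lemma future_law:
  assumes h: "0 < h"
  shows "distr M (grid_space n) (future h m n) = distr M (grid_space n) (past h n)"
proof -
  let ?\<Phi> = "\<lambda>v. \<lambda>j\<in>{..n}. heis_prod v j"
  have "distr M (grid_space n) (\<lambda>\<omega>. ?\<Phi> (\<lambda>i\<in>{..<n}. incr h (m + i) \<omega>)) = distr M (grid_space n) (\<lambda>\<omega>. ?\<Phi> (\<lambda>i\<in>{..<n}. incr h i \<omega>))"
  proof (rule distr_indep_cong[where X="\<lambda>i. incr h (m + i)" and Y="incr h" and I="{..<n}" and N="\<lambda>_. borel" and \<Phi>="?\<Phi>"])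
    have "indep_vars (\<lambda>_. borel) (incr h) ((+) m ` {..<n})"
      by (rule indep_vars_subset[OF g_indep[OF h, of "m + n"]]) auto
    then show "indep_vars (\<lambda>_. borel) (\<lambda>i. incr h (m + i)) {..<n}"
      by (rule indep_vars_reindex_inj) (auto simp: inj_on_def)
    show "indep_vars (\<lambda>_. borel) (incr h) {..<n}" by (rule g_indep[OF h])
    show "distr M borel (incr h (m + i)) = distr M borel (incr h i)" for i by (rule distr_incr_eq[OF h])
  qed (rule heis_prod_PiM_meas, simp)
  moreover have "?\<Phi> (\<lambda>i\<in>{..<n}. incr h (m + i) \<omega>) = future h m n \<omega>" for \<omega>
    unfolding future_def by (intro restrict_ext) (subst heis_prod_incr[symmetric], auto intro!: heis_prod_cong)
  moreover have "?\<Phi> (\<lambda>i\<in>{..<n}. incr h i \<omega>) = past h n \<omega>" if "\<omega> \<in> space M" for \<omega>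
    unfolding past_def using that by (intro restrict_ext heis_prod_incr_0) auto
  ultimately show ?thesis
    using distr_cong[of M M "grid_space n" "grid_space n" "\<lambda>\<omega>. ?\<Phi> (\<lambda>i\<in>{..<n}. incr h i \<omega>)" "past h n"] by simp
qed

lemma past_scaling:
  assumes h: "0 < h" and c: "0 < c"
  shows "distr M (grid_space n) (past (c * h) n) = distr M (grid_space n) (\<lambda>\<omega>. \<lambda>j\<in>{..n}. heis_dil (sqrt c) (past h n \<omega> j))"
proof -
  let ?\<Phi> = "\<lambda>v. \<lambda>j\<in>{..n}. heis_prod v j"
  have ch: "0 < c * h" using h c by simp
  have "distr M (grid_space n) (\<lambda>\<omega>. ?\<Phi> (\<lambda>i\<in>{..<n}. incr (c * h) i \<omega>)) = distr M (grid_space n) (\<lambda>\<omega>. ?\<Phi> (\<lambda>i\<in>{..<n}. heis_dil (sqrt c) (incr h i \<omega>)))"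
  proof (rule distr_indep_cong[where X="incr (c * h)" and Y="\<lambda>i \<omega>. heis_dil (sqrt c) (incr h i \<omega>)" and I="{..<n}" and N="\<lambda>_. borel" and \<Phi>="?\<Phi>"])
    show "indep_vars (\<lambda>_. borel) (incr (c * h)) {..<n}" by (rule g_indep[OF ch])
    show "indep_vars (\<lambda>_. borel) (\<lambda>i \<omega>. heis_dil (sqrt c) (incr h i \<omega>)) {..<n}"
      by (rule indep_vars_compose2[OF g_indep[OF h]]) auto
    fix i
    have "distr M borel (\<lambda>\<omega>. heis_dil (sqrt c) (incr h i \<omega>)) = distr (distr M borel (incr h i)) borel (heis_dil (sqrt c))"
      by (subst distr_distr) (auto simp: comp_def)
    also have "\<dots> = distr M borel (\<lambda>\<omega>. heis_dil (sqrt c) (heis_dil (sqrt h) (g 1 \<omega>)))"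
      unfolding g_law[OF h] by (subst distr_distr) (auto simp: comp_def)
    also have "\<dots> = distr M borel (incr (c * h) i)"
      unfolding g_law[OF ch] by (simp add: heis_dil_dil real_sqrt_mult)
    finally show "distr M borel (incr (c * h) i) = distr M borel (\<lambda>\<omega>. heis_dil (sqrt c) (incr h i \<omega>))" by simp
  qed (rule heis_prod_PiM_meas, simp)
  moreover have "distr M (grid_space n) (\<lambda>\<omega>. ?\<Phi> (\<lambda>i\<in>{..<n}. incr (c * h) i \<omega>)) = distr M (grid_space n) (past (c * h) n)"
    by (intro distr_cong refl) (auto simp: past_def heis_prod_incr_0 simp del: of_nat_Suc intro!: restrict_ext)
  moreover have "distr M (grid_space n) (\<lambda>\<omega>. ?\<Phi> (\<lambda>i\<in>{..<n}. heis_dil (sqrt c) (incr h i \<omega>)))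
      = distr M (grid_space n) (\<lambda>\<omega>. \<lambda>j\<in>{..n}. heis_dil (sqrt c) (past h n \<omega> j))"
  proof (intro distr_cong refl restrict_ext)
    fix \<omega> j assume "\<omega> \<in> space M" "j \<in> {..n}"
    then have "heis_dil (sqrt c) (past h n \<omega> j) = heis_dil (sqrt c) (heis_prod (\<lambda>i\<in>{..<n}. incr h i \<omega>) j)"
      by (simp add: past_def heis_prod_incr_0 del: of_nat_Suc)
    also have "\<dots> = heis_prod (\<lambda>i\<in>{..<n}. heis_dil (sqrt c) (incr h i \<omega>)) j"
      unfolding heis_dil_prod using \<open>j \<in> {..n}\<close> by (intro heis_prod_cong) auto
    finally show "heis_prod (\<lambda>i\<in>{..<n}. heis_dil (sqrt c) (incr h i \<omega>)) j = heis_dil (sqrt c) (past h n \<omega> j)" by simp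
  qed
  ultimately show ?thesis by simp
qed

lemma indep_past_future:
  assumes h: "0 < h"
  shows "indep_var (grid_space m) (past h m) (grid_space n) (future h m n)"
proof -
  have "indep_var (PiM {..<m} (\<lambda>_. borel)) (\<lambda>\<omega>. restrict (\<lambda>i. incr h i \<omega>) {..<m}) (PiM {m..<m + n} (\<lambda>_. borel)) (\<lambda>\<omega>. restrict (\<lambda>i. incr h i \<omega>) {m..<m + n})"
    by (rule indep_var_restrict[OF g_indep[OF h, of "m + n"]]) auto
  from indep_var_compose[OF this heis_prod_PiM_meas[of m "\<lambda>i. i"] heis_prod_PiM_meas[of n "\<lambda>i. m + i"]]
  have *: "indep_var (grid_space m) (\<lambda>\<omega>. \<lambda>j\<in>{..m}. heis_prod (restrict (\<lambda>i. incr h i \<omega>) {..<m}) j)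
     (grid_space n) (\<lambda>\<omega>. \<lambda>j\<in>{..n}. heis_prod (\<lambda>i. restrict (\<lambda>i. incr h i \<omega>) {m..<m + n} (m + i)) j)"
    by (simp add: comp_def)
  have 1: "(\<lambda>j\<in>{..m}. heis_prod (restrict (\<lambda>i. incr h i \<omega>) {..<m}) j) = past h m \<omega>" if "\<omega> \<in> space M" for \<omega>
    unfolding past_def using that by (intro restrict_ext heis_prod_incr_0) auto
  have 2: "(\<lambda>j\<in>{..n}. heis_prod (\<lambda>i. restrict (\<lambda>i. incr h i \<omega>) {m..<m + n} (m + i)) j) = future h m n \<omega>" for \<omega>
    unfolding future_def by (intro restrict_ext) (subst heis_prod_incr[symmetric], auto intro!: heis_prod_cong)
  \<comment> \<open>The products equal \<open>past\<close> only on \<open>space M\<close>, where the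
    path starts at \<open>0\<close>, so independence is transferred through the joint laws.\<close>
  have "random_variable (grid_space m) (past h m)" "random_variable (grid_space n) (future h m n)" by auto
  moreover have "distr M (grid_space m) (past h m) = distr M (grid_space m) (\<lambda>\<omega>. \<lambda>j\<in>{..m}. heis_prod (restrict (\<lambda>i. incr h i \<omega>) {..<m}) j)"
    by (intro distr_cong) (auto simp: 1 simp del: of_nat_Suc)
  moreover have "distr M (grid_space m \<Otimes>\<^sub>M grid_space n) (\<lambda>\<omega>. (past h m \<omega>, future h m n \<omega>)) = distr M (grid_space m \<Otimes>\<^sub>M grid_space n) (\<lambda>\<omega>. (\<lambda>j\<in>{..m}. heis_prod (restrict (\<lambda>i. incr h i \<omega>) {..<m}) j, future h m n \<omega>))"
    by (intro distr_cong) (auto simp: 1 simp del: of_nat_Suc)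
  ultimately show ?thesis
    using * unfolding indep_var_distribution_eq 2 by simp
qed

text \<open>Events decided by the path at the points of one dyadic refinement of the grid up to time
  \<open>m h\<close>. Two levels have a common refinement, so the family is intersection stable and
  independence extends to the generated \<open>filt h m\<close>, which also contains events about
  the whole continuous path.\<close>

definition past_sets :: "real \<Rightarrow> nat \<Rightarrow> 'a set set" where
  "past_sets h m = (\<Union>k. {past (h / 2 ^ k) (m * 2 ^ k) -` S \<inter> space M | S. S \<in> sets (grid_space (m * 2 ^ k))})"

definition filt :: "real \<Rightarrow> nat \<Rightarrow> 'a measure" where
  "filt h m = sigma (space M) (past_sets h m)"

lemma past_sets_Pow: "past_sets h m \<subseteq> Pow (space M)"
  by (auto simp: past_sets_def)

lemma past_sets_events: "past_sets h m \<subseteq> events"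
  unfolding past_sets_def by (auto intro!: measurable_sets[OF past_meas])

lemma space_filt [simp]: "space (filt h m) = space M"
  and sets_filt: "sets (filt h m) = sigma_sets (space M) (past_sets h m)"
  using past_sets_Pow[of h m] by (auto simp: filt_def)

lemma filt_subset: "sets (filt h m) \<subseteq> events"
  unfolding sets_filt by (intro sets.sigma_sets_subset past_sets_events)

lemma filt_measurable_M: "f \<in> measurable (filt h m) N \<Longrightarrow> f \<in> measurable M N"
  using filt_subset[of h m] by (auto simp: measurable_def)

lemma past_refine:
  assumes "E = past (h / 2 ^ k) (m * 2 ^ k) -` S \<inter> space M" "S \<in> sets (grid_space (m * 2 ^ k))"
  shows "\<exists>S'\<in>sets (grid_space (m * 2 ^ (k + l))). E = past (h / 2 ^ (k + l)) (m * 2 ^ (k + l)) -` S' \<inter> space M"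
proof
  let ?\<pi> = "\<lambda>v. \<lambda>j\<in>{..m * 2 ^ k}. v (j * 2 ^ l) :: heis"
  have le: "j * 2 ^ l \<le> m * 2 ^ (k + l)" if "j \<le> m * 2 ^ k" for j
    using mult_right_mono[OF that, of "2 ^ l"] by (simp add: power_add mult.assoc)
  have \<pi>: "?\<pi> \<in> measurable (grid_space (m * 2 ^ (k + l))) (grid_space (m * 2 ^ k))"
    using le by (intro measurable_restrict measurable_component_singleton) auto
  show "?\<pi> -` S \<inter> space (grid_space (m * 2 ^ (k + l))) \<in> sets (grid_space (m * 2 ^ (k + l)))"
    by (rule measurable_sets[OF \<pi> assms(2)])
  have "past (h / 2 ^ k) (m * 2 ^ k) \<omega> = ?\<pi> (past (h / 2 ^ (k + l)) (m * 2 ^ (k + l)) \<omega>)" for \<omega>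
    unfolding past_def using le by (intro restrict_ext) (auto simp: power_add)
  moreover have "past (h / 2 ^ (k + l)) (m * 2 ^ (k + l)) \<omega> \<in> space (grid_space (m * 2 ^ (k + l)))" for \<omega>
    by (auto simp: past_def space_PiM)
  ultimately show "E = past (h / 2 ^ (k + l)) (m * 2 ^ (k + l)) -` (?\<pi> -` S \<inter> space (grid_space (m * 2 ^ (k + l)))) \<inter> space M"
    unfolding assms(1) by auto
qed

lemma Int_stable_past_sets: "Int_stable (past_sets h m)"
proof (rule Int_stableI)
  fix E F assume "E \<in> past_sets h m" "F \<in> past_sets h m"
  then obtain k S l T where E: "E = past (h / 2 ^ k) (m * 2 ^ k) -` S \<inter> space M" "S \<in> sets (grid_space (m * 2 ^ k))"
    and F: "F = past (h / 2 ^ l) (m * 2 ^ l) -` T \<inter> space M" "T \<in> sets (grid_space (m * 2 ^ l))"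
    by (auto simp: past_sets_def)
  obtain S' where S': "S' \<in> sets (grid_space (m * 2 ^ (k + l)))" "E = past (h / 2 ^ (k + l)) (m * 2 ^ (k + l)) -` S' \<inter> space M"
    using past_refine[OF E, of l] by auto
  obtain T' where T': "T' \<in> sets (grid_space (m * 2 ^ (k + l)))" "F = past (h / 2 ^ (k + l)) (m * 2 ^ (k + l)) -` T' \<inter> space M"
    using past_refine[OF F, of k] by (auto simp: add.commute)
  have "E \<inter> F = past (h / 2 ^ (k + l)) (m * 2 ^ (k + l)) -` (S' \<inter> T') \<inter> space M" using S' T' by auto
  then show "E \<inter> F \<in> past_sets h m"
    using S'(1) T'(1) unfolding past_sets_def by blast
qed

lemma future_refine: "future (h / 2 ^ l) (m * 2 ^ l) (n * 2 ^ l) \<omega> =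
    (\<lambda>j\<in>{..n * 2 ^ l}. future (h / 2 ^ (k + l)) (m * 2 ^ (k + l)) (n * 2 ^ (k + l)) \<omega> (j * 2 ^ k))"
  unfolding future_def
proof (rule restrict_ext)
  fix j assume "j \<in> {..n * 2 ^ l}"
  then have "j * 2 ^ k \<le> n * 2 ^ (k + l)"
    using mult_right_mono[of j "n * 2 ^ l" "2 ^ k"] by (simp add: power_add ac_simps)
  moreover have "real (m * 2 ^ (k + l) + j * 2 ^ k) = 2 ^ k * real (m * 2 ^ l + j)"
    by (simp add: power_add algebra_simps)
  then have "real (m * 2 ^ (k + l) + j * 2 ^ k) * (h / 2 ^ (k + l)) = real (m * 2 ^ l + j) * (h / 2 ^ l)"
    by (simp add: power_add del: of_nat_add)
  ultimately show "- g (real (m * 2 ^ l) * (h / 2 ^ l)) \<omega> \<odot> g (real (m * 2 ^ l + j) * (h / 2 ^ l)) \<omega> =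
     (\<lambda>j\<in>{..n * 2 ^ (k + l)}. - g (real (m * 2 ^ (k + l)) * (h / 2 ^ (k + l))) \<omega> \<odot> g (real (m * 2 ^ (k + l) + j) * (h / 2 ^ (k + l))) \<omega>) (j * 2 ^ k)"
    by (simp del: of_nat_add)
qed

text \<open>Independence of past and future in the form that Fubini needs: the joint law is a
  product, with the identity map into \<open>filt h m\<close> standing for the past.\<close>

lemma indep_filt_future:
  fixes h :: real and m n l :: nat
  assumes h: "0 < h"
  defines "Y \<equiv> future (h / 2 ^ l) (m * 2 ^ l) (n * 2 ^ l)"
  shows "distr M (filt h m) (\<lambda>\<omega>. \<omega>) \<Otimes>\<^sub>M distr M (grid_space (n * 2 ^ l)) Y
    = distr M (filt h m \<Otimes>\<^sub>M grid_space (n * 2 ^ l)) (\<lambda>\<omega>. (\<omega>, Y \<omega>))"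
proof -
  let ?F = "{future (h / 2 ^ l) (m * 2 ^ l) (n * 2 ^ l) -` T \<inter> space M | T. T \<in> sets (grid_space (n * 2 ^ l))}"
  have "indep_set (past_sets h m) ?F"
    unfolding indep_sets2_eq
  proof (intro conjI ballI)
    show "past_sets h m \<subseteq> events" by (rule past_sets_events)
    show "?F \<subseteq> events" by (auto intro!: measurable_sets[OF future_meas])
    fix E F assume "E \<in> past_sets h m" "F \<in> ?F"
    then obtain k S T where E: "E = past (h / 2 ^ k) (m * 2 ^ k) -` S \<inter> space M" "S \<in> sets (grid_space (m * 2 ^ k))"
      and F: "F = future (h / 2 ^ l) (m * 2 ^ l) (n * 2 ^ l) -` T \<inter> space M" "T \<in> sets (grid_space (n * 2 ^ l))"
      by (auto simp: past_sets_def)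
    obtain S' where S': "S' \<in> sets (grid_space (m * 2 ^ (k + l)))" "E = past (h / 2 ^ (k + l)) (m * 2 ^ (k + l)) -` S' \<inter> space M"
      using past_refine[OF E, of l] by auto
    let ?\<pi> = "\<lambda>v. \<lambda>j\<in>{..n * 2 ^ l}. v (j * 2 ^ k) :: heis"
    let ?X = "past (h / 2 ^ (k + l)) (m * 2 ^ (k + l))" and ?Y = "future (h / 2 ^ (k + l)) (m * 2 ^ (k + l)) (n * 2 ^ (k + l))"
    have le: "j * 2 ^ k \<le> n * 2 ^ (k + l)" if "j \<le> n * 2 ^ l" for j
      using mult_right_mono[OF that, of "2 ^ k"] by (simp add: power_add ac_simps)
    have \<pi>: "?\<pi> \<in> measurable (grid_space (n * 2 ^ (k + l))) (grid_space (n * 2 ^ l))"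
      using le by (intro measurable_restrict measurable_component_singleton) auto
    let ?T = "?\<pi> -` T \<inter> space (grid_space (n * 2 ^ (k + l)))"
    have T: "?T \<in> sets (grid_space (n * 2 ^ (k + l)))" by (rule measurable_sets[OF \<pi> F(2)])
    have "?Y \<omega> \<in> space (grid_space (n * 2 ^ (k + l)))" for \<omega> by (auto simp: future_def space_PiM)
    then have F': "F = ?Y -` ?T \<inter> space M"
      unfolding F(1) future_refine[of h l m n _ k] by auto
    have "indep_var (grid_space (m * 2 ^ (k + l))) ?X (grid_space (n * 2 ^ (k + l))) ?Y"
      using h by (intro indep_past_future) auto
    from indep_varD[OF this S'(1) T]
    have "prob ((\<lambda>x. (?X x, ?Y x)) -` (S' \<times> ?T) \<inter> space M) = prob (?X -` S' \<inter> space M) * prob (?Y -` ?T \<inter> space M)" .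
    moreover have "(\<lambda>x. (?X x, ?Y x)) -` (S' \<times> ?T) \<inter> space M = E \<inter> F" unfolding S'(2) F' by auto
    moreover have "?X -` S' \<inter> space M = E" using S'(2) by simp
    moreover have "?Y -` ?T \<inter> space M = F" by (rule F'[symmetric])
    ultimately show "prob (E \<inter> F) = prob E * prob F" by (simp only:)
  qed
  moreover have "Int_stable ?F"
  proof (rule Int_stableI)
    fix E F assume "E \<in> ?F" "F \<in> ?F"
    then obtain S T where "E = future (h / 2 ^ l) (m * 2 ^ l) (n * 2 ^ l) -` S \<inter> space M" "S \<in> sets (grid_space (n * 2 ^ l))"
      "F = future (h / 2 ^ l) (m * 2 ^ l) (n * 2 ^ l) -` T \<inter> space M" "T \<in> sets (grid_space (n * 2 ^ l))" by auto
    then have "E \<inter> F = future (h / 2 ^ l) (m * 2 ^ l) (n * 2 ^ l) -` (S \<inter> T) \<inter> space M" "S \<inter> T \<in> sets (grid_space (n * 2 ^ l))" by auto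
    then show "E \<inter> F \<in> ?F" by blast
  qed
  ultimately have "indep_set (sigma_sets (space M) (past_sets h m)) (sigma_sets (space M) ?F)"
    by (intro indep_set_sigma_sets Int_stable_past_sets)
  then have ind: "prob (E \<inter> (Y -` T \<inter> space M)) = prob E * prob (Y -` T \<inter> space M)"
    if "E \<in> sets (filt h m)" "T \<in> sets (grid_space (n * 2 ^ l))" for E T
  proof -
    have "Y -` T \<inter> space M \<in> sigma_sets (space M) ?F"
      using that(2) unfolding Y_def by (intro sigma_sets.Basic) blast
    with that(1) \<open>indep_set (sigma_sets (space M) (past_sets h m)) (sigma_sets (space M) ?F)\<close> show ?thesis
      unfolding indep_sets2_eq sets_filt by blast
  qed
  have id [measurable]: "(\<lambda>\<omega>. \<omega>) \<in> measurable M (filt h m)"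
    by (rule filt_measurable_M[of _ h m]) simp
  have Y [measurable]: "Y \<in> measurable M (grid_space (n * 2 ^ l))" unfolding Y_def by simp
  interpret P: prob_space "distr M (filt h m) (\<lambda>\<omega>. \<omega>)" by (rule prob_space_distr) simp
  interpret F: prob_space "distr M (grid_space (n * 2 ^ l)) Y" by (rule prob_space_distr) simp
  show ?thesis
  proof (rule pair_measure_eqI)
    fix E T assume "E \<in> sets (distr M (filt h m) (\<lambda>\<omega>. \<omega>))" "T \<in> sets (distr M (grid_space (n * 2 ^ l)) Y)"
    then have ET [measurable]: "E \<in> sets (filt h m)" "T \<in> sets (grid_space (n * 2 ^ l))" by auto
    have sub: "E \<subseteq> space M" using sets.sets_into_space[OF ET(1)] by simp
    have "emeasure (distr M (filt h m \<Otimes>\<^sub>M grid_space (n * 2 ^ l)) (\<lambda>\<omega>. (\<omega>, Y \<omega>))) (E \<times> T) = emeasure M (E \<inter> (Y -` T \<inter> space M))"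
      using sub by (subst emeasure_distr) (auto intro!: arg_cong[where f="emeasure M"])
    also have "\<dots> = emeasure M E * emeasure M (Y -` T \<inter> space M)"
      using ind[OF ET] by (simp add: emeasure_eq_measure ennreal_mult)
    also have "emeasure M E = emeasure (distr M (filt h m) (\<lambda>\<omega>. \<omega>)) E"
      using sub by (subst emeasure_distr) (auto simp: Int_absorb2)
    also have "emeasure M (Y -` T \<inter> space M) = emeasure (distr M (grid_space (n * 2 ^ l)) Y) T"
      by (subst emeasure_distr) auto
    finally show "emeasure (distr M (filt h m) (\<lambda>\<omega>. \<omega>)) E * emeasure (distr M (grid_space (n * 2 ^ l)) Y) T
       = emeasure (distr M (filt h m \<Otimes>\<^sub>M grid_space (n * 2 ^ l)) (\<lambda>\<omega>. (\<omega>, Y \<omega>))) (E \<times> T)" by simp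
  qed (auto intro: P.sigma_finite_measure_axioms F.sigma_finite_measure_axioms)
qed

lemma g_filt_meas_grid:
  assumes "j \<le> m * 2 ^ k"
  shows "g (real j * (h / 2 ^ k)) \<in> borel_measurable (filt h m)"
proof (rule measurableI)
  fix B :: "heis set" assume B: "B \<in> sets borel"
  let ?S = "{v \<in> space (grid_space (m * 2 ^ k)). v j \<in> B}"
  have "?S \<in> sets (grid_space (m * 2 ^ k))"
    using measurable_sets[OF measurable_component_singleton[of j "{..m * 2 ^ k}" "\<lambda>_. borel"] B] assms
    by (simp add: vimage_def Int_def conj_commute)
  moreover have "past (h / 2 ^ k) (m * 2 ^ k) \<omega> \<in> space (grid_space (m * 2 ^ k))" for \<omega> by (auto simp: past_def space_PiM)
  then have "g (real j * (h / 2 ^ k)) -` B \<inter> space M = past (h / 2 ^ k) (m * 2 ^ k) -` ?S \<inter> space M"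
    using assms by (auto simp: past_def)
  ultimately show "g (real j * (h / 2 ^ k)) -` B \<inter> space (filt h m) \<in> sets (filt h m)"
    unfolding sets_filt space_filt past_sets_def by (intro sigma_sets.Basic) blast
qed auto

end

text \<open>Each time is a limit of dyadic times from the left, and a continuous path that lies in a
  closed set at these lies in it at their limit. This reduces confinement to countably many
  conditions.\<close>

lemma dyadic_closed_iff:
  fixes p :: "real \<Rightarrow> 'b::t2_space"
  assumes p: "continuous_on {0..} p" and C: "closed C" and h: "0 < h"
  shows "(\<forall>l. \<forall>j\<le>n * 2 ^ l. p (real j * (h / 2 ^ l)) \<in> C) \<longleftrightarrow> (\<forall>u\<in>{0..real n * h}. p u \<in> C)"
proof safe
  fix u assume *: "\<forall>l. \<forall>j\<le>n * 2 ^ l. p (real j * (h / 2 ^ l)) \<in> C" and u: "u \<in> {0..real n * h}"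
  define j where "j l = nat \<lfloor>u / h * 2 ^ l\<rfloor>" for l :: nat
  have j_le: "real (j l) \<le> u / h * 2 ^ l" for l using u h by (simp add: j_def)
  have j_gt: "u / h * 2 ^ l < real (j l) + 1" for l using u h unfolding j_def by (simp add: floor_le_iff)
  have "real (j l) \<le> real (n * 2 ^ l)" for l
  proof -
    have "u / h \<le> real n" using u h by (simp add: field_simps)
    then have "u / h * 2 ^ l \<le> real n * 2 ^ l" by (intro mult_right_mono) auto
    then show ?thesis using j_le[of l] by simp
  qed
  then have jn: "j l \<le> n * 2 ^ l" for l by (simp only: of_nat_le_iff)
  have "(\<lambda>l. u - h * (1 / 2) ^ l) \<longlonglongrightarrow> u - h * 0"
    by (intro tendsto_intros LIMSEQ_power_zero) auto
  then have lim0: "(\<lambda>l. u - h / 2 ^ l) \<longlonglongrightarrow> u" by (simp add: power_divide)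
  have lim: "(\<lambda>l. real (j l) * (h / 2 ^ l)) \<longlonglongrightarrow> u"
  proof (rule tendsto_sandwich[OF _ _ lim0 tendsto_const])
    show "\<forall>\<^sub>F l in sequentially. u - h / 2 ^ l \<le> real (j l) * (h / 2 ^ l)"
    proof (intro always_eventually allI)
      fix l
      have "u < (real (j l) + 1) * (h / 2 ^ l)" using j_gt[of l] h by (simp add: field_simps)
      then show "u - h / 2 ^ l \<le> real (j l) * (h / 2 ^ l)" unfolding distrib_right by simp
    qed
    show "\<forall>\<^sub>F l in sequentially. real (j l) * (h / 2 ^ l) \<le> u"
      using h j_le by (intro always_eventually allI) (simp add: field_simps)
  qed
  have "(\<lambda>l. p (real (j l) * (h / 2 ^ l))) \<longlonglongrightarrow> p u"
    using h u by (intro continuous_on_tendsto_compose[OF p lim]) auto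
  then show "p u \<in> C"
    by (rule Lim_in_closed_set[OF C, rotated 2]) (use * jn in auto)
next
  fix l j assume *: "\<forall>u\<in>{0..real n * h}. p u \<in> C" and "j \<le> n * 2 ^ l"
  then have "real j \<le> real n * 2 ^ l" by (metis of_nat_le_iff of_nat_mult of_nat_numeral of_nat_power)
  then show "p (real j * (h / 2 ^ l)) \<in> C" using h by (intro *[rule_format]) (auto simp: field_simps)
qed

section \<open>The Markov property in continuous time\<close>

context heis_bm
begin

text \<open>The measure \<open>N\<close> is a parameter so that the same argument yields events of
  \<open>M\<close> and events of a \<open>filt\<close>.\<close>

lemma sets_stay:
  fixes p :: "real \<Rightarrow> 'a \<Rightarrow> heis"
  assumes p: "\<And>\<omega>. \<omega> \<in> space M \<Longrightarrow> continuous_on {0..} (\<lambda>u. p u \<omega>)" and C: "closed C" and h: "0 < h"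
    and m: "\<And>l j. j \<le> n * 2 ^ l \<Longrightarrow> p (real j * (h / 2 ^ l)) \<in> borel_measurable N" and N: "space N = space M"
  shows "{\<omega> \<in> space M. \<forall>u\<in>{0..real n * h}. p u \<omega> \<in> C} \<in> sets N"
proof -
  have "{\<omega> \<in> space M. \<forall>u\<in>{0..real n * h}. p u \<omega> \<in> C} = (\<Inter>l. \<Inter>j\<in>{..n * 2 ^ l}. p (real j * (h / 2 ^ l)) -` C \<inter> space N)"
    using dyadic_closed_iff[OF p C h, of _ n] unfolding N by auto
  also have "\<dots> \<in> sets N"
  proof (rule sets.countable_INT')
    have "(\<Inter>j\<in>{..n * 2 ^ l}. p (real j * (h / 2 ^ l)) -` C \<inter> space N) \<in> sets N" for l
      using C by (intro sets.finite_INT measurable_sets[OF m]) auto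
    then show "range (\<lambda>l. \<Inter>j\<in>{..n * 2 ^ l}. p (real j * (h / 2 ^ l)) -` C \<inter> space N) \<subseteq> sets N"
      by (rule image_subsetI)
  qed auto
  finally show ?thesis .
qed

lemma g_cont_mult: "\<omega> \<in> space M \<Longrightarrow> continuous_on {0..} (\<lambda>u. y \<odot> g u \<omega>)"
  by (intro continuous_intros g_cont)

lemma g_cont_shift: "\<omega> \<in> space M \<Longrightarrow> 0 \<le> s \<Longrightarrow> continuous_on {0..} (\<lambda>u. y \<odot> g (s + u) \<omega>)"
  by (intro continuous_intros continuous_on_compose2[OF g_cont]) auto

lemma g_filt_meas [measurable]: "g (real m * h) \<in> borel_measurable (filt h m)"
  using g_filt_meas_grid[of m m 0 h] by simp

lemma events_stay:
  assumes "closed C" "0 \<le> t"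
  shows "{\<omega> \<in> space M. \<forall>u\<in>{0..t}. y \<odot> g u \<omega> \<in> C} \<in> events"
proof (cases "t = 0")
  case False
  then show ?thesis using sets_stay[of "\<lambda>u \<omega>. y \<odot> g u \<omega>" C t 1 M] assms g_cont_mult by auto
next
  case True
  have [measurable]: "C \<in> sets borel" using assms(1) by simp
  have "{\<omega> \<in> space M. y \<odot> g 0 \<omega> \<in> C} \<in> events" by measurable
  then show ?thesis using True by simp
qed

definition stay :: "heis set \<Rightarrow> heis set \<Rightarrow> real \<Rightarrow> heis \<Rightarrow> real" where
  "stay C C' t y = prob {\<omega> \<in> space M. (\<forall>u\<in>{0..t}. y \<odot> g u \<omega> \<in> C) \<and> y \<odot> g t \<omega> \<in> C'}"

text \<open>The increments after time \<open>s\<close>, restarted at \<open>\<psi> \<omega>\<close>.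
  With \<open>\<psi> = y \<odot> g s\<close> this is the true continuation of the path from
  \<open>y\<close>; with constant \<open>\<psi>\<close> it is a fresh start independent of the
  past.\<close>

definition fut_event :: "heis set \<Rightarrow> heis set \<Rightarrow> real \<Rightarrow> real \<Rightarrow> ('a \<Rightarrow> heis) \<Rightarrow> 'a set" where
  "fut_event C C' s t \<psi> = {\<omega> \<in> space M. (\<forall>u\<in>{0..t}. \<psi> \<omega> \<odot> (- g s \<omega> \<odot> g (s + u) \<omega>) \<in> C) \<and>
     \<psi> \<omega> \<odot> (- g s \<omega> \<odot> g (s + t) \<omega>) \<in> C'}"

lemma stay_bounds: "0 \<le> stay C C' t y" "stay C C' t y \<le> 1"
  by (auto simp: stay_def)

text \<open>Fubini on the product of past and future: with the past \<open>\<omega>\<close> frozen,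
  the section of the event has probability \<open>Q (\<psi> \<omega>)\<close>, because the future
  increments have the law of the path from \<open>0\<close>.\<close>

lemma markov_grid:
  fixes h :: real and m n l :: nat
  assumes h: "0 < h" and E: "E \<in> sets (filt h m)" and \<psi> [measurable]: "\<psi> \<in> borel_measurable (filt h m)"
    and C [measurable]: "C \<in> sets borel" and C' [measurable]: "C' \<in> sets borel"
  defines "N \<equiv> n * 2 ^ l" and "d \<equiv> h / 2 ^ l"
  defines "Q \<equiv> \<lambda>y. prob {\<omega> \<in> space M. (\<forall>j\<le>N. y \<odot> g (real j * d) \<omega> \<in> C) \<and> y \<odot> g (real N * d) \<omega> \<in> C'}"
  shows "(\<lambda>\<omega>. indicator E \<omega> * Q (\<psi> \<omega>)) \<in> borel_measurable M"
    and "prob {\<omega> \<in> E. (\<forall>j\<le>N. \<psi> \<omega> \<odot> (- g (real m * h) \<omega> \<odot> g (real m * h + real j * d) \<omega>) \<in> C) \<and>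
        \<psi> \<omega> \<odot> (- g (real m * h) \<omega> \<odot> g (real m * h + real N * d) \<omega>) \<in> C'}
      = expectation (\<lambda>\<omega>. indicator E \<omega> * Q (\<psi> \<omega>))"
proof -
  define Y where "Y = future d (m * 2 ^ l) N"
  have d: "0 < d" using h by (simp add: d_def)
  have Y_eq: "Y \<omega> j = - g (real m * h) \<omega> \<odot> g (real m * h + real j * d) \<omega>" if "j \<le> N" for \<omega> j
  proof -
    have *: "real (m * 2 ^ l) * d = real m * h" by (simp add: d_def)
    then have "real (m * 2 ^ l + j) * d = real m * h + real j * d" by (simp only: of_nat_add distrib_right)
    then show ?thesis using that * by (simp add: Y_def future_def del: of_nat_add of_nat_mult)
  qed
  have Y [measurable]: "Y \<in> measurable M (grid_space N)" by (simp add: Y_def)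
  have id [measurable]: "(\<lambda>\<omega>. \<omega>) \<in> measurable M (filt h m)" by (rule filt_measurable_M[of _ h m]) simp
  let ?P = "distr M (filt h m) (\<lambda>\<omega>. \<omega>)" and ?F = "distr M (grid_space N) Y"
  interpret P: prob_space ?P by (rule prob_space_distr) simp
  interpret F: prob_space ?F by (rule prob_space_distr) simp
  have joint: "?P \<Otimes>\<^sub>M ?F = distr M (filt h m \<Otimes>\<^sub>M grid_space N) (\<lambda>\<omega>. (\<omega>, Y \<omega>))"
    using indep_filt_future[OF h, of m n l] by (simp add: Y_def N_def d_def)
  let ?X = "filt h m \<Otimes>\<^sub>M grid_space N"
  have mj: "(\<lambda>p. \<psi> (fst p) \<odot> snd p j) \<in> borel_measurable ?X" if "j \<le> N" for j
    using that by (intro borel_measurable_heis_mult measurable_compose[OF measurable_fst \<psi>]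
        measurable_compose[OF measurable_snd measurable_component_singleton]) auto
  define S where "S = {p \<in> space ?X. fst p \<in> E \<and> (\<forall>j\<le>N. \<psi> (fst p) \<odot> snd p j \<in> C) \<and> \<psi> (fst p) \<odot> snd p N \<in> C'}"
  have S_eq: "S = (fst -` E \<inter> space ?X) \<inter> (\<Inter>j\<in>{..N}. (\<lambda>p. \<psi> (fst p) \<odot> snd p j) -` C \<inter> space ?X) \<inter> ((\<lambda>p. \<psi> (fst p) \<odot> snd p N) -` C' \<inter> space ?X)"
    by (auto simp: S_def)
  have S: "S \<in> sets ?X"
    unfolding S_eq using E mj
    by (intro sets.Int sets.finite_INT measurable_sets[OF measurable_fst] measurable_sets[OF mj]) auto
  have S': "S \<in> sets (?P \<Otimes>\<^sub>M ?F)" using S by (simp cong: sets_pair_measure_cong)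
  have slice: "measure ?F (Pair \<omega> -` S) = indicator E \<omega> * Q (\<psi> \<omega>)" if \<omega>: "\<omega> \<in> space M" for \<omega>
  proof -
    have sl: "Pair \<omega> -` S \<in> sets (grid_space N)" by (rule sets_Pair1[OF S])
    have "?F = distr M (grid_space N) (past d N)"
      unfolding Y_def by (rule future_law[OF d])
    then have "measure ?F (Pair \<omega> -` S) = prob (past d N -` (Pair \<omega> -` S) \<inter> space M)"
      using sl by (simp add: measure_distr)
    also have "past d N -` (Pair \<omega> -` S) \<inter> space M = (if \<omega> \<in> E then {\<omega>' \<in> space M. (\<forall>j\<le>N. \<psi> \<omega> \<odot> g (real j * d) \<omega>' \<in> C) \<and> \<psi> \<omega> \<odot> g (real N * d) \<omega>' \<in> C'} else {})"
      using \<omega> by (auto simp: S_def past_def space_pair_measure space_PiM)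
    also have "prob \<dots> = indicator E \<omega> * Q (\<psi> \<omega>)" by (simp add: Q_def)
    finally show ?thesis .
  qed
  \<comment> \<open>Measurability of the transition probability comes from sections of a measurable
    set, not from regularity of \<open>Q\<close> in the starting point.\<close>
  have "(\<lambda>\<omega>. emeasure ?F (Pair \<omega> -` S)) \<in> borel_measurable ?P"
    by (rule F.measurable_emeasure_Pair[OF S'])
  then have "(\<lambda>\<omega>. emeasure ?F (Pair \<omega> -` S)) \<in> borel_measurable (filt h m)" by simp
  then have em: "(\<lambda>\<omega>. emeasure ?F (Pair \<omega> -` S)) \<in> borel_measurable M" by (rule filt_measurable_M)
  then have "(\<lambda>\<omega>. measure ?F (Pair \<omega> -` S)) \<in> borel_measurable M"
    unfolding measure_def by measurable
  then show meas: "(\<lambda>\<omega>. indicator E \<omega> * Q (\<psi> \<omega>)) \<in> borel_measurable M"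
    by (subst measurable_cong[OF slice[symmetric]]) auto
  have sub: "E \<subseteq> space M" using sets.sets_into_space[OF E] by simp
  have space_Y: "Y \<omega> \<in> space (grid_space N)" for \<omega> by (auto simp: Y_def future_def space_PiM)
  let ?A = "{\<omega> \<in> E. (\<forall>j\<le>N. \<psi> \<omega> \<odot> (- g (real m * h) \<omega> \<odot> g (real m * h + real j * d) \<omega>) \<in> C) \<and>
        \<psi> \<omega> \<odot> (- g (real m * h) \<omega> \<odot> g (real m * h + real N * d) \<omega>) \<in> C'}"
  have A: "?A = (\<lambda>\<omega>. (\<omega>, Y \<omega>)) -` S \<inter> space M"
    using sub space_Y by (auto simp: S_def Y_eq space_pair_measure)
  have "emeasure M ?A = emeasure (?P \<Otimes>\<^sub>M ?F) S"
    unfolding joint A using S by (subst emeasure_distr) auto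
  also have "\<dots> = (\<integral>\<^sup>+\<omega>. emeasure ?F (Pair \<omega> -` S) \<partial>?P)"
    by (rule F.emeasure_pair_measure_alt[OF S'])
  also have "\<dots> = (\<integral>\<^sup>+\<omega>. emeasure ?F (Pair \<omega> -` S) \<partial>M)"
    using F.measurable_emeasure_Pair[OF S'] by (subst nn_integral_distr) auto
  also have "\<dots> = (\<integral>\<^sup>+\<omega>. ennreal (indicator E \<omega> * Q (\<psi> \<omega>)) \<partial>M)"
    by (intro nn_integral_cong) (simp add: F.emeasure_eq_measure slice)
  also have "\<dots> = ennreal (expectation (\<lambda>\<omega>. indicator E \<omega> * Q (\<psi> \<omega>)))"
  proof (rule nn_integral_eq_integral)
    show "integrable M (\<lambda>\<omega>. indicator E \<omega> * Q (\<psi> \<omega>))"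
      using meas by (intro integrable_const_bound[of _ 1]) (auto simp: Q_def indicator_def)
  qed (simp add: Q_def)
  finally show "prob ?A = expectation (\<lambda>\<omega>. indicator E \<omega> * Q (\<psi> \<omega>))"
    by (simp add: emeasure_eq_measure Q_def integral_nonneg_AE)
qed

lemma stay_grid_tendsto:
  assumes h: "0 < h" and C: "closed C" and C' [measurable]: "C' \<in> sets borel"
  shows "(\<lambda>l. prob {\<omega> \<in> space M. (\<forall>j\<le>n * 2 ^ l. y \<odot> g (real j * (h / 2 ^ l)) \<omega> \<in> C) \<and> y \<odot> g (real n * h) \<omega> \<in> C'})
    \<longlonglongrightarrow> stay C C' (real n * h) y"
proof -
  have [measurable]: "C \<in> sets borel" using C by simp
  let ?A = "\<lambda>l. {\<omega> \<in> space M. (\<forall>j\<le>n * 2 ^ l. y \<odot> g (real j * (h / 2 ^ l)) \<omega> \<in> C) \<and> y \<odot> g (real n * h) \<omega> \<in> C'}"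
  have "decseq ?A"
  proof (rule decseq_SucI, safe)
    fix l \<omega> j assume *: "\<forall>j\<le>n * 2 ^ Suc l. y \<odot> g (real j * (h / 2 ^ Suc l)) \<omega> \<in> C" "j \<le> n * 2 ^ l"
    then have "y \<odot> g (real (j * 2) * (h / 2 ^ Suc l)) \<omega> \<in> C" by (intro *(1)[rule_format]) simp
    then show "y \<odot> g (real j * (h / 2 ^ l)) \<omega> \<in> C" by simp
  qed
  then have "(\<lambda>l. prob (?A l)) \<longlonglongrightarrow> prob (\<Inter>l. ?A l)"
    by (intro finite_Lim_measure_decseq) auto
  also have "(\<Inter>l. ?A l) = {\<omega> \<in> space M. (\<forall>u\<in>{0..real n * h}. y \<odot> g u \<omega> \<in> C) \<and> y \<odot> g (real n * h) \<omega> \<in> C'}"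
    using dyadic_closed_iff[of "\<lambda>u. y \<odot> g u _" C h n, OF g_cont_mult C h] by auto
  finally show ?thesis by (simp add: stay_def)
qed

text \<open>The grid events decrease to the continuous-time event as the mesh is refined, and
  dominated convergence handles the expectations.\<close>

theorem markov:
  assumes h: "0 < h" and E: "E \<in> sets (filt h m)" and \<psi>: "\<psi> \<in> borel_measurable (filt h m)"
    and C: "closed C" and C': "C' \<in> sets borel"
  shows "(\<lambda>\<omega>. indicator E \<omega> * stay C C' (real n * h) (\<psi> \<omega>)) \<in> borel_measurable M"
    and "prob (E \<inter> fut_event C C' (real m * h) (real n * h) \<psi>) = expectation (\<lambda>\<omega>. indicator E \<omega> * stay C C' (real n * h) (\<psi> \<omega>))"
proof -
  define Q where "Q l y = prob {\<omega> \<in> space M. (\<forall>j\<le>n * 2 ^ l. y \<odot> g (real j * (h / 2 ^ l)) \<omega> \<in> C) \<and> y \<odot> g (real n * h) \<omega> \<in> C'}" for l y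
  define A where "A l = {\<omega> \<in> E. (\<forall>j\<le>n * 2 ^ l. \<psi> \<omega> \<odot> (- g (real m * h) \<omega> \<odot> g (real m * h + real j * (h / 2 ^ l)) \<omega>) \<in> C) \<and>
        \<psi> \<omega> \<odot> (- g (real m * h) \<omega> \<odot> g (real m * h + real n * h) \<omega>) \<in> C'}" for l
  have CB [measurable]: "C \<in> sets borel" using C by simp
  note C' [measurable]
  have [measurable]: "\<psi> \<in> borel_measurable M" using \<psi> by (rule filt_measurable_M)
  have EM [measurable]: "E \<in> events" using E filt_subset by auto
  have A_meas: "A l \<in> events" for l unfolding A_def by measurable
  have Qm: "(\<lambda>\<omega>. indicator E \<omega> * Q l (\<psi> \<omega>)) \<in> borel_measurable M"
   and Qe: "prob (A l) = expectation (\<lambda>\<omega>. indicator E \<omega> * Q l (\<psi> \<omega>))" for l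
    using markov_grid[OF h E \<psi> CB C', of n l] by (simp_all add: Q_def A_def)
  have Q_lim: "(\<lambda>l. Q l y) \<longlonglongrightarrow> stay C C' (real n * h) y" for y
    unfolding Q_def by (rule stay_grid_tendsto[OF h C C'])
  have lim: "(\<lambda>l. indicator E \<omega> * Q l (\<psi> \<omega>)) \<longlonglongrightarrow> indicator E \<omega> * stay C C' (real n * h) (\<psi> \<omega>)" for \<omega>
    by (intro tendsto_intros Q_lim)
  show meas: "(\<lambda>\<omega>. indicator E \<omega> * stay C C' (real n * h) (\<psi> \<omega>)) \<in> borel_measurable M"
    by (rule borel_measurable_LIMSEQ_real[OF lim Qm])
  have int_lim: "(\<lambda>l. expectation (\<lambda>\<omega>. indicator E \<omega> * Q l (\<psi> \<omega>))) \<longlonglongrightarrow> expectation (\<lambda>\<omega>. indicator E \<omega> * stay C C' (real n * h) (\<psi> \<omega>))"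
    by (rule integral_dominated_convergence[where w="\<lambda>_. 1"])
       (use meas Qm lim in \<open>auto simp: Q_def indicator_def\<close>)
  have "decseq A"
  proof (rule decseq_SucI)
    fix l
    show "A (Suc l) \<subseteq> A l"
    proof
      fix \<omega> assume \<omega>: "\<omega> \<in> A (Suc l)"
      have "\<psi> \<omega> \<odot> (- g (real m * h) \<omega> \<odot> g (real m * h + real j * (h / 2 ^ l)) \<omega>) \<in> C" if "j \<le> n * 2 ^ l" for j
      proof -
        have "\<psi> \<omega> \<odot> (- g (real m * h) \<omega> \<odot> g (real m * h + real (j * 2) * (h / 2 ^ Suc l)) \<omega>) \<in> C"
          using \<omega> that by (auto simp: A_def simp del: of_nat_mult)
        then show ?thesis by simp
      qed
      then show "\<omega> \<in> A l" using \<omega> by (auto simp: A_def)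
    qed
  qed
  then have "(\<lambda>l. prob (A l)) \<longlonglongrightarrow> prob (\<Inter>l. A l)"
    using A_meas by (intro finite_Lim_measure_decseq) auto
  moreover have "(\<Inter>l. A l) = E \<inter> fut_event C C' (real m * h) (real n * h) \<psi>"
  proof -
    have *: "(\<forall>l. \<forall>j\<le>n * 2 ^ l. \<psi> \<omega> \<odot> (- g (real m * h) \<omega> \<odot> g (real m * h + real j * (h / 2 ^ l)) \<omega>) \<in> C)
       \<longleftrightarrow> (\<forall>u\<in>{0..real n * h}. \<psi> \<omega> \<odot> (- g (real m * h) \<omega> \<odot> g (real m * h + u) \<omega>) \<in> C)" if "\<omega> \<in> space M" for \<omega>
      using h that by (intro dyadic_closed_iff[OF _ C h]) (auto simp: heis_mult_assoc[symmetric] intro!: g_cont_shift)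
    have sub: "E \<subseteq> space M" using sets.sets_into_space[OF EM] .
    show ?thesis
    proof (intro set_eqI)
      fix \<omega>
      have "\<omega> \<in> (\<Inter>l. A l) \<longleftrightarrow> \<omega> \<in> E \<and> (\<forall>l. \<forall>j\<le>n * 2 ^ l. \<psi> \<omega> \<odot> (- g (real m * h) \<omega> \<odot> g (real m * h + real j * (h / 2 ^ l)) \<omega>) \<in> C)
         \<and> \<psi> \<omega> \<odot> (- g (real m * h) \<omega> \<odot> g (real m * h + real n * h) \<omega>) \<in> C'"
        by (auto simp: A_def)
      then show "\<omega> \<in> (\<Inter>l. A l) \<longleftrightarrow> \<omega> \<in> E \<inter> fut_event C C' (real m * h) (real n * h) \<psi>"
        using sub * by (cases "\<omega> \<in> E") (auto simp: fut_event_def)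
    qed
  qed
  ultimately have "(\<lambda>l. prob (A l)) \<longlonglongrightarrow> prob (E \<inter> fut_event C C' (real m * h) (real n * h) \<psi>)" by simp
  then show "prob (E \<inter> fut_event C C' (real m * h) (real n * h) \<psi>) = expectation (\<lambda>\<omega>. indicator E \<omega> * stay C C' (real n * h) (\<psi> \<omega>))"
    by (rule LIMSEQ_unique) (simp only: Qe int_lim)
qed

corollary markov_ge:
  assumes h: "0 < h" and E: "E \<in> sets (filt h m)" and \<psi>: "\<psi> \<in> borel_measurable (filt h m)"
    and C: "closed C" and C': "C' \<in> sets borel"
    and \<kappa>: "\<And>\<omega>. \<omega> \<in> E \<Longrightarrow> \<kappa> \<le> stay C C' (real n * h) (\<psi> \<omega>)"
  shows "prob E * \<kappa> \<le> prob (E \<inter> fut_event C C' (real m * h) (real n * h) \<psi>)"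
proof -
  note mk = markov[OF h E \<psi> C C', of n]
  have E' [measurable]: "E \<in> events" using E filt_subset by auto
  have "prob E * \<kappa> = expectation (\<lambda>\<omega>. indicator E \<omega> * \<kappa>)" by simp
  also have "\<dots> \<le> expectation (\<lambda>\<omega>. indicator E \<omega> * stay C C' (real n * h) (\<psi> \<omega>))"
  proof (rule integral_mono)
    show "integrable M (\<lambda>\<omega>. indicator E \<omega> * \<kappa>)" by (auto simp: less_top[symmetric])
    show "integrable M (\<lambda>\<omega>. indicator E \<omega> * stay C C' (real n * h) (\<psi> \<omega>))"
      using mk(1) stay_bounds by (intro integrable_const_bound[of _ 1]) (auto simp: indicator_def)
  qed (use \<kappa> in \<open>auto simp: indicator_def\<close>)
  finally show ?thesis unfolding mk(2) .
qed

corollary markov_le: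
  assumes h: "0 < h" and E: "E \<in> sets (filt h m)" and \<psi>: "\<psi> \<in> borel_measurable (filt h m)"
    and C: "closed C" and C': "C' \<in> sets borel"
    and \<kappa>: "\<And>\<omega>. \<omega> \<in> E \<Longrightarrow> stay C C' (real n * h) (\<psi> \<omega>) \<le> \<kappa>"
  shows "prob (E \<inter> fut_event C C' (real m * h) (real n * h) \<psi>) \<le> prob E * \<kappa>"
proof -
  note mk = markov[OF h E \<psi> C C', of n]
  have E' [measurable]: "E \<in> events" using E filt_subset by auto
  have "expectation (\<lambda>\<omega>. indicator E \<omega> * stay C C' (real n * h) (\<psi> \<omega>)) \<le> expectation (\<lambda>\<omega>. indicator E \<omega> * \<kappa>)"
  proof (rule integral_mono)
    show "integrable M (\<lambda>\<omega>. indicator E \<omega> * \<kappa>)" by (auto simp: less_top[symmetric])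
    show "integrable M (\<lambda>\<omega>. indicator E \<omega> * stay C C' (real n * h) (\<psi> \<omega>))"
      using mk(1) stay_bounds by (intro integrable_const_bound[of _ 1]) (auto simp: indicator_def)
  qed (use \<kappa> in \<open>auto simp: indicator_def\<close>)
  then show ?thesis unfolding mk(2) by simp
qed

corollary markov_const:
  assumes "0 < h" "E \<in> sets (filt h m)" "closed C" "C' \<in> sets borel"
  shows "prob (E \<inter> fut_event C C' (real m * h) (real n * h) (\<lambda>_. y)) = prob E * stay C C' (real n * h) y"
  using markov_ge[OF assms(1,2) _ assms(3,4), of "\<lambda>_. y" "stay C C' (real n * h) y" n]
    markov_le[OF assms(1,2) _ assms(3,4), of "\<lambda>_. y" n "stay C C' (real n * h) y"] by auto

lemma stay_scaling_grid:
  assumes h: "0 < h" and c: "0 < c" and C [measurable]: "C \<in> sets borel" and C' [measurable]: "C' \<in> sets borel"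
  shows "prob {\<omega> \<in> space M. (\<forall>j\<le>n. y \<odot> g (real j * (c * h)) \<omega> \<in> C) \<and> y \<odot> g (real n * (c * h)) \<omega> \<in> C'}
   = prob {\<omega> \<in> space M. (\<forall>j\<le>n. y \<odot> heis_dil (sqrt c) (g (real j * h) \<omega>) \<in> C) \<and> y \<odot> heis_dil (sqrt c) (g (real n * h) \<omega>) \<in> C'}"
proof -
  let ?T = "{v \<in> space (grid_space n). (\<forall>j\<le>n. y \<odot> v j \<in> C) \<and> y \<odot> v n \<in> C'}"
  have m: "(\<lambda>v. y \<odot> v j) \<in> borel_measurable (grid_space n)" if "j \<le> n" for j
    using that by (intro borel_measurable_heis_mult measurable_const measurable_component_singleton) auto
  have "?T = (\<Inter>j\<in>{..n}. (\<lambda>v. y \<odot> v j) -` C \<inter> space (grid_space n)) \<inter> ((\<lambda>v. y \<odot> v n) -` C' \<inter> space (grid_space n))" by auto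
  also have "\<dots> \<in> sets (grid_space n)"
    by (intro sets.Int sets.finite_INT measurable_sets[OF m]) auto
  finally have T: "?T \<in> sets (grid_space n)" .
  have Z: "(\<lambda>\<omega>. \<lambda>j\<in>{..n}. heis_dil (sqrt c) (past h n \<omega> j)) \<in> measurable M (grid_space n)"
    by (intro measurable_restrict) (auto simp: past_def)
  have "prob (past (c * h) n -` ?T \<inter> space M) = prob ((\<lambda>\<omega>. \<lambda>j\<in>{..n}. heis_dil (sqrt c) (past h n \<omega> j)) -` ?T \<inter> space M)"
    unfolding measure_distr[OF past_meas T, symmetric] measure_distr[OF Z T, symmetric] past_scaling[OF h c] ..
  moreover have "past (c * h) n -` ?T \<inter> space M = {\<omega> \<in> space M. (\<forall>j\<le>n. y \<odot> g (real j * (c * h)) \<omega> \<in> C) \<and> y \<odot> g (real n * (c * h)) \<omega> \<in> C'}"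
    by (auto simp: past_def space_PiM)
  moreover have "(\<lambda>\<omega>. \<lambda>j\<in>{..n}. heis_dil (sqrt c) (past h n \<omega> j)) -` ?T \<inter> space M
     = {\<omega> \<in> space M. (\<forall>j\<le>n. y \<odot> heis_dil (sqrt c) (g (real j * h) \<omega>) \<in> C) \<and> y \<odot> heis_dil (sqrt c) (g (real n * h) \<omega>) \<in> C'}"
    by (auto simp: past_def space_PiM)
  ultimately show ?thesis by simp
qed

text \<open>Brownian scaling. Time is stretched by \<open>c\<close> and space by the dilation
  \<open>sqrt c\<close>; the identity holds on every dyadic grid and passes to the limit.\<close>

lemma stay_scaling:
  assumes c: "0 < c" and t: "0 < t" and C: "closed C" and C': "C' \<in> sets borel"
  shows "stay C C' (c * t) y = stay (heis_dil (sqrt c) -` C) (heis_dil (sqrt c) -` C') t (heis_dil (1 / sqrt c) y)"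
proof (rule LIMSEQ_unique)
  let ?D = "heis_dil (sqrt c)"
  have CB [measurable]: "C \<in> sets borel" using C by simp
  note C' [measurable]
  show "(\<lambda>l. prob {\<omega> \<in> space M. (\<forall>j\<le>1 * 2 ^ l. y \<odot> g (real j * (c * t / 2 ^ l)) \<omega> \<in> C) \<and> y \<odot> g (real 1 * (c * t)) \<omega> \<in> C'}) \<longlonglongrightarrow> stay C C' (c * t) y"
    using stay_grid_tendsto[of "c * t" C C' 1 y] c t C C' by simp
  have cl: "closed (?D -` C)"
    by (intro closed_vimage[OF C] continuous_intros)
  have D: "?D (heis_dil (1 / sqrt c) y) = y" using c by (simp add: heis_dil_dil)
  have eq: "prob {\<omega> \<in> space M. (\<forall>j\<le>1 * 2 ^ l. y \<odot> g (real j * (c * t / 2 ^ l)) \<omega> \<in> C) \<and> y \<odot> g (real 1 * (c * t)) \<omega> \<in> C'}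
    = prob {\<omega> \<in> space M. (\<forall>j\<le>1 * 2 ^ l. heis_dil (1 / sqrt c) y \<odot> g (real j * (t / 2 ^ l)) \<omega> \<in> ?D -` C) \<and> heis_dil (1 / sqrt c) y \<odot> g (real 1 * t) \<omega> \<in> ?D -` C'}" for l
    using stay_scaling_grid[of "t / 2 ^ l" c C C' "2 ^ l" y] c t by (simp add: heis_dil_mult D)
  have "?D -` C' \<in> sets borel" using measurable_sets[OF borel_measurable_heis_dil C'] by simp
  then show "(\<lambda>l. prob {\<omega> \<in> space M. (\<forall>j\<le>1 * 2 ^ l. y \<odot> g (real j * (c * t / 2 ^ l)) \<omega> \<in> C) \<and> y \<odot> g (real 1 * (c * t)) \<omega> \<in> C'})
     \<longlonglongrightarrow> stay (?D -` C) (?D -` C') t (heis_dil (1 / sqrt c) y)"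
    unfolding eq using stay_grid_tendsto[OF t cl, of "?D -` C'" 1 "heis_dil (1 / sqrt c) y"] by simp
qed

end

subsection \<open>Reaching a neighbourhood of any point with positive probability\<close>

abbreviation heis_cball :: "real \<Rightarrow> heis set" where
  "heis_cball r \<equiv> {c. heis_norm c \<le> r}"

text \<open>Neighbourhood for the left-invariant distance \<open>heis_norm (- k \<odot> p)\<close>.
  Written as the image of a product it is compact, hence closed, for compact
  \<open>K\<close>.\<close>

definition tube :: "heis set \<Rightarrow> real \<Rightarrow> heis set" where
  "tube K \<eta> = (\<lambda>(k, c). k \<odot> c) ` (K \<times> heis_cball \<eta>)"

lemma tube_iff: "p \<in> tube K \<eta> \<longleftrightarrow> (\<exists>k\<in>K. heis_norm (- k \<odot> p) \<le> \<eta>)"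
proof
  assume "\<exists>k\<in>K. heis_norm (- k \<odot> p) \<le> \<eta>"
  then obtain k where "k \<in> K" "heis_norm (- k \<odot> p) \<le> \<eta>" by auto
  then show "p \<in> tube K \<eta>" unfolding tube_def by (intro image_eqI[of _ _ "(k, - k \<odot> p)"]) auto
next
  assume "p \<in> tube K \<eta>"
  then obtain k c where "k \<in> K" "heis_norm c \<le> \<eta>" "p = k \<odot> c" by (auto simp: tube_def)
  then show "\<exists>k\<in>K. heis_norm (- k \<odot> p) \<le> \<eta>" by (intro bexI[of _ k]) auto
qed

lemma compact_tube: "compact K \<Longrightarrow> compact (tube K \<eta>)"
  unfolding tube_def split_beta
  by (intro compact_continuous_image compact_Times compact_heis_cball continuous_intros)

lemma closed_tube: "compact K \<Longrightarrow> closed (tube K \<eta>)"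
  by (intro compact_imp_closed compact_tube)

lemma tube_mono: "K \<subseteq> K' \<Longrightarrow> \<eta> \<le> \<eta>' \<Longrightarrow> tube K \<eta> \<subseteq> tube K' \<eta>'"
  unfolding subset_iff tube_iff using order_trans by blast

lemma tube_cball: "tube (heis_cball r) \<eta> \<subseteq> heis_cball (r + \<eta>)"
proof
  fix p assume "p \<in> tube (heis_cball r) \<eta>"
  then obtain k where "heis_norm k \<le> r" "heis_norm (- k \<odot> p) \<le> \<eta>" by (auto simp: tube_iff)
  then show "p \<in> heis_cball (r + \<eta>)" using heis_norm_triangle[of k "- k \<odot> p"] by simp
qed

lemma closed_heis_nbhd: "closed {c. heis_norm (- x \<odot> c) \<le> \<eta>}"
  by (intro closed_heis_norm_le continuous_intros)

text \<open>Makes the cost in \<open>heis_norm_mult_perturb\<close> as small as desired when the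
  later piece has norm at most \<open>r\<close>.\<close>

lemma small_conj_bound:
  assumes "0 < (\<eta>::real)" "0 \<le> r"
  shows "\<exists>\<delta>>0. \<delta> + sqrt (\<delta> * r) \<le> \<eta>"
proof -
  define \<delta> where "\<delta> = min (\<eta> / 2) ((\<eta> / 2)\<^sup>2 / (r + 1))"
  have \<delta>: "\<delta> \<le> \<eta> / 2" "\<delta> \<le> (\<eta> / 2)\<^sup>2 / (r + 1)"
    unfolding \<delta>_def by (rule min.cobounded1, rule min.cobounded2)
  have pos: "0 < \<delta>" using assms by (simp add: \<delta>_def)
  have "\<delta> * r \<le> \<delta> * (r + 1)" using pos by simp
  also have "\<dots> \<le> (\<eta> / 2)\<^sup>2" using \<delta>(2) assms by (simp add: pos_le_divide_eq)
  finally have "sqrt (\<delta> * r) \<le> \<eta> / 2" using assms by (intro real_le_lsqrt) auto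
  then show ?thesis using \<delta> pos by (intro exI[of _ \<delta>]) auto
qed

text \<open>The Markov property is available on a grid only; two rational times are multiples of one
  mesh, the inverse of the product of their denominators.\<close>

lemma rational_grid:
  assumes "s \<in> \<rat>" "t \<in> \<rat>" "0 \<le> s" "0 \<le> (t::real)"
  shows "\<exists>h>0. \<exists>m n :: nat. s = real m * h \<and> t = real n * h"
proof -
  obtain a b where ab: "b \<noteq> 0" "\<bar>s\<bar> = real a / real b" using Rats_abs_nat_div_natE[OF assms(1)] by metis
  obtain c d where cd: "d \<noteq> 0" "\<bar>t\<bar> = real c / real d" using Rats_abs_nat_div_natE[OF assms(2)] by metis
  show ?thesis
    using ab cd assms
    by (intro exI[of _ "1 / (real b * real d)"] conjI exI[of _ "a * d"] exI[of _ "c * b"]) (auto simp: field_simps)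
qed

context heis_bm
begin

lemma filt_mono:
  assumes "m \<le> m'"
  shows "sets (filt h m) \<subseteq> sets (filt h m')"
proof -
  have "past (h / 2 ^ k) (m * 2 ^ k) \<in> measurable (filt h m') (grid_space (m * 2 ^ k))" for k
    unfolding past_def [abs_def]
  proof (rule measurable_restrict)
    fix j assume "j \<in> {..m * 2 ^ k}"
    then have "j \<le> m * 2 ^ k" by simp
    also have "m * 2 ^ k \<le> m' * 2 ^ k" using assms by (rule mult_right_mono) simp
    finally have "j \<le> m' * 2 ^ k" .
    then show "g (real j * (h / 2 ^ k)) \<in> borel_measurable (filt h m')" by (rule g_filt_meas_grid)
  qed
  from measurable_sets[OF this] have "past_sets h m \<subseteq> sets (filt h m')"
    unfolding past_sets_def by auto
  then show ?thesis
    unfolding sets_filt[of h m] using sets.sigma_sets_subset[of "past_sets h m" "filt h m'"] by simp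
qed

lemma fut_event_filt:
  assumes h: "0 < h" and C: "closed C" and C': "C' \<in> sets borel"
  shows "fut_event C C' (real m * h) (real n * h) (\<lambda>_. y) \<in> sets (filt h (m + n))"
proof -
  let ?p = "\<lambda>u \<omega>. y \<odot> (- g (real m * h) \<omega> \<odot> g (real m * h + u) \<omega>)"
  have m1: "g (real m * h + real j * (h / 2 ^ l)) \<in> borel_measurable (filt h (m + n))" if "j \<le> n * 2 ^ l" for j l
  proof -
    have "g (real (m * 2 ^ l + j) * (h / 2 ^ l)) \<in> borel_measurable (filt h (m + n))"
      using that by (intro g_filt_meas_grid) (simp add: distrib_right)
    also have "real (m * 2 ^ l + j) * (h / 2 ^ l) = real m * h + real j * (h / 2 ^ l)"
      unfolding of_nat_add distrib_right by simp
    finally show ?thesis .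
  qed
  have m0 [measurable]: "g (real m * h) \<in> borel_measurable (filt h (m + n))"
    using m1[of 0 0] by simp
  have mE [measurable]: "g (real m * h + real n * h) \<in> borel_measurable (filt h (m + n))"
    using m1[of n 0] by simp
  have "{\<omega> \<in> space M. \<forall>u\<in>{0..real n * h}. ?p u \<omega> \<in> C} \<in> sets (filt h (m + n))"
  proof (rule sets_stay[OF _ C h])
    show "continuous_on {0..} (\<lambda>u. ?p u \<omega>)" if "\<omega> \<in> space M" for \<omega>
      using h that by (auto simp: heis_mult_assoc[symmetric] intro!: g_cont_shift)
    show "?p (real j * (h / 2 ^ l)) \<in> borel_measurable (filt h (m + n))" if "j \<le> n * 2 ^ l" for j l
      by (intro borel_measurable_heis_mult borel_measurable_uminus measurable_const m0 m1[OF that]) simp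
  qed simp
  moreover have "?p (real n * h) -` C' \<inter> space (filt h (m + n)) \<in> sets (filt h (m + n))"
    by (intro measurable_sets[OF _ C']) measurable
  ultimately have "{\<omega> \<in> space M. \<forall>u\<in>{0..real n * h}. ?p u \<omega> \<in> C} \<inter> (?p (real n * h) -` C' \<inter> space M) \<in> sets (filt h (m + n))"
    by auto
  also have "{\<omega> \<in> space M. \<forall>u\<in>{0..real n * h}. ?p u \<omega> \<in> C} \<inter> (?p (real n * h) -` C' \<inter> space M) = fut_event C C' (real m * h) (real n * h) (\<lambda>_. y)"
    by (auto simp: fut_event_def)
  finally show ?thesis .
qed

definition stay_event :: "heis set \<Rightarrow> heis set \<Rightarrow> real \<Rightarrow> heis \<Rightarrow> 'a set" where
  "stay_event C C' t y = {\<omega> \<in> space M. (\<forall>u\<in>{0..t}. y \<odot> g u \<omega> \<in> C) \<and> y \<odot> g t \<omega> \<in> C'}"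

lemma stay_eq: "stay C C' t y = prob (stay_event C C' t y)"
  by (simp add: stay_def stay_event_def)

lemma fut_event_0: "fut_event C C' 0 t (\<lambda>_. y) = stay_event C C' t y"
  by (auto simp: fut_event_def stay_event_def g_0)

lemma stay_event_filt:
  assumes "0 < h" "closed C" "C' \<in> sets borel"
  shows "stay_event C C' (real n * h) y \<in> sets (filt h n)"
  using fut_event_filt[OF assms, of 0 n y] by (simp add: fut_event_0)

lemma stay_event_events:
  assumes "0 \<le> t" "closed C" "C' \<in> sets borel"
  shows "stay_event C C' t y \<in> events"
proof -
  note assms(3) [measurable]
  have "{\<omega> \<in> space M. y \<odot> g t \<omega> \<in> C'} \<in> events" by measurable
  with events_stay[OF assms(2,1), of y] have "{\<omega> \<in> space M. \<forall>u\<in>{0..t}. y \<odot> g u \<omega> \<in> C} \<inter> {\<omega> \<in> space M. y \<odot> g t \<omega> \<in> C'} \<in> events" by auto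
  also have "{\<omega> \<in> space M. \<forall>u\<in>{0..t}. y \<odot> g u \<omega> \<in> C} \<inter> {\<omega> \<in> space M. y \<odot> g t \<omega> \<in> C'} = stay_event C C' t y" by (auto simp: stay_event_def)
  finally show ?thesis .
qed

lemma stay_mono:
  assumes "0 \<le> t" "closed D" "D' \<in> sets borel"
    and D: "\<And>p. y \<odot> p \<in> C \<Longrightarrow> y' \<odot> p \<in> D" and D': "\<And>p. y \<odot> p \<in> C' \<Longrightarrow> y' \<odot> p \<in> D'"
  shows "stay C C' t y \<le> stay D D' t y'"
  unfolding stay_eq
proof (rule finite_measure_mono)
  show "stay_event C C' t y \<subseteq> stay_event D D' t y'"
    unfolding stay_event_def using D D' by blast
qed (intro stay_event_events assms)

text \<open>Approach to \<open>x\<close> from \<open>0\<close> inside every neighbourhood of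
  \<open>K\<close>. The time may depend on \<open>\<eta>\<close>, since only positivity matters, and
  is rational so that two such pieces can be placed on one grid.\<close>

definition reach :: "heis \<Rightarrow> heis set \<Rightarrow> bool" where
  "reach x K \<longleftrightarrow> (\<forall>\<eta>>0. \<exists>t\<in>\<rat>. 0 < t \<and> 0 < stay (tube K \<eta>) {c. heis_norm (- x \<odot> c) \<le> \<eta>} t 0)"

lemma reach_mono:
  assumes "reach x K" "K \<subseteq> K'" "compact K'"
  shows "reach x K'"
  unfolding reach_def
proof (intro allI impI)
  fix \<eta> :: real assume "0 < \<eta>"
  then obtain t where t: "t \<in> \<rat>" "0 < t" "0 < stay (tube K \<eta>) {c. heis_norm (- x \<odot> c) \<le> \<eta>} t 0"
    using assms(1) by (auto simp: reach_def)
  have "stay (tube K \<eta>) {c. heis_norm (- x \<odot> c) \<le> \<eta>} t 0 \<le> stay (tube K' \<eta>) {c. heis_norm (- x \<odot> c) \<le> \<eta>} t 0"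
    using t assms tube_mono[OF assms(2), of \<eta> \<eta>] by (intro stay_mono closed_tube) (auto intro: borel_closed closed_heis_nbhd)
  then show "\<exists>t\<in>\<rat>. 0 < t \<and> 0 < stay (tube K' \<eta>) {c. heis_norm (- x \<odot> c) \<le> \<eta>} t 0"
    using t by (intro bexI[of _ t]) auto
qed

text \<open>Follow the route to \<open>x\<close>, then restart with the increments of a route to
  \<open>y\<close>. The first piece misses \<open>x\<close> by \<open>k\<close>, and near a point
  \<open>l\<close> of the second route this becomes a conjugate of \<open>k\<close> by
  \<open>l\<close>, bounded because \<open>L\<close> is compact.\<close>

lemma reach_mult:
  assumes K: "compact K" and L: "compact L" and x: "reach x K" and y: "reach y L"
  shows "reach (x \<odot> y) (K \<union> (\<odot>) x ` L)"
  unfolding reach_def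
proof (intro allI impI)
  fix \<eta> :: real assume \<eta>: "0 < \<eta>"
  have KL: "compact (K \<union> (\<odot>) x ` L)"
    using K L by (intro compact_Un compact_continuous_image continuous_intros)
  have "bounded (heis_norm ` insert y L)"
    using L by (intro compact_imp_bounded compact_continuous_image continuous_intros) auto
  \<comment> \<open>The point \<open>y\<close> is included because the final position is estimated
    in the same way as the points of \<open>L\<close>.\<close>
  then obtain r where r: "\<And>l. l \<in> insert y L \<Longrightarrow> heis_norm l \<le> r"
    by (force simp: bounded_iff)
  have "0 \<le> r" using order_trans[OF heis_norm_nonneg r[of y]] by simp
  then obtain \<delta> where \<delta>: "0 < \<delta>" "\<delta> + sqrt (\<delta> * r) \<le> \<eta> / 2" using small_conj_bound[of "\<eta> / 2" r] \<eta> by auto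
  have \<delta>\<eta>: "\<delta> \<le> \<eta>"
  proof -
    have "0 \<le> sqrt (\<delta> * r)" using \<delta>(1) \<open>0 \<le> r\<close> by simp
    then show ?thesis using \<delta>(2) \<eta> by linarith
  qed
  obtain s where s: "s \<in> \<rat>" "0 < s" "0 < stay (tube K \<delta>) {c. heis_norm (- x \<odot> c) \<le> \<delta>} s 0"
    using x \<delta> by (auto simp: reach_def)
  obtain t where t: "t \<in> \<rat>" "0 < t" "0 < stay (tube L (\<eta> / 2)) {c. heis_norm (- y \<odot> c) \<le> \<eta> / 2} t 0"
    using y \<eta> unfolding reach_def by (meson half_gt_zero)
  obtain h m n where h: "0 < h" "s = real m * h" "t = real n * h"
    using rational_grid[OF s(1) t(1)] s t by auto
  let ?E = "stay_event (tube K \<delta>) {c. heis_norm (- x \<odot> c) \<le> \<delta>} s 0"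
  let ?F = "fut_event (tube L (\<eta> / 2)) {c. heis_norm (- y \<odot> c) \<le> \<eta> / 2} s t (\<lambda>_. 0)"
  let ?G = "stay_event (tube (K \<union> (\<odot>) x ` L) \<eta>) {c. heis_norm (- (x \<odot> y) \<odot> c) \<le> \<eta>} (s + t) 0"
  have "0 < prob ?E * stay (tube L (\<eta> / 2)) {c. heis_norm (- y \<odot> c) \<le> \<eta> / 2} t 0"
    using s(3) t(3) by (simp add: stay_eq)
  also have "\<dots> = prob (?E \<inter> ?F)"
    unfolding h(2,3) using h(1) K L
    by (intro markov_const[symmetric] stay_event_filt closed_tube) (auto intro: borel_closed closed_heis_nbhd)
  also have "\<dots> \<le> prob ?G"
  proof (rule finite_measure_mono)
    show "?G \<in> events" using s t KL by (intro stay_event_events closed_tube) (auto intro: borel_closed closed_heis_nbhd)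
    show "?E \<inter> ?F \<subseteq> ?G"
    proof
      fix \<omega> assume \<omega>: "\<omega> \<in> ?E \<inter> ?F"
      define k where "k = - x \<odot> g s \<omega>"
      have k: "heis_norm k \<le> \<delta>" using \<omega> by (simp add: stay_event_def k_def)
      have pert: "heis_norm (- (x \<odot> l) \<odot> g (s + u) \<omega>) \<le> \<eta>"
        if "l \<in> insert y L" "heis_norm (- l \<odot> (- g s \<omega> \<odot> g (s + u) \<omega>)) \<le> \<eta> / 2" for l u
      proof -
        define c where "c = - l \<odot> (- g s \<omega> \<odot> g (s + u) \<omega>)"
        have "g (s + u) \<omega> = x \<odot> k \<odot> l \<odot> c" by (simp add: k_def c_def heis_mult_assoc)
        then have "- (x \<odot> l) \<odot> g (s + u) \<omega> = (- l \<odot> k \<odot> l) \<odot> c"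
          by (simp add: heis_uminus_mult heis_mult_assoc)
        then have "heis_norm (- (x \<odot> l) \<odot> g (s + u) \<omega>) \<le> heis_norm (- l \<odot> k \<odot> l) + heis_norm c"
          by (simp add: heis_norm_triangle)
        also have "heis_norm (- l \<odot> k \<odot> l) \<le> heis_norm (- l \<odot> l) + \<delta> + sqrt (\<delta> * r)"
          using k r[OF that(1)] by (rule heis_norm_mult_perturb)
        finally show ?thesis using that(2) \<delta>(2) by (simp add: c_def)
      qed
      have "g u \<omega> \<in> tube (K \<union> (\<odot>) x ` L) \<eta>" if u: "u \<in> {0..s + t}" for u
      proof (cases "u \<le> s")
        case True
        then have "g u \<omega> \<in> tube K \<delta>" using \<omega> u by (auto simp: stay_event_def)
        then show ?thesis using tube_mono[of K "K \<union> (\<odot>) x ` L" \<delta> \<eta>] \<delta>\<eta> by auto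
      next
        case False
        then have "u - s \<in> {0..t}" using u by auto
        moreover have "\<forall>v\<in>{0..t}. - g s \<omega> \<odot> g (s + v) \<omega> \<in> tube L (\<eta> / 2)" using \<omega> by (simp add: fut_event_def)
        ultimately have "- g s \<omega> \<odot> g (s + (u - s)) \<omega> \<in> tube L (\<eta> / 2)" by blast
        then obtain l where "l \<in> L" "heis_norm (- l \<odot> (- g s \<omega> \<odot> g (s + (u - s)) \<omega>)) \<le> \<eta> / 2" by (auto simp: tube_iff)
        then show ?thesis using pert[of l "u - s"] by (auto simp: tube_iff)
      qed
      moreover have "heis_norm (- (x \<odot> y) \<odot> g (s + t) \<omega>) \<le> \<eta>"
        using \<omega> by (intro pert) (auto simp: fut_event_def)
      ultimately show "\<omega> \<in> ?G" using \<omega> by (auto simp: stay_event_def)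
    qed
  qed
  finally show "\<exists>t\<in>\<rat>. 0 < t \<and> 0 < stay (tube (K \<union> (\<odot>) x ` L) \<eta>) {c. heis_norm (- (x \<odot> y) \<odot> c) \<le> \<eta>} t 0"
    using s t by (intro bexI[of _ "s + t"]) (auto simp: stay_eq)
qed

text \<open>Continuous paths are bounded on the unit interval, so the events with increasing radii
  cover an event of positive probability; they cannot all be null.\<close>

lemma stay_unit_pos:
  assumes "0 < \<delta>"
  shows "\<exists>R>0. 0 < stay (heis_cball R) {c. norm (fst c - w) \<le> \<delta>} 1 0"
proof (rule ccontr)
  assume "\<not> ?thesis"
  then have z: "prob (stay_event (heis_cball (real (Suc k))) {c. norm (fst c - w) \<le> \<delta>} 1 0) = 0" for k
    by (metis measure_nonneg of_nat_0_less_iff order_le_less stay_eq zero_less_Suc)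
  have cl: "closed {c :: heis. norm (fst c - w) \<le> \<delta>}" by (intro closed_Collect_le continuous_intros)
  have ev: "stay_event (heis_cball (real (Suc k))) {c. norm (fst c - w) \<le> \<delta>} 1 0 \<in> events" for k
    using cl by (intro stay_event_events) (auto intro: borel_closed closed_heis_norm_le)
  have "(\<Union>k. stay_event (heis_cball (real (Suc k))) {c. norm (fst c - w) \<le> \<delta>} 1 0) \<in> null_sets M"
    using z ev by (intro null_sets_UN) (auto simp: null_sets_def emeasure_eq_measure)
  moreover have "{\<omega> \<in> space M. norm (fst (g 1 \<omega>) - w) < \<delta>} \<subseteq> (\<Union>k. stay_event (heis_cball (real (Suc k))) {c. norm (fst c - w) \<le> \<delta>} 1 0)"
  proof
    fix \<omega> assume \<omega>: "\<omega> \<in> {\<omega> \<in> space M. norm (fst (g 1 \<omega>) - w) < \<delta>}"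
    have "compact ((\<lambda>u. heis_norm (g u \<omega>)) ` {0..1})"
      using \<omega> by (intro compact_continuous_image continuous_intros continuous_on_subset[OF g_cont]) auto
    then have "bounded ((\<lambda>u. heis_norm (g u \<omega>)) ` {0..1})" by (rule compact_imp_bounded)
    then obtain B where B: "\<And>u. u \<in> {0..1} \<Longrightarrow> heis_norm (g u \<omega>) \<le> B" by (force simp: bounded_iff)
    obtain k where "B \<le> real k" using real_arch_simple by blast
    then have "\<omega> \<in> stay_event (heis_cball (real (Suc k))) {c. norm (fst c - w) \<le> \<delta>} 1 0"
      using B \<omega> by (force simp: stay_event_def)
    then show "\<omega> \<in> (\<Union>k. stay_event (heis_cball (real (Suc k))) {c. norm (fst c - w) \<le> \<delta>} 1 0)" by auto
  qed
  moreover have "{\<omega> \<in> space M. norm (fst (g 1 \<omega>) - w) < \<delta>} \<in> events" by measurable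
  ultimately have "{\<omega> \<in> space M. norm (fst (g 1 \<omega>) - w) < \<delta>} \<in> null_sets M"
    using null_sets_subset by blast
  then show False using g_support[OF assms, of w] by (simp add: measure_eq_0_null_sets)
qed

lemma prob_blocks:
  assumes h: "0 < h" and C: "closed C" and C': "C' \<in> sets borel"
  shows "(\<Inter>i\<in>{..<j}. fut_event C C' (real i * h) h (\<lambda>_. 0)) \<inter> space M \<in> sets (filt h j) \<and>
    prob ((\<Inter>i\<in>{..<j}. fut_event C C' (real i * h) h (\<lambda>_. 0)) \<inter> space M) = stay C C' h 0 ^ j"
proof (induction j)
  case 0
  have "space M \<in> sets (filt h 0)" using sets.top[of "filt h 0"] by simp
  then show ?case by (simp add: prob_space)
next
  case (Suc j)
  let ?E = "(\<Inter>i\<in>{..<j}. fut_event C C' (real i * h) h (\<lambda>_. 0)) \<inter> space M" and ?F = "fut_event C C' (real j * h) h (\<lambda>_. 0)"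
  have eq: "(\<Inter>i\<in>{..<Suc j}. fut_event C C' (real i * h) h (\<lambda>_. 0)) \<inter> space M = ?E \<inter> ?F"
    by (auto simp: lessThan_Suc)
  have "?E \<in> sets (filt h (Suc j))" using Suc.IH filt_mono[of j "Suc j" h] by auto
  moreover have "?F \<in> sets (filt h (Suc j))" using fut_event_filt[OF h C C', of j 1 0] by simp
  moreover have "prob (?E \<inter> ?F) = prob ?E * stay C C' h 0"
    using markov_const[OF h _ C C', of ?E j 1 0] Suc.IH by simp
  ultimately show ?case unfolding eq using Suc.IH by auto
qed

end

text \<open>Each block moves by \<open>(w + f) / n\<close> with \<open>|f| \<le> \<delta>\<close>
  and adds at most \<open>(R / n)^2\<close> of its own area, in total \<open>R^2 / n\<close>. The
  parallel parts have vanishing form, so the area between blocks is only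
  \<open>O(|w| \<delta> + \<delta>^2)\<close>.\<close>

lemma horizontal_blocks_bound:
  fixes \<gamma> :: "nat \<Rightarrow> heis" and n :: nat
  assumes \<gamma>0: "\<gamma> 0 = 0" and n: "0 < n" and \<delta>: "0 \<le> \<delta>" and R: "0 \<le> R"
    and c1: "\<And>i. i < n \<Longrightarrow> heis_norm (- \<gamma> i \<odot> \<gamma> (Suc i)) \<le> R / real n"
    and c2: "\<And>i. i < n \<Longrightarrow> norm (real n *\<^sub>R fst (- \<gamma> i \<odot> \<gamma> (Suc i)) - w) \<le> \<delta>"
  shows "j \<le> n \<Longrightarrow> norm (fst (\<gamma> j) - (real j / real n) *\<^sub>R w) \<le> real j / real n * \<delta> \<and>
    \<bar>snd (\<gamma> j)\<bar> \<le> real j / real n * (R\<^sup>2 / real n + norm w * \<delta> + \<delta>\<^sup>2)"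
proof (induction j)
  case 0
  then show ?case by (simp add: \<gamma>0)
next
  case (Suc j)
  then have j: "j < n" by simp
  define c where "c = - \<gamma> j \<odot> \<gamma> (Suc j)"
  define e where "e = fst (\<gamma> j) - (real j / real n) *\<^sub>R w"
  define f where "f = real n *\<^sub>R fst c - w"
  have \<gamma>: "\<gamma> (Suc j) = \<gamma> j \<odot> c" by (simp add: c_def)
  have jn: "real j / real n \<le> 1" using j by simp
  have e: "norm e \<le> real j / real n * \<delta>" using Suc j by (simp add: e_def)
  then have e1: "norm e \<le> \<delta>" using mult_right_mono[OF jn \<delta>] by simp
  have f: "norm f \<le> \<delta>" using c2[OF j] by (simp add: f_def c_def)
  have fc: "fst c = (1 / real n) *\<^sub>R (w + f)" using n by (simp add: f_def)
  have fg: "fst (\<gamma> j) = (real j / real n) *\<^sub>R w + e" by (simp add: e_def)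
  have Sj: "real (Suc j) / real n = real j / real n + 1 / real n" by (simp add: add_divide_distrib)
  have "fst (\<gamma> (Suc j)) - (real (Suc j) / real n) *\<^sub>R w = e + (1 / real n) *\<^sub>R f"
    unfolding \<gamma> fst_heis_mult fc fg Sj by (simp add: algebra_simps)
  then have "norm (fst (\<gamma> (Suc j)) - (real (Suc j) / real n) *\<^sub>R w) \<le> norm e + norm ((1 / real n) *\<^sub>R f)"
    by (simp only: norm_triangle_ineq)
  also have "norm ((1 / real n) *\<^sub>R f) \<le> 1 / real n * \<delta>"
    using f n by (simp add: divide_right_mono)
  finally have 1: "norm (fst (\<gamma> (Suc j)) - (real (Suc j) / real n) *\<^sub>R w) \<le> real (Suc j) / real n * \<delta>"
    using e unfolding Sj distrib_right by linarith
  \<comment> \<open>The term with both arguments along \<open>w\<close> has dropped out.\<close>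
  have om: "omega2 (fst (\<gamma> j)) (fst c) = (1 / real n) * ((real j / real n) * omega2 w f + omega2 e w + omega2 e f)"
    unfolding fc fg by (simp add: omega2_linear algebra_simps add_divide_distrib)
  have "\<bar>(real j / real n) * omega2 w f + omega2 e w + omega2 e f\<bar> \<le> norm w * \<delta> + norm w * \<delta> + \<delta>\<^sup>2"
  proof -
    have "\<bar>(real j / real n) * omega2 w f\<bar> \<le> 1 * (norm w * norm f)"
      unfolding abs_mult using jn n by (intro mult_mono abs_omega2_le) auto
    moreover have "norm w * norm f \<le> norm w * \<delta>" using f by (intro mult_left_mono) auto
    moreover have "\<bar>omega2 e w\<bar> \<le> norm w * \<delta>"
      using abs_omega2_le[of e w] mult_right_mono[OF e1, of "norm w"] by (simp add: mult.commute)
    moreover have "\<bar>omega2 e f\<bar> \<le> \<delta> * \<delta>"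
      using abs_omega2_le[of e f] mult_mono[OF e1 f \<delta>] by simp
    moreover have "\<bar>p + q + r\<bar> \<le> P + Q + S" if "\<bar>p\<bar> \<le> 1 * P'" "P' \<le> P" "\<bar>q\<bar> \<le> Q" "\<bar>r\<bar> \<le> S" for p q r P P' Q S :: real
      using that by linarith
    ultimately show ?thesis unfolding power2_eq_square by blast
  qed
  then have "\<bar>omega2 (fst (\<gamma> j)) (fst c)\<bar> \<le> (1 / real n) * (norm w * \<delta> + norm w * \<delta> + \<delta>\<^sup>2)"
    unfolding om abs_mult using n by (simp add: divide_right_mono)
  then have "\<bar>omega2 (fst (\<gamma> j)) (fst c) / 2\<bar> \<le> (1 / real n) * (norm w * \<delta> + norm w * \<delta> + \<delta>\<^sup>2) / 2"
    by (simp only: abs_divide abs_numeral) (rule divide_right_mono, assumption, simp)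
  also have "\<dots> \<le> (1 / real n) * (norm w * \<delta> + \<delta>\<^sup>2)"
    using n by (simp add: field_simps)
  finally have 2: "\<bar>omega2 (fst (\<gamma> j)) (fst c) / 2\<bar> \<le> (1 / real n) * (norm w * \<delta> + \<delta>\<^sup>2)" .
  have "\<bar>snd c\<bar> \<le> (heis_norm c)\<^sup>2" by (rule abs_snd_le_heis_norm)
  also have "\<dots> \<le> (R / real n)\<^sup>2" using c1[OF j] by (intro power_mono) (auto simp: c_def)
  also have "\<dots> = (1 / real n) * (R\<^sup>2 / real n)" by (simp add: power2_eq_square)
  finally have 3: "\<bar>snd c\<bar> \<le> (1 / real n) * (R\<^sup>2 / real n)" .
  let ?B = "R\<^sup>2 / real n + norm w * \<delta> + \<delta>\<^sup>2"
  have "\<bar>snd (\<gamma> (Suc j))\<bar> \<le> \<bar>snd (\<gamma> j)\<bar> + \<bar>snd c\<bar> + \<bar>omega2 (fst (\<gamma> j)) (fst c) / 2\<bar>"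
    unfolding \<gamma> snd_heis_mult by linarith
  also have "\<dots> \<le> real j / real n * ?B + (1 / real n) * (R\<^sup>2 / real n) + (1 / real n) * (norm w * \<delta> + \<delta>\<^sup>2)"
    using 2 3 Suc j by (intro add_mono) auto
  also have "\<dots> = real (Suc j) / real n * ?B"
    unfolding Sj by (simp add: algebra_simps)
  finally show ?case using 1 by simp
qed

definition horizontal_segment :: "real \<times> real \<Rightarrow> heis set" where
  "horizontal_segment w = (\<lambda>\<tau>. (\<tau> *\<^sub>R w, 0)) ` {0..1}"

lemma compact_horizontal_segment: "compact (horizontal_segment w)"
  unfolding horizontal_segment_def by (intro compact_continuous_image continuous_intros) auto

context heis_bm
begin

text \<open>Cut the time \<open>1/n\<close> into \<open>n\<close> blocks of length \<open>1/n\<^sup>2\<close> and ask in each of them for a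
  horizontal displacement close to \<open>w/n\<close>. The area gathered inside the blocks is \<open>O(1/n)\<close> in total.\<close>

lemma reach_horizontal: "reach (w, 0) (horizontal_segment w)"
  unfolding reach_def
proof (intro allI impI)
  fix \<eta> :: real assume \<eta>: "0 < \<eta>"
  define a where "a = norm w"
  have a: "0 \<le> a" by (simp add: a_def)
  \<comment> \<open>Error budget at the nodes: \<open>\<eta> / 4\<close> horizontally, and centrally
    \<open>\<eta>^2 / 32\<close> from \<open>\<delta>\<close> plus \<open>\<eta>^2 / 32\<close> from
    \<open>R^2 / n\<close>, whose sum has square root \<open>\<eta> / 4\<close>. The motion inside a
    block adds another \<open>\<eta> / 4\<close>.\<close>
  define \<delta> where "\<delta> = min (\<eta> / 4) (min 1 (\<eta>\<^sup>2 / (32 * (2 * a + 1))))"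
  have \<delta>: "0 < \<delta>" using \<eta> a by (simp add: \<delta>_def)
  have \<delta>4: "\<delta> \<le> \<eta> / 4" unfolding \<delta>_def by (rule min.cobounded1)
  have \<delta>1: "\<delta> \<le> 1" unfolding \<delta>_def by (intro min.coboundedI2 min.cobounded1)
  have \<delta>2: "\<delta> \<le> \<eta>\<^sup>2 / (32 * (2 * a + 1))" unfolding \<delta>_def by (intro min.coboundedI2 min.cobounded2)
  have \<delta>3: "2 * a * \<delta> + \<delta>\<^sup>2 \<le> \<eta>\<^sup>2 / 32"
  proof -
    have "\<delta>\<^sup>2 \<le> \<delta>" using \<delta> \<delta>1 by (simp add: power2_eq_square mult_left_le)
    then have "2 * a * \<delta> + \<delta>\<^sup>2 \<le> \<delta> * (2 * a + 1)" by (simp add: algebra_simps)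
    also have "\<dots> \<le> \<eta>\<^sup>2 / 32" using \<delta>2 a by (simp add: field_simps)
    finally show ?thesis .
  qed
  \<comment> \<open>\<open>R\<close> depends on \<open>\<delta>\<close> and may be large;
    \<open>n\<close> is chosen afterwards and makes it harmless.\<close>
  obtain R where R: "0 < R" and pos: "0 < stay (heis_cball R) {c. norm (fst c - w) \<le> \<delta>} 1 0"
    using stay_unit_pos[OF \<delta>] by blast
  obtain n :: nat where "max 1 (max (32 * R\<^sup>2 / \<eta>\<^sup>2) (4 * R / \<eta>)) \<le> real n" using real_arch_simple by blast
  then have n: "0 < n" "32 * R\<^sup>2 / \<eta>\<^sup>2 \<le> real n" "4 * R / \<eta> \<le> real n" by auto
  have n2: "R\<^sup>2 / real n \<le> \<eta>\<^sup>2 / 32" "R / real n \<le> \<eta> / 4"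
    using n \<eta> by (auto simp: field_simps)
  define h where "h = 1 / (real n)\<^sup>2"
  have h: "0 < h" using n by (simp add: h_def)
  have nh: "real n * h = 1 / real n" using n by (simp add: h_def power2_eq_square)
  define C where "C = heis_cball (R / real n)"
  define C' where "C' = {c :: heis. norm (real n *\<^sub>R fst c - w) \<le> \<delta>}"
  have C: "closed C" unfolding C_def by (intro closed_heis_norm_le continuous_intros)
  have C'cl: "closed C'" unfolding C'_def by (intro closed_Collect_le continuous_intros)
  then have C': "C' \<in> sets borel" by simp
  \<comment> \<open>Dilation by \<open>n\<close> turns the event of a block into the unit-time
    event, so its probability does not depend on \<open>n\<close>.\<close>
  have "sqrt h = 1 / real n" using n by (simp add: h_def real_sqrt_divide)
  then have "heis_dil (sqrt h) -` C = heis_cball R" "heis_dil (sqrt h) -` C' = {c. norm (fst c - w) \<le> \<delta>}"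
    using n by (auto simp: C_def C'_def divide_le_cancel)
  then have "stay C C' h 0 = stay (heis_cball R) {c. norm (fst c - w) \<le> \<delta>} 1 0"
    using stay_scaling[OF h, of 1 C C' 0] C C' by simp
  then have posn: "0 < stay C C' h 0 ^ n" using pos by simp
  let ?E = "(\<Inter>i\<in>{..<n}. fut_event C C' (real i * h) h (\<lambda>_. 0)) \<inter> space M"
  let ?G = "stay_event (tube (horizontal_segment w) \<eta>) {c. heis_norm (- (w, 0) \<odot> c) \<le> \<eta>} (1 / real n) 0"
  have "stay C C' h 0 ^ n = prob ?E" using prob_blocks[OF h C C', of n] by simp
  also have "\<dots> \<le> prob ?G"
  proof (rule finite_measure_mono)
    show "?G \<in> events"
      by (intro stay_event_events closed_tube compact_horizontal_segment borel_closed closed_heis_nbhd) simp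
    show "?E \<subseteq> ?G"
    proof
      fix \<omega> assume \<omega>: "\<omega> \<in> ?E"
      then have sp: "\<omega> \<in> space M" by simp
      define \<gamma> where "\<gamma> i = g (real i * h) \<omega>" for i
      have blk: "heis_norm (- \<gamma> i \<odot> g (real i * h + u) \<omega>) \<le> R / real n" if "i < n" "u \<in> {0..h}" for i u
      proof -
        have "\<omega> \<in> fut_event C C' (real i * h) h (\<lambda>_. 0)" using \<omega> that by auto
        then show ?thesis using that(2) by (simp add: fut_event_def C_def \<gamma>_def)
      qed
      have Suc: "\<gamma> (Suc i) = g (real i * h + h) \<omega>" for i by (simp add: \<gamma>_def distrib_right add.commute)
      have blk': "norm (real n *\<^sub>R fst (- \<gamma> i \<odot> \<gamma> (Suc i)) - w) \<le> \<delta>" if "i < n" for i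
      proof -
        have "\<omega> \<in> fut_event C C' (real i * h) h (\<lambda>_. 0)" using \<omega> that by auto
        then have "0 \<odot> (- \<gamma> i \<odot> \<gamma> (Suc i)) \<in> C'" unfolding Suc by (simp add: fut_event_def \<gamma>_def)
        then show ?thesis by (simp add: C'_def)
      qed
      have bound: "norm (fst (\<gamma> j) - (real j / real n) *\<^sub>R w) \<le> real j / real n * \<delta> \<and>
          \<bar>snd (\<gamma> j)\<bar> \<le> real j / real n * (R\<^sup>2 / real n + norm w * \<delta> + \<delta>\<^sup>2)" if "j \<le> n" for j
        using that
      proof (rule horizontal_blocks_bound[rotated -1])
        show "\<gamma> 0 = 0" using sp by (simp add: \<gamma>_def g_0)
        show "heis_norm (- \<gamma> i \<odot> \<gamma> (Suc i)) \<le> R / real n" if "i < n" for i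
          using blk[OF that, of h] h by (simp add: Suc)
      qed (use n \<delta> R blk' in auto)
      have node: "heis_norm (- ((real j / real n) *\<^sub>R w, 0) \<odot> \<gamma> j) \<le> \<eta> / 2" if "j \<le> n" for j
      proof -
        let ?q = "real j / real n"
        define e where "e = fst (\<gamma> j) - ?q *\<^sub>R w"
        have q: "0 \<le> ?q" "?q \<le> 1" using that n by auto
        have "?q * \<delta> \<le> \<delta>" using mult_right_mono[OF q(2), of \<delta>] \<delta> by simp
        then have e: "norm e \<le> \<delta>" using bound[OF that] by (simp add: e_def)
        have "?q * (R\<^sup>2 / real n + a * \<delta> + \<delta>\<^sup>2) \<le> R\<^sup>2 / real n + a * \<delta> + \<delta>\<^sup>2"
          using q a \<delta> by (intro mult_left_le_one_le) auto
        then have z: "\<bar>snd (\<gamma> j)\<bar> \<le> R\<^sup>2 / real n + a * \<delta> + \<delta>\<^sup>2" using bound[OF that] by (simp add: a_def)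
        have f1: "fst (- (?q *\<^sub>R w, 0) \<odot> \<gamma> j) = e" by (simp add: e_def)
        have s1: "snd (- (?q *\<^sub>R w, 0) \<odot> \<gamma> j) = snd (\<gamma> j) - ?q * omega2 w e / 2"
          by (simp add: e_def omega2_linear)
        have "\<bar>?q * omega2 w e\<bar> \<le> 1 * (a * \<delta>)"
          unfolding abs_mult using q e abs_omega2_le[of w e] mult_left_mono[OF e, of a] a
          by (intro mult_mono) (auto simp: a_def)
        then have "\<bar>snd (- (?q *\<^sub>R w, 0) \<odot> \<gamma> j)\<bar> \<le> R\<^sup>2 / real n + (2 * a * \<delta> + \<delta>\<^sup>2)"
        proof -
          have "\<bar>s - y / 2\<bar> \<le> B + B'" if "\<bar>s\<bar> \<le> B" "\<bar>y\<bar> \<le> 1 * B'" for s y B B' :: real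
            using that by linarith
          from this[OF z \<open>\<bar>?q * omega2 w e\<bar> \<le> 1 * (a * \<delta>)\<close>] show ?thesis
            unfolding s1 by (simp only: algebra_simps mult_2)
        qed
        also have "\<dots> \<le> \<eta>\<^sup>2 / 32 + \<eta>\<^sup>2 / 32" by (rule add_mono[OF n2(1) \<delta>3])
        also have "\<dots> = (\<eta> / 4)\<^sup>2" by (simp add: power_divide)
        finally have "sqrt \<bar>snd (- (?q *\<^sub>R w, 0) \<odot> \<gamma> j)\<bar> \<le> \<eta> / 4" using \<eta> by (intro real_le_lsqrt) auto
        then show ?thesis
          using heis_norm_le[of "- (?q *\<^sub>R w, 0) \<odot> \<gamma> j"] e \<delta>4 unfolding f1 by linarith
      qed
      have tube: "g u \<omega> \<in> tube (horizontal_segment w) \<eta>" if u: "u \<in> {0..1 / real n}" for u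
      proof -
        \<comment> \<open>The minimum treats the final time, where the quotient is \<open>n\<close>
          and the last block must be taken.\<close>
        define j where "j = min (n - 1) (nat \<lfloor>u / h\<rfloor>)"
        have jn: "j < n" using n by (auto simp: j_def)
        have uh: "0 \<le> u / h" "u / h \<le> real n" using u h nh by (auto simp: field_simps)
        have "real j \<le> u / h" unfolding j_def using uh by linarith
        moreover have "u / h \<le> real j + 1" unfolding j_def using uh n by linarith
        ultimately have "u - real j * h \<in> {0..h}" using h by (auto simp: field_simps)
        from blk[OF jn this] have "heis_norm (- \<gamma> j \<odot> g u \<omega>) \<le> R / real n" by simp
        also note n2(2)
        finally have "heis_norm (- \<gamma> j \<odot> g u \<omega>) \<le> \<eta> / 4" .
        moreover have "- ((real j / real n) *\<^sub>R w, 0) \<odot> g u \<omega> = (- ((real j / real n) *\<^sub>R w, 0) \<odot> \<gamma> j) \<odot> (- \<gamma> j \<odot> g u \<omega>)"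
          by (simp add: heis_mult_assoc)
        ultimately have "heis_norm (- ((real j / real n) *\<^sub>R w, 0) \<odot> g u \<omega>) \<le> \<eta>"
          using heis_norm_triangle[of "- ((real j / real n) *\<^sub>R w, 0) \<odot> \<gamma> j" "- \<gamma> j \<odot> g u \<omega>"] node[of j] jn \<eta> by simp
        moreover have "((real j / real n) *\<^sub>R w, 0) \<in> horizontal_segment w"
          unfolding horizontal_segment_def using jn by (intro image_eqI[of _ _ "real j / real n"]) auto
        ultimately show ?thesis unfolding tube_iff by blast
      qed
      have "heis_norm (- (w, 0) \<odot> g (1 / real n) \<omega>) \<le> \<eta>"
        using node[of n] n \<eta> by (simp add: \<gamma>_def nh)
      then show "\<omega> \<in> ?G" using tube sp by (simp add: stay_event_def)
    qed
  qed
  finally show "\<exists>t\<in>\<rat>. 0 < t \<and> 0 < stay (tube (horizontal_segment w) \<eta>) {c. heis_norm (- (w, 0) \<odot> c) \<le> \<eta>} t 0"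
    using posn n by (intro bexI[of _ "1 / real n"]) (auto simp: stay_eq)
qed

lemma reach_horizontal_cball: "norm w \<le> r \<Longrightarrow> reach (w, 0) (heis_cball r)"
proof (rule reach_mono[OF reach_horizontal])
  assume r: "norm w \<le> r"
  have "heis_norm (\<tau> *\<^sub>R w, 0) \<le> r" if "\<tau> \<in> {0..1}" for \<tau>
    using that r mult_left_le_one_le[of "norm w" \<tau>] by simp
  then show "horizontal_segment w \<subseteq> heis_cball r" by (auto simp: horizontal_segment_def)
qed (rule compact_heis_cball)

lemma reach_mult_cball:
  assumes x: "reach x (heis_cball r)" and y: "reach y (heis_cball r')" and "r \<le> s" "heis_norm x + r' \<le> s"
  shows "reach (x \<odot> y) (heis_cball s)"
proof (rule reach_mono[OF reach_mult[OF compact_heis_cball compact_heis_cball x y] _ compact_heis_cball])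
  have "heis_norm (x \<odot> l) \<le> s" if "heis_norm l \<le> r'" for l
    using heis_norm_triangle[of x l] that assms by linarith
  then show "heis_cball r \<union> (\<odot>) x ` heis_cball r' \<subseteq> heis_cball s"
    using assms(3) by auto
qed

text \<open>Four horizontal sides of a square of side \<open>s\<close> close up in the plane and
  leave the enclosed area \<open>s^2\<close> in the centre; the orientation gives the sign.\<close>

lemma reach_loop:
  assumes s: "0 \<le> s" and \<sigma>: "\<sigma> = 1 \<or> \<sigma> = -1"
  shows "reach (0, \<sigma> * s\<^sup>2) (heis_cball (4 * s))"
proof -
  have step: "reach (w, 0) (heis_cball s)" if "norm w = s" for w
    using that by (intro reach_horizontal_cball) simp
  have 4: "reach ((w1, 0) \<odot> (w2, 0) \<odot> (w3, 0) \<odot> (w4, 0)) (heis_cball (4 * s))"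
    if w: "norm w1 = s" "norm w2 = s" "norm w3 = s" "norm w4 = s" for w1 w2 w3 w4
  proof -
    have n2: "heis_norm ((w1, 0) \<odot> (w2, 0)) \<le> 2 * s"
      using heis_norm_triangle[of "(w1, 0)" "(w2, 0)"] w by simp
    then have n3: "heis_norm ((w1, 0) \<odot> (w2, 0) \<odot> (w3, 0)) \<le> 3 * s"
      using heis_norm_triangle[of "(w1, 0) \<odot> (w2, 0)" "(w3, 0)"] w by simp
    have r2: "reach ((w1, 0) \<odot> (w2, 0)) (heis_cball (2 * s))"
      by (rule reach_mult_cball[OF step[OF w(1)] step[OF w(2)]]) (use w s in auto)
    have r3: "reach ((w1, 0) \<odot> (w2, 0) \<odot> (w3, 0)) (heis_cball (3 * s))"
      by (rule reach_mult_cball[OF r2 step[OF w(3)]]) (use s n2 in auto)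
    show ?thesis
      by (rule reach_mult_cball[OF r3 step[OF w(4)]]) (use s n3 in auto)
  qed
  have n: "norm (s, 0::real) = s" "norm (0::real, s) = s" "norm (- s, 0::real) = s" "norm (0::real, - s) = s"
    using s by auto
  have "(0, s\<^sup>2) = ((s, 0), 0) \<odot> ((0, s), 0) \<odot> ((- s, 0), 0) \<odot> ((0, - s), 0)"
    "(0, - s\<^sup>2) = ((0, s), 0) \<odot> ((s, 0), 0) \<odot> ((0, - s), 0) \<odot> ((- s, 0), 0)"
    by (simp_all add: heis_mult_def omega2_def power2_eq_square zero_prod_def)
  then show ?thesis using \<sigma> 4[OF n] 4[OF n(2,1,4,3)] by auto
qed

text \<open>The excursion bound for one loop is four times the norm of its target, too large for the
  ball required later. Climbing in many small loops exceeds the norm reached by at most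
  \<open>4 * s\<close>.\<close>

lemma reach_loops:
  assumes s: "0 \<le> s" and \<sigma>: "\<sigma> = 1 \<or> \<sigma> = -1"
  shows "reach (0, \<sigma> * (real (Suc n) * s\<^sup>2)) (heis_cball (sqrt (real (Suc n)) * s + 4 * s))"
proof (induction n)
  case 0
  have "heis_cball (4 * s) \<subseteq> heis_cball (sqrt (real (Suc 0)) * s + 4 * s)" using s by auto
  from reach_mono[OF reach_loop[OF s \<sigma>] this compact_heis_cball] show ?case by simp
next
  case (Suc n)
  let ?x = "(0, \<sigma> * (real (Suc n) * s\<^sup>2)) :: heis"
  have nx: "heis_norm ?x = sqrt (real (Suc n)) * s"
    using \<sigma> s by (auto simp: abs_mult real_sqrt_mult)
  have le: "sqrt (real (Suc n)) * s \<le> sqrt (real (Suc (Suc n))) * s" using s by (intro mult_right_mono) auto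
  have "reach (?x \<odot> (0, \<sigma> * s\<^sup>2)) (heis_cball (sqrt (real (Suc (Suc n))) * s + 4 * s))"
    using le nx by (intro reach_mult_cball[OF Suc.IH reach_loop[OF s \<sigma>]]) auto
  moreover have "?x \<odot> (0, \<sigma> * s\<^sup>2) = (0, \<sigma> * (real (Suc (Suc n)) * s\<^sup>2))"
    by (intro prod_eqI) (auto simp: algebra_simps)
  ultimately show ?case by simp
qed

lemma reach_vertical:
  assumes z: "z \<noteq> 0" and \<epsilon>: "0 < \<epsilon>"
  shows "reach (0, z) (heis_cball (sqrt \<bar>z\<bar> + \<epsilon>))"
proof -
  obtain n :: nat where n: "16 * \<bar>z\<bar> / \<epsilon>\<^sup>2 \<le> real n" using real_arch_simple by blast
  then have n': "16 * \<bar>z\<bar> / \<epsilon>\<^sup>2 \<le> real (Suc n)" by simp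
  define s where "s = sqrt (\<bar>z\<bar> / real (Suc n))"
  have s: "0 \<le> s" by (simp add: s_def)
  have s2: "real (Suc n) * s\<^sup>2 = \<bar>z\<bar>" by (simp add: s_def del: of_nat_Suc)
  have s3: "sqrt (real (Suc n)) * s = sqrt \<bar>z\<bar>" by (simp add: s_def real_sqrt_mult[symmetric] del: of_nat_Suc)
  have "\<bar>z\<bar> / real (Suc n) \<le> (\<epsilon> / 4)\<^sup>2" using n' \<epsilon> by (simp add: field_simps power2_eq_square del: of_nat_Suc)
  then have "s \<le> \<epsilon> / 4" unfolding s_def using \<epsilon> by (intro real_le_lsqrt) auto
  then have "heis_cball (sqrt (real (Suc n)) * s + 4 * s) \<subseteq> heis_cball (sqrt \<bar>z\<bar> + \<epsilon>)" unfolding s3 by auto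
  moreover have "reach (0, sgn z * (real (Suc n) * s\<^sup>2)) (heis_cball (sqrt (real (Suc n)) * s + 4 * s))"
    using s z by (intro reach_loops) (auto simp: sgn_if)
  ultimately have "reach (0, sgn z * \<bar>z\<bar>) (heis_cball (sqrt \<bar>z\<bar> + \<epsilon>))"
    unfolding s2 by (intro reach_mono[OF _ _ compact_heis_cball])
  then show ?thesis by (simp add: sgn_mult_abs)
qed

text \<open>The route climbs the centre to \<open>(0, z)\<close> and then moves along the horizontal
  segment. There the fourth power of the norm is at most \<open>|w|^4 + z^2\<close>, so only the
  vertical part needs the extra \<open>\<epsilon>\<close>.\<close>

lemma reach_cball:
  assumes \<epsilon>: "0 < \<epsilon>"
  shows "reach x (heis_cball (heis_norm x + \<epsilon>))"
proof (cases "snd x = 0")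
  case True
  then have "x = (fst x, 0)" by (simp add: prod_eq_iff)
  moreover have "norm (fst x) \<le> heis_norm x + \<epsilon>" using norm_fst_le_heis_norm[of x] \<epsilon> by simp
  ultimately show ?thesis using reach_horizontal_cball by metis
next
  case False
  let ?z = "(0, snd x) :: heis" and ?w = "fst x"
  have "reach (?z \<odot> (?w, 0)) (heis_cball (sqrt \<bar>snd x\<bar> + \<epsilon>) \<union> (\<odot>) ?z ` horizontal_segment ?w)"
    by (intro reach_mult compact_heis_cball compact_horizontal_segment reach_vertical False \<epsilon> reach_horizontal)
  moreover have "?z \<odot> (?w, 0) = x" by (intro prod_eqI) auto
  moreover have "heis_cball (sqrt \<bar>snd x\<bar> + \<epsilon>) \<union> (\<odot>) ?z ` horizontal_segment ?w \<subseteq> heis_cball (heis_norm x + \<epsilon>)"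
  proof -
    have "\<bar>snd x\<bar> \<le> (heis_norm x)\<^sup>2" by (rule abs_snd_le_heis_norm)
    then have 1: "sqrt \<bar>snd x\<bar> \<le> heis_norm x" by (intro real_le_lsqrt) auto
    have 2: "heis_norm (?z \<odot> (\<tau> *\<^sub>R ?w, 0)) \<le> heis_norm x" if "\<tau> \<in> {0..1}" for \<tau>
    proof (rule power_le_imp_le_base[of _ 3])
      have "(norm (\<tau> *\<^sub>R ?w)) ^ 4 \<le> norm ?w ^ 4"
        using that mult_left_le_one_le[of "norm ?w" \<tau>] by (intro power_mono) auto
      then show "heis_norm (?z \<odot> (\<tau> *\<^sub>R ?w, 0)) ^ Suc 3 \<le> heis_norm x ^ Suc 3"
        by (simp add: heis_norm_pow4)
    qed simp
    show ?thesis
    proof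
      fix p assume "p \<in> heis_cball (sqrt \<bar>snd x\<bar> + \<epsilon>) \<union> (\<odot>) ?z ` horizontal_segment ?w"
      then consider "heis_norm p \<le> sqrt \<bar>snd x\<bar> + \<epsilon>" | \<tau> where "\<tau> \<in> {0..1}" "p = ?z \<odot> (\<tau> *\<^sub>R ?w, 0)"
        by (auto simp: horizontal_segment_def)
      then show "p \<in> heis_cball (heis_norm x + \<epsilon>)"
        using 1 2 \<epsilon> by cases force+
    qed
  qed
  ultimately show ?thesis
    using reach_mono[OF _ _ compact_heis_cball] by metis
qed

text \<open>A route that comes \<open>\<eta> / 2\<close>-close to \<open>x0\<close> comes
  \<open>\<eta>\<close>-close to every \<open>x\<close> within \<open>\<eta> / 2\<close> of
  \<open>x0\<close>. A finite subcover of the ball leaves finitely many times and a positive minimum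
  of the probabilities.\<close>

lemma reach_uniform:
  assumes \<eta>: "0 < \<eta>"
  shows "\<exists>\<kappa>>0. \<exists>T. finite T \<and> T \<subseteq> \<rat> \<and> (\<forall>t\<in>T. 0 < t) \<and>
    (\<forall>x. heis_norm x \<le> 1 \<longrightarrow> (\<exists>t\<in>T. \<kappa> \<le> stay (heis_cball (1 + \<eta>)) {c. heis_norm (- x \<odot> c) \<le> \<eta>} t 0))"
proof -
  have "\<exists>t. t \<in> \<rat> \<and> 0 < t \<and> 0 < stay (tube (heis_cball (heis_norm x + \<eta> / 2)) (\<eta> / 2)) {c. heis_norm (- x \<odot> c) \<le> \<eta> / 2} t 0" for x
    using reach_cball[of "\<eta> / 2" x] \<eta> unfolding reach_def by (meson half_gt_zero)
  then obtain \<tau> where \<tau>: "\<And>x. \<tau> x \<in> \<rat>" "\<And>x. 0 < \<tau> x"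
    "\<And>x. 0 < stay (tube (heis_cball (heis_norm x + \<eta> / 2)) (\<eta> / 2)) {c. heis_norm (- x \<odot> c) \<le> \<eta> / 2} (\<tau> x) 0" by metis
  define p where "p x = stay (tube (heis_cball (heis_norm x + \<eta> / 2)) (\<eta> / 2)) {c. heis_norm (- x \<odot> c) \<le> \<eta> / 2} (\<tau> x) 0" for x
  let ?U = "\<lambda>x0. {x. heis_norm (- x \<odot> x0) < \<eta> / 2}"
  have "open (?U x0)" for x0 by (intro open_Collect_less continuous_intros)
  moreover have "heis_cball 1 \<subseteq> (\<Union>x0\<in>heis_cball 1. ?U x0)"
  proof
    fix x assume "x \<in> heis_cball 1"
    then show "x \<in> (\<Union>x0\<in>heis_cball 1. ?U x0)" by (rule UN_I) (use \<eta> in simp)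
  qed
  ultimately obtain F where F: "F \<subseteq> heis_cball 1" "finite F" "heis_cball 1 \<subseteq> (\<Union>x0\<in>F. ?U x0)"
    using compactE_image[OF compact_heis_cball[of 1], of "heis_cball 1" ?U] by metis
  have "F \<noteq> {}"
  proof
    assume "F = {}"
    moreover have "0 \<in> heis_cball 1" by simp
    ultimately show False using F(3) by blast
  qed
  define \<kappa> where "\<kappa> = Min (p ` F)"
  have \<kappa>: "0 < \<kappa>" "\<And>x0. x0 \<in> F \<Longrightarrow> \<kappa> \<le> p x0"
    using F(2) \<open>F \<noteq> {}\<close> \<tau>(3) by (auto simp: \<kappa>_def p_def)
  have "\<exists>t\<in>\<tau> ` F. \<kappa> \<le> stay (heis_cball (1 + \<eta>)) {c. heis_norm (- x \<odot> c) \<le> \<eta>} t 0" if "heis_norm x \<le> 1" for x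
  proof -
    have "x \<in> (\<Union>x0\<in>F. ?U x0)" using F(3) that by auto
    then obtain x0 where x0: "x0 \<in> F" "heis_norm (- x \<odot> x0) < \<eta> / 2" by auto
    have x01: "heis_norm x0 \<le> 1" using x0 F(1) by auto
    have "\<kappa> \<le> p x0" by (rule \<kappa>(2)[OF x0(1)])
    also have "\<dots> \<le> stay (heis_cball (1 + \<eta>)) {c. heis_norm (- x \<odot> c) \<le> \<eta>} (\<tau> x0) 0"
      unfolding p_def
    proof (rule stay_mono)
      fix q :: heis
      show "0 \<odot> q \<in> heis_cball (1 + \<eta>)" if "0 \<odot> q \<in> tube (heis_cball (heis_norm x0 + \<eta> / 2)) (\<eta> / 2)"
        using tube_cball[of "heis_norm x0 + \<eta> / 2" "\<eta> / 2"] that x01 by auto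
      assume "0 \<odot> q \<in> {c. heis_norm (- x0 \<odot> c) \<le> \<eta> / 2}"
      moreover have "- x \<odot> q = (- x \<odot> x0) \<odot> (- x0 \<odot> q)" by (simp add: heis_mult_assoc)
      ultimately show "0 \<odot> q \<in> {c. heis_norm (- x \<odot> c) \<le> \<eta>}"
        using heis_norm_triangle[of "- x \<odot> x0" "- x0 \<odot> q"] x0(2) by simp
    next
      show "closed (heis_cball (1 + \<eta>))" by (intro closed_heis_norm_le continuous_intros)
    qed (use \<tau>(2)[of x0] in \<open>auto intro: borel_closed closed_heis_nbhd\<close>)
    finally show ?thesis using x0(1) by blast
  qed
  then show ?thesis
    using \<kappa>(1) F(2) \<tau> by (intro exI[of _ \<kappa>] conjI exI[of _ "\<tau> ` F"]) auto
qed

end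

subsection \<open>Exponential decay rate of the survival probability\<close>

text \<open>Fekete's lemma with \<open>L\<close> the supremum of \<open>f n / n\<close>.
  Nonnegativity allows the remainder of a division to be dropped.\<close>

lemma superadditive_rate:
  fixes f :: "nat \<Rightarrow> real"
  assumes super: "\<And>m n. f m + f n \<le> f (m + n)" and nonneg: "\<And>n. 0 \<le> f n" and bound: "\<And>n. f n \<le> B * real n"
  shows "\<exists>L. (\<forall>n. f n \<le> L * real n) \<and> (\<forall>\<mu><L. \<forall>\<^sub>F n in sequentially. \<mu> * real n \<le> f n)"
proof -
  define L where "L = (SUP n\<in>{1..}. f n / real n)"
  have bdd: "bdd_above ((\<lambda>n. f n / real n) ` {1..})"
    using bound by (intro bdd_aboveI[of _ B]) (auto simp: divide_le_eq)
  have up: "f n \<le> L * real n" for n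
  proof (cases "n = 0")
    case False
    then have "f n / real n \<le> L" unfolding L_def by (intro cSUP_upper bdd) auto
    then show ?thesis using False by (simp add: divide_le_eq)
  qed (use bound[of 0] in simp)
  have mult: "real k * f m \<le> f (k * m)" for k m
  proof (induction k)
    case (Suc k)
    then show ?case using super[of "k * m" m] by (simp add: algebra_simps)
  qed (simp add: nonneg)
  have "\<forall>\<^sub>F n in sequentially. \<mu> * real n \<le> f n" if less: "\<mu> < L" for \<mu>
  proof -
    \<comment> \<open>A single good \<open>m\<close> suffices: division of \<open>n\<close> by
      \<open>m\<close> loses at most \<open>f m\<close>, which the gap \<open>d\<close> absorbs for
      large \<open>n\<close>.\<close>
    obtain m where m: "m \<ge> 1" "\<mu> < f m / real m"
      using less less_cSUP_iff[of "{1..}" "\<lambda>n. f n / real n" \<mu>] bdd by (auto simp: L_def)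
    define d where "d = f m / real m - \<mu>"
    have d: "0 < d" using m by (simp add: d_def)
    obtain n0 :: nat where n0: "f m / d \<le> real n0" using real_arch_simple by blast
    have "\<mu> * real n \<le> f n" if n: "n0 \<le> n" for n
    proof -
      have "n = (n div m) * m + n mod m" by simp
      then have "f n = f ((n div m) * m + n mod m)" by (rule arg_cong)
      then have 1: "real (n div m) * f m \<le> f n"
        using mult[of "n div m" m] super[of "(n div m) * m" "n mod m"] nonneg[of "n mod m"] by linarith
      have "real n = real (n div m) * real m + real (n mod m)"
        by (metis \<open>n = n div m * m + n mod m\<close> of_nat_add of_nat_mult)
      moreover have "real (n mod m) \<le> real m" using m by simp
      ultimately have "real n / real m - 1 \<le> real (n div m)" using m by (simp add: field_simps)
      then have "(real n / real m - 1) * f m \<le> real (n div m) * f m" using nonneg by (intro mult_right_mono) auto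
      with 1 have 2: "real n * (f m / real m) - f m \<le> f n" by (simp add: algebra_simps)
      have "f m \<le> d * real n" using n0 n d by (simp add: field_simps) (meson mult_left_mono of_nat_le_iff order_less_imp_le order_trans)
      then show ?thesis using 2 by (simp add: d_def algebra_simps)
    qed
    then show ?thesis by (auto simp: eventually_sequentially)
  qed
  then show ?thesis using up by auto
qed

section \<open>Survival in a ball\<close>

context heis_bm
begin

definition surv :: "real \<Rightarrow> real \<Rightarrow> heis \<Rightarrow> real" where
  "surv \<rho> t x = stay (heis_cball \<rho>) UNIV t x"

abbreviation surv_event :: "real \<Rightarrow> real \<Rightarrow> heis \<Rightarrow> 'a set" where
  "surv_event \<rho> t x \<equiv> stay_event (heis_cball \<rho>) UNIV t x"

lemma closed_heis_cball: "closed (heis_cball r)"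
  by (intro closed_heis_norm_le continuous_intros)

lemma surv_eq: "surv \<rho> t x = prob (surv_event \<rho> t x)"
  by (simp add: surv_def stay_eq)

lemma surv_event_iff: "\<omega> \<in> surv_event \<rho> t x \<longleftrightarrow> \<omega> \<in> space M \<and> (\<forall>u\<in>{0..t}. heis_norm (x \<odot> g u \<omega>) \<le> \<rho>)"
  by (auto simp: stay_event_def)

lemma surv_event_events: "0 \<le> t \<Longrightarrow> surv_event \<rho> t x \<in> events"
  by (intro stay_event_events closed_heis_cball) auto

lemma surv_event_filt: "0 < h \<Longrightarrow> surv_event \<rho> (real n * h) x \<in> sets (filt h n)"
  by (intro stay_event_filt closed_heis_cball) auto

lemma surv_bounds: "0 \<le> surv \<rho> t x" "surv \<rho> t x \<le> 1"
  by (simp_all add: surv_eq)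

lemma surv_antimono:
  assumes "0 \<le> s" "s \<le> t"
  shows "surv \<rho> t x \<le> surv \<rho> s x"
  unfolding surv_eq
proof (rule finite_measure_mono)
  show "surv_event \<rho> t x \<subseteq> surv_event \<rho> s x"
    unfolding subset_iff surv_event_iff using assms by auto
qed (use assms in \<open>auto intro: surv_event_events\<close>)

lemma surv_outside: "\<rho> < heis_norm x \<Longrightarrow> 0 \<le> t \<Longrightarrow> surv \<rho> t x = 0"
proof -
  assume "\<rho> < heis_norm x" "0 \<le> t"
  then have "\<omega> \<notin> surv_event \<rho> t x" for \<omega>
    unfolding surv_event_iff using g_0[of \<omega>] by (auto intro!: bexI[of _ 0])
  then have "surv_event \<rho> t x = {}" by blast
  then show ?thesis by (simp add: surv_eq)
qed

lemma surv_scaling: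
  assumes "0 < r" "0 < t"
  shows "surv (r * \<rho>) (r\<^sup>2 * t) (heis_dil r x) = surv \<rho> t x"
proof -
  have "heis_dil r -` heis_cball (r * \<rho>) = heis_cball \<rho>" using assms by auto
  then show ?thesis
    using stay_scaling[of "r\<^sup>2" t "heis_cball (r * \<rho>)" UNIV "heis_dil r x"] assms
    by (simp add: surv_def closed_heis_cball heis_dil_dil)
qed

lemma surv_0_scaling: "0 < r \<Longrightarrow> 0 < t \<Longrightarrow> surv r t 0 = surv 1 (t / r\<^sup>2) 0"
  using surv_scaling[of r "t / r\<^sup>2" 1 0] by simp

text \<open>The supremum runs over the whole group, so any restart point is covered; starts outside
  the unit ball contribute \<open>0\<close>.\<close>

definition q :: "nat \<Rightarrow> real" where
  "q n = (SUP x. surv 1 (real n) x)"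

lemma q_upper: "surv 1 (real n) x \<le> q n"
  unfolding q_def by (intro cSUP_upper) (auto intro!: bdd_aboveI[of _ 1] simp: surv_bounds)

lemma q_least: "(\<And>x. surv 1 (real n) x \<le> b) \<Longrightarrow> q n \<le> b"
  unfolding q_def by (intro cSUP_least) auto

lemma q_bounds: "0 \<le> q n" "q n \<le> 1"
  using order_trans[OF surv_bounds(1) q_upper] by (auto intro: q_least surv_bounds)

lemma q_submult: "q (m + n) \<le> q m * q n"
proof (rule q_least)
  fix x
  let ?E = "surv_event 1 (real m * 1) x" and ?\<psi> = "\<lambda>\<omega>. x \<odot> g (real m * 1) \<omega>"
  let ?F = "fut_event (heis_cball 1) UNIV (real m * 1) (real n * 1) ?\<psi>"
  have E: "?E \<in> sets (filt 1 m)" by (rule surv_event_filt) simp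
  have \<psi>: "?\<psi> \<in> borel_measurable (filt 1 m)"
    by (intro borel_measurable_heis_mult measurable_const g_filt_meas) simp
  have "surv 1 (real (m + n)) x \<le> prob (?E \<inter> ?F)"
    unfolding surv_eq
  proof (rule finite_measure_mono)
    show "surv_event 1 (real (m + n)) x \<subseteq> ?E \<inter> ?F"
    proof
      fix \<omega> assume "\<omega> \<in> surv_event 1 (real (m + n)) x"
      then have \<omega>: "\<omega> \<in> space M" "\<And>u. 0 \<le> u \<Longrightarrow> u \<le> real m + real n \<Longrightarrow> heis_norm (x \<odot> g u \<omega>) \<le> 1"
        by (auto simp: surv_event_iff)
      then show "\<omega> \<in> ?E \<inter> ?F" by (auto simp: surv_event_iff fut_event_def heis_mult_assoc)
    qed
    \<comment> \<open>With the actual position as restart point the future event is a statement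
      about the path at times \<open>m + u\<close>, which gives its measurability.\<close>
    have "?F \<inter> ?E = ?E \<inter> {\<omega> \<in> space M. \<forall>u\<in>{0..real n}. x \<odot> g (real m + u) \<omega> \<in> heis_cball 1}"
      by (auto simp: fut_event_def surv_event_iff heis_mult_assoc)
    moreover have "{\<omega> \<in> space M. \<forall>u\<in>{0..real n * 1}. x \<odot> g (real m + u) \<omega> \<in> heis_cball 1} \<in> events"
      by (rule sets_stay[OF g_cont_shift closed_heis_cball]) auto
    moreover have "?E \<in> events" using E filt_subset by blast
    ultimately have "?F \<inter> ?E \<in> events" by simp
    then show "?E \<inter> ?F \<in> events" by (simp only: Int_commute)
  qed
  also have "\<dots> \<le> prob ?E * q n"
    using q_upper[of n] by (intro markov_le[OF _ E \<psi> closed_heis_cball]) (auto simp flip: surv_def)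
  also have "\<dots> \<le> q m * q n"
    using q_upper[of m x] q_bounds by (intro mult_right_mono) (auto simp: surv_eq)
  finally show "surv 1 (real (m + n)) x \<le> q m * q n" .
qed

text \<open>From \<open>x\<close> in the unit ball the increments are steered towards
  \<open>- x\<close>, which brings the path back to the unit ball. Meanwhile they stay within radius
  2 and the path within radius 3. Each return costs a factor \<open>\<kappa>\<close> and takes at
  least the smallest of the finitely many times.\<close>

lemma surv_lower_steps:
  "\<exists>\<kappa> \<tau>. 0 < \<kappa> \<and> \<kappa> \<le> 1 \<and> 0 < \<tau> \<and> (\<forall>k S x. S \<in> \<rat> \<longrightarrow> 0 \<le> S \<longrightarrow> S \<le> real k * \<tau> \<longrightarrow> heis_norm x \<le> 1 \<longrightarrow> \<kappa> ^ k \<le> surv 3 S x)"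
proof -
  obtain \<kappa> T where \<kappa>: "0 < \<kappa>" and T: "finite T" "T \<subseteq> \<rat>" "\<And>t. t \<in> T \<Longrightarrow> 0 < t"
    and reach: "\<And>x. heis_norm x \<le> 1 \<Longrightarrow> \<exists>t\<in>T. \<kappa> \<le> stay (heis_cball (1 + 1)) {c. heis_norm (- x \<odot> c) \<le> 1} t 0"
    using reach_uniform[of 1] by auto
  have "T \<noteq> {}" using reach[of 0] by auto
  define \<tau> where "\<tau> = Min T"
  have \<tau>: "0 < \<tau>" "\<And>t. t \<in> T \<Longrightarrow> \<tau> \<le> t" using T \<open>T \<noteq> {}\<close> by (auto simp: \<tau>_def)
  have \<kappa>1: "\<kappa> \<le> 1"
  proof -
    obtain t where "\<kappa> \<le> stay (heis_cball (1 + 1)) {c. heis_norm (- 0 \<odot> c) \<le> 1} t 0" using reach[of 0] by auto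
    then show ?thesis using stay_bounds(2) order_trans by blast
  qed
  have "\<kappa> ^ k \<le> surv 3 S x" if "S \<in> \<rat>" "0 \<le> S" "S \<le> real k * \<tau>" "heis_norm x \<le> 1" for k S x
    using that
  proof (induction k arbitrary: S x)
    case 0
    \<comment> \<open>\<open>S \<le> 0 * \<tau>\<close> leaves no time to survive.\<close>
    then have "S = 0" by simp
    have "surv_event 3 0 x = space M" using 0 by (auto simp: surv_event_iff g_0)
    then show ?case using \<open>S = 0\<close> by (simp add: surv_eq prob_space)
  next
    case (Suc k)
    obtain t where t: "t \<in> T" "\<kappa> \<le> stay (heis_cball (1 + 1)) {c. heis_norm (- (- x) \<odot> c) \<le> 1} t 0"
      using reach[of "- x"] Suc.prems by auto
    have tpos: "0 < t" "t \<in> \<rat>" using T t by auto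
    let ?C' = "{c. heis_norm (x \<odot> c) \<le> 1}"
    have C': "?C' \<in> sets borel" by (intro borel_closed closed_heis_norm_le continuous_intros)
    let ?E = "stay_event (heis_cball 2) ?C' t 0"
    have PE: "\<kappa> \<le> prob ?E" using t by (simp add: stay_eq)
    have E3: "?E \<subseteq> surv_event 3 t x"
    proof
      fix \<omega> assume \<omega>: "\<omega> \<in> ?E"
      have "heis_norm (x \<odot> g u \<omega>) \<le> 3" if "u \<in> {0..t}" for u
      proof -
        have "heis_norm (g u \<omega>) \<le> 2" using \<omega> that by (auto simp: stay_event_def)
        then show ?thesis using heis_norm_triangle[of x "g u \<omega>"] Suc.prems(4) by linarith
      qed
      then show "\<omega> \<in> surv_event 3 t x" using \<omega> by (auto simp: surv_event_iff stay_event_def)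
    qed
    show ?case
    proof (cases "S \<le> t")
      case True
      have "\<kappa> ^ Suc k \<le> \<kappa>" using \<kappa> \<kappa>1 by (simp add: mult_left_le power_le_one)
      also have "\<dots> \<le> prob (surv_event 3 t x)"
        using finite_measure_mono[OF E3 surv_event_events[of t 3 x]] PE tpos by simp
      also have "\<dots> \<le> surv 3 S x" using surv_antimono[of S t 3 x] Suc.prems True by (simp add: surv_eq)
      finally show ?thesis .
    next
      case False
      obtain h m n where h: "0 < h" "t = real m * h" "S - t = real n * h"
        using rational_grid[of t "S - t"] tpos Suc.prems False by auto
      let ?\<psi> = "\<lambda>\<omega>. x \<odot> g t \<omega>"
      let ?F = "fut_event (heis_cball 3) UNIV t (S - t) ?\<psi>"
      have E: "?E \<in> sets (filt h m)" unfolding h(2) by (intro stay_event_filt h(1) closed_heis_cball C')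
      have \<psi>: "?\<psi> \<in> borel_measurable (filt h m)"
        unfolding h(2) by (intro borel_measurable_heis_mult measurable_const g_filt_meas) simp
      have "\<kappa> * \<kappa> ^ k \<le> prob ?E * \<kappa> ^ k" using PE \<kappa> by (intro mult_right_mono) auto
      also have "\<dots> \<le> prob (?E \<inter> fut_event (heis_cball 3) UNIV (real m * h) (real n * h) ?\<psi>)"
      proof (rule markov_ge[OF h(1) E \<psi> closed_heis_cball])
        fix \<omega> assume "\<omega> \<in> ?E"
        then have "heis_norm (?\<psi> \<omega>) \<le> 1" by (auto simp: stay_event_def)
        moreover have "S - t \<le> real k * \<tau>" using Suc.prems(3) \<tau>(2)[OF t(1)] by (simp add: distrib_right)
        ultimately have "\<kappa> ^ k \<le> surv 3 (S - t) (?\<psi> \<omega>)"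
          using Suc.prems tpos False by (intro Suc.IH) auto
        then show "\<kappa> ^ k \<le> stay (heis_cball 3) UNIV (real n * h) (?\<psi> \<omega>)" by (simp add: surv_def h(3))
      qed simp
      also have "\<dots> = prob (?E \<inter> ?F)" by (simp only: h(2,3)[symmetric])
      also have "\<dots> \<le> surv 3 S x"
        unfolding surv_eq
      proof (rule finite_measure_mono)
        show "?E \<inter> ?F \<subseteq> surv_event 3 S x"
        proof
          fix \<omega> assume \<omega>: "\<omega> \<in> ?E \<inter> ?F"
          have "heis_norm (x \<odot> g u \<omega>) \<le> 3" if u: "u \<in> {0..S}" for u
          proof (cases "u \<le> t")
            case True
            then show ?thesis using \<omega> E3 u by (auto simp: surv_event_iff)
          next
            case False
            then have "u - t \<in> {0..S - t}" using u by auto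
            moreover have "\<forall>v\<in>{0..S - t}. heis_norm (x \<odot> g (t + v) \<omega>) \<le> 3"
              using \<omega> by (auto simp: fut_event_def heis_mult_assoc)
            ultimately have "heis_norm (x \<odot> g (t + (u - t)) \<omega>) \<le> 3" by blast
            then show ?thesis by simp
          qed
          then show "\<omega> \<in> surv_event 3 S x" using \<omega> by (auto simp: surv_event_iff stay_event_def)
        qed
      qed (use Suc.prems in \<open>auto intro: surv_event_events\<close>)
      finally show ?thesis by simp
    qed
  qed
  then show ?thesis using \<kappa> \<kappa>1 \<tau>(1) by blast
qed

text \<open>Scaling turns radius 3 and time \<open>9 n\<close> into radius 1 and time
  \<open>n\<close>; the extra step from rounding is absorbed since \<open>n \<ge> 1\<close>.\<close>

lemma surv_1_lower: "\<exists>B. \<forall>n>0. 0 < surv 1 (real n) 0 \<and> - ln (surv 1 (real n) 0) \<le> B * real n"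
proof -
  obtain \<kappa> \<tau> where \<kappa>: "0 < \<kappa>" "\<kappa> \<le> 1" "0 < \<tau>"
    and low: "\<And>k S x. S \<in> \<rat> \<Longrightarrow> 0 \<le> S \<Longrightarrow> S \<le> real k * \<tau> \<Longrightarrow> heis_norm x \<le> 1 \<Longrightarrow> \<kappa> ^ k \<le> surv 3 S x"
    using surv_lower_steps by blast
  have "0 < surv 1 (real n) 0 \<and> - ln (surv 1 (real n) 0) \<le> ((9 / \<tau> + 1) * (- ln \<kappa>)) * real n" if n: "0 < n" for n :: nat
  proof -
    define k where "k = nat \<lceil>9 * real n / \<tau>\<rceil>"
    have k: "9 * real n / \<tau> \<le> real k" "real k \<le> 9 * real n / \<tau> + 1" using \<kappa>(3) unfolding k_def by (simp_all add: of_nat_ceiling)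
    have "\<kappa> ^ k \<le> surv 3 (9 * real n) 0"
      using k(1) \<kappa>(3) by (intro low) (auto simp: field_simps)
    also have "surv 3 (9 * real n) 0 = surv 1 (real n) 0" using surv_0_scaling[of 3 "9 * real n"] n by simp
    finally have le: "\<kappa> ^ k \<le> surv 1 (real n) 0" .
    have pk: "0 < \<kappa> ^ k" using \<kappa> by simp
    then have pos: "0 < surv 1 (real n) 0" using le by linarith
    have "ln (\<kappa> ^ k) \<le> ln (surv 1 (real n) 0)" using le pk pos by (subst ln_le_cancel_iff)
    then have "- ln (surv 1 (real n) 0) \<le> real k * (- ln \<kappa>)" using \<kappa> by (simp add: ln_realpow)
    also have "\<dots> \<le> ((9 / \<tau> + 1) * real n) * (- ln \<kappa>)"
    proof (rule mult_right_mono)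
      have "1 \<le> real n" using n by simp
      then show "real k \<le> (9 / \<tau> + 1) * real n" using k(2) by (simp add: algebra_simps)
      show "0 \<le> - ln \<kappa>" using \<kappa> by (simp add: ln_le_zero_iff)
    qed
    finally show ?thesis using pos by (simp add: mult_ac)
  qed
  then show ?thesis by blast
qed

text \<open>Survival for unit time forces a horizontal displacement of at most 2, whatever the
  start. The target \<open>(3, 0)\<close> with tolerance 1 excludes this with a probability
  independent of the start. It makes the rate positive.\<close>

lemma q_1_less: "q 1 < 1"
proof -
  let ?B = "{\<omega> \<in> space M. norm (fst (g 1 \<omega>) - (3, 0)) < 1}"
  have "surv 1 1 x \<le> 1 - prob ?B" for x
  proof (cases "heis_norm x \<le> 1")
    case False
    then show ?thesis using surv_outside[of 1 x 1] by simp
  next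
    case True
    have "surv 1 1 x \<le> prob (space M - ?B)"
      unfolding surv_eq
    proof (rule finite_measure_mono)
      show "surv_event 1 1 x \<subseteq> space M - ?B"
      proof
        fix \<omega> assume "\<omega> \<in> surv_event 1 1 x"
        then have \<omega>: "\<omega> \<in> space M" "heis_norm (x \<odot> g 1 \<omega>) \<le> 1" by (auto simp: surv_event_iff)
        have "norm (fst (x \<odot> g 1 \<omega>) - fst x) \<le> 1 + 1"
          using norm_fst_le_heis_norm[of "x \<odot> g 1 \<omega>"] norm_fst_le_heis_norm[of x] \<omega>(2) True
          by (intro order_trans[OF norm_triangle_ineq4] add_mono) auto
        then have "norm (fst (g 1 \<omega>)) \<le> 2" by simp
        moreover have "norm (3::real, 0::real) = 3" by simp
        moreover have "norm (3::real, 0::real) \<le> norm (fst (g 1 \<omega>)) + norm (fst (g 1 \<omega>) - (3, 0))"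
          using norm_triangle_sub[of "(3, 0)" "fst (g 1 \<omega>)"] by (simp add: norm_minus_commute)
        ultimately show "\<omega> \<in> space M - ?B" using \<omega> by auto
      qed
    qed measurable
    also have "\<dots> = 1 - prob ?B" by (intro prob_compl) measurable
    finally show ?thesis .
  qed
  then have "q 1 \<le> 1 - prob ?B" by (intro q_least) simp
  then show ?thesis using g_support[of 1 "(3, 0)"] by simp
qed

text \<open>First go near \<open>x\<close>, then use increments that would survive from exactly
  \<open>x\<close>. Such increments have norm at most 2, so replacing the true position by
  \<open>x\<close> costs \<open>\<eta> + sqrt (\<eta> * 2)\<close>, which fits into
  \<open>\<rho> - 1\<close>.\<close>

lemma q_le_surv_enlarged:
  assumes \<rho>: "1 < \<rho>"
  shows "\<exists>\<kappa>>0. \<forall>n. \<kappa> * q n \<le> surv \<rho> (real n) 0"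
proof -
  obtain \<eta> where \<eta>: "0 < \<eta>" "\<eta> + sqrt (\<eta> * 2) \<le> \<rho> - 1" using small_conj_bound[of "\<rho> - 1" 2] \<rho> by auto
  have \<eta>\<rho>: "1 + \<eta> \<le> \<rho>"
  proof -
    have "0 \<le> sqrt (\<eta> * 2)" using \<eta>(1) by simp
    then show ?thesis using \<eta>(2) by linarith
  qed
  obtain \<kappa> T where \<kappa>: "0 < \<kappa>" and T: "T \<subseteq> \<rat>" "\<And>t. t \<in> T \<Longrightarrow> 0 < t"
    and reach: "\<And>x. heis_norm x \<le> 1 \<Longrightarrow> \<exists>t\<in>T. \<kappa> \<le> stay (heis_cball (1 + \<eta>)) {c. heis_norm (- x \<odot> c) \<le> \<eta>} t 0"
    using reach_uniform[OF \<eta>(1)] by blast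
  have "\<kappa> * surv 1 (real n) x \<le> surv \<rho> (real n) 0" for n x
  proof (cases "heis_norm x \<le> 1")
    case False
    then show ?thesis using surv_outside[of 1 x "real n"] surv_bounds by simp
  next
    case True
    obtain t where t: "t \<in> T" "\<kappa> \<le> stay (heis_cball (1 + \<eta>)) {c. heis_norm (- x \<odot> c) \<le> \<eta>} t 0"
      using reach[OF True] by auto
    have tpos: "0 < t" "t \<in> \<rat>" using T t by auto
    obtain h m n' where h: "0 < h" "t = real m * h" "real n = real n' * h"
      using rational_grid[of t "real n"] tpos by auto
    let ?E = "stay_event (heis_cball (1 + \<eta>)) {c. heis_norm (- x \<odot> c) \<le> \<eta>} t 0"
    \<comment> \<open>The restart point is the constant \<open>x\<close>, not the position reached,
      which makes this event independent of the first piece.\<close>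
    let ?F = "fut_event (heis_cball 1) UNIV t (real n) (\<lambda>_. x)"
    have "\<kappa> * surv 1 (real n) x \<le> prob ?E * surv 1 (real n) x"
      using t(2) surv_bounds by (intro mult_right_mono) (auto simp: stay_eq)
    also have "\<dots> = prob (?E \<inter> ?F)"
      unfolding h(2,3) surv_def
      by (intro markov_const[symmetric] stay_event_filt h(1) closed_heis_cball borel_closed closed_heis_nbhd) simp
    also have "\<dots> \<le> prob (surv_event \<rho> (real n) 0)"
    proof (rule finite_measure_mono)
      show "?E \<inter> ?F \<subseteq> surv_event \<rho> (real n) 0"
      proof
        fix \<omega> assume \<omega>: "\<omega> \<in> ?E \<inter> ?F"
        then have E: "\<omega> \<in> space M" "\<And>u. u \<in> {0..t} \<Longrightarrow> heis_norm (g u \<omega>) \<le> 1 + \<eta>" "heis_norm (- x \<odot> g t \<omega>) \<le> \<eta>"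
          and F: "\<And>v. v \<in> {0..real n} \<Longrightarrow> heis_norm (x \<odot> (- g t \<omega> \<odot> g (t + v) \<omega>)) \<le> 1"
          by (auto simp: stay_event_def fut_event_def)
        have "heis_norm (g u \<omega>) \<le> \<rho>" if u: "u \<in> {0..real n}" for u
        proof (cases "u \<le> t")
          case True
          then show ?thesis using E(2)[of u] u \<eta>\<rho> by auto
        next
          case False
          then have v: "u - t \<in> {0..real n}" using u tpos by auto
          define c where "c = - g t \<omega> \<odot> g u \<omega>"
          have xc: "heis_norm (x \<odot> c) \<le> 1" using F[OF v] by (simp add: c_def)
          have "heis_norm c \<le> heis_norm (- x) + heis_norm (x \<odot> c)" using heis_norm_triangle[of "- x" "x \<odot> c"] by simp
          then have c2: "heis_norm c \<le> 2" using xc True by simp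
          have "g u \<omega> = x \<odot> (- x \<odot> g t \<omega>) \<odot> c" by (simp add: c_def heis_mult_assoc)
          then have "heis_norm (g u \<omega>) \<le> heis_norm (x \<odot> c) + \<eta> + sqrt (\<eta> * 2)"
            using heis_norm_mult_perturb[OF E(3) c2, of x] by simp
          then show ?thesis using xc \<eta>(2) by linarith
        qed
        then show "\<omega> \<in> surv_event \<rho> (real n) 0" using E(1) by (simp add: surv_event_iff)
      qed
    qed (auto intro: surv_event_events)
    finally show ?thesis by (simp add: surv_eq)
  qed
  then have "\<kappa> * q n \<le> surv \<rho> (real n) 0" for n
    using q_least[of n "surv \<rho> (real n) 0 / \<kappa>"] \<kappa> by (simp add: field_simps)
  then show ?thesis using \<kappa> by blast
qed

text \<open>The rate of \<open>q\<close> bounds survival from \<open>0\<close> above at once. Below,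
  survival in radius \<open>\<rho>\<close> for time \<open>\<rho>^2 T\<close> is rescaled to radius
  1 and time \<open>T\<close>, and \<open>\<rho>\<close> is taken close to 1.\<close>

theorem surv_rate:
  "\<exists>L>0. (\<forall>\<mu>. 0 < \<mu> \<longrightarrow> \<mu> < L \<longrightarrow> (\<forall>\<^sub>F T in at_top. surv 1 T 0 \<le> exp (- \<mu> * T))) \<and>
         (\<forall>\<mu>>L. \<forall>\<^sub>F T in at_top. exp (- \<mu> * T) \<le> surv 1 T 0)"
proof -
  obtain B where B: "\<And>n. 0 < n \<Longrightarrow> 0 < surv 1 (real n) 0 \<and> - ln (surv 1 (real n) 0) \<le> B * real n" using surv_1_lower by blast
  have q0: "q 0 = 1"
  proof -
    have "surv_event 1 0 0 = space M" by (auto simp: surv_event_iff g_0)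
    then have "surv 1 (real 0) 0 = 1" by (simp add: surv_eq prob_space)
    then show ?thesis using q_upper[of 0 0] q_bounds(2)[of 0] by linarith
  qed
  have qpos: "0 < q n" for n
    using B[of n] q_upper[of n 0] q0 by (cases "n = 0") (auto intro: less_le_trans)
  define f where "f n = - ln (q n)" for n
  have super: "f m + f n \<le> f (m + n)" for m n
  proof -
    have "ln (q (m + n)) \<le> ln (q m * q n)" using q_submult[of m n] qpos by (subst ln_le_cancel_iff) auto
    then show ?thesis using qpos by (simp add: f_def ln_mult_pos)
  qed
  have nonneg: "0 \<le> f n" for n using q_bounds[of n] qpos[of n] by (simp add: f_def)
  have bound: "f n \<le> B * real n" for n
  proof (cases "n = 0")
    case False
    then have "ln (surv 1 (real n) 0) \<le> ln (q n)" using B[of n] q_upper[of n 0] qpos[of n] by (subst ln_le_cancel_iff) auto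
    then show ?thesis using B[of n] False by (simp add: f_def)
  qed (simp add: f_def q0)
  obtain L where L: "\<And>n. f n \<le> L * real n" "\<And>\<mu>. \<mu> < L \<Longrightarrow> \<forall>\<^sub>F n in sequentially. \<mu> * real n \<le> f n"
    using superadditive_rate[of f B, OF super nonneg bound] by blast
  have "0 < f 1" using q_1_less qpos[of 1] by (simp add: f_def)
  then have Lpos: "0 < L" using L(1)[of 1] by simp
  have up: "\<forall>\<^sub>F T in at_top. surv 1 T 0 \<le> exp (- \<mu> * T)" if \<mu>: "0 < \<mu>" "\<mu> < L" for \<mu>
  proof -
    \<comment> \<open>A rate strictly between pays for rounding \<open>T\<close> down to an
      integer.\<close>
    define \<mu>' where "\<mu>' = (\<mu> + L) / 2"
    have \<mu>': "\<mu> < \<mu>'" "\<mu>' < L" "0 < \<mu>'" using \<mu> by (auto simp: \<mu>'_def)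
    obtain n0 where n0: "\<And>n. n0 \<le> n \<Longrightarrow> \<mu>' * real n \<le> f n" using L(2)[OF \<mu>'(2)] by (auto simp: eventually_sequentially)
    show ?thesis
      using eventually_ge_at_top[of "real n0 + 1"] eventually_ge_at_top[of "\<mu>' / (\<mu>' - \<mu>)"] eventually_ge_at_top[of 0]
    proof eventually_elim
      fix T :: real assume T: "real n0 + 1 \<le> T" "\<mu>' / (\<mu>' - \<mu>) \<le> T" "0 \<le> T"
      define n where "n = nat \<lfloor>T\<rfloor>"
      have n: "real n \<le> T" "T < real n + 1" using T by (auto simp: n_def) 
      have "n0 \<le> n" using T n by linarith
      have "\<mu> * T \<le> \<mu>' * (T - 1)" using T(2) \<mu>' by (simp add: field_simps)
      also have "\<dots> \<le> \<mu>' * real n" using n \<mu>' by (intro mult_left_mono) auto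
      also have "\<dots> \<le> f n" by (rule n0[OF \<open>n0 \<le> n\<close>])
      finally have fT: "\<mu> * T \<le> f n" .
      have "surv 1 T 0 \<le> surv 1 (real n) 0" using n by (intro surv_antimono) auto
      also have "\<dots> \<le> q n" by (rule q_upper)
      also have "\<dots> = exp (- f n)" using qpos[of n] by (simp add: f_def)
      also have "\<dots> \<le> exp (- \<mu> * T)" using fT by simp
      finally show "surv 1 T 0 \<le> exp (- \<mu> * T)" .
    qed
  qed
  have low: "\<forall>\<^sub>F T in at_top. exp (- \<mu> * T) \<le> surv 1 T 0" if \<mu>: "L < \<mu>" for \<mu>
  proof -
    \<comment> \<open>Chosen so that \<open>L \<rho>^2 = (L + \<mu>) / 2\<close>; the other half of
      the gap, times \<open>T\<close>, absorbs \<open>- ln \<kappa>\<close> and the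
      rounding.\<close>
    define \<rho> where "\<rho> = sqrt ((L + \<mu>) / (2 * L))"
    have arg: "1 < (L + \<mu>) / (2 * L)" using \<mu> Lpos by (simp add: field_simps)
    have \<rho>: "1 < \<rho>" "\<rho>\<^sup>2 = (L + \<mu>) / (2 * L)" using arg by (auto simp: \<rho>_def)
    obtain \<kappa> where \<kappa>: "0 < \<kappa>" "\<And>n. \<kappa> * q n \<le> surv \<rho> (real n) 0" using q_le_surv_enlarged[OF \<rho>(1)] by blast
    show ?thesis
      using eventually_ge_at_top[of "(- ln \<kappa> + L) / ((\<mu> - L) / 2)"] eventually_gt_at_top[of 0]
    proof eventually_elim
      fix T :: real assume T: "(- ln \<kappa> + L) / ((\<mu> - L) / 2) \<le> T" "0 < T"
      define n where "n = nat \<lceil>\<rho>\<^sup>2 * T\<rceil>"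
      have n: "\<rho>\<^sup>2 * T \<le> real n" "real n \<le> \<rho>\<^sup>2 * T + 1" using T by (auto simp: n_def of_nat_ceiling)
      have "- ln \<kappa> + L \<le> T * ((\<mu> - L) / 2)" using T(1) \<mu> by (subst (asm) pos_divide_le_eq) auto
      moreover have "L * real n \<le> L * (\<rho>\<^sup>2 * T + 1)" using n Lpos by (intro mult_left_mono) auto
      moreover have "L * (\<rho>\<^sup>2 * T + 1) = (L + \<mu>) / 2 * T + L" using Lpos by (simp add: \<rho>(2) field_simps)
      ultimately have *: "- ln \<kappa> + f n \<le> \<mu> * T" using L(1)[of n] by (simp add: field_simps)
      have "exp (- \<mu> * T) \<le> exp (ln \<kappa> - f n)" using * by simp
      also have "\<dots> = \<kappa> * q n" using \<kappa>(1) qpos[of n] by (simp add: f_def exp_add)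
      also have "\<dots> \<le> surv \<rho> (real n) 0" by (rule \<kappa>(2))
      also have "\<dots> \<le> surv \<rho> (\<rho>\<^sup>2 * T) 0" using n T by (intro surv_antimono) auto
      also have "\<dots> = surv 1 T 0" using surv_scaling[of \<rho> T 1 0] \<rho> T by simp
      finally show "exp (- \<mu> * T) \<le> surv 1 T 0" .
    qed
  qed
  show ?thesis using Lpos up low by blast
qed

end

subsection \<open>Tail of the running maximum\<close>

context heis_bm
begin

lemma incr_tail:
  assumes h: "0 < h" and r: "0 < r"
  shows "prob {\<omega> \<in> space M. r < heis_norm (incr h j \<omega>)} \<le> 32 * h\<^sup>2 / r ^ 4"
proof -
  have S: "{c. r < heis_norm c} \<in> sets borel" by measurable
  have "prob {\<omega> \<in> space M. r < heis_norm (incr h j \<omega>)} = measure (distr M borel (incr h j)) {c. r < heis_norm c}"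
    using S by (subst measure_distr) (auto simp: vimage_def Int_def conj_commute simp del: of_nat_Suc)
  also have "\<dots> = measure (distr M borel (\<lambda>\<omega>. heis_dil (sqrt h) (g 1 \<omega>))) {c. r < heis_norm c}"
    by (simp only: g_law[OF h])
  also have "\<dots> = prob {\<omega> \<in> space M. r / sqrt h < heis_norm (g 1 \<omega>)}"
    using S h by (subst measure_distr) (auto simp: vimage_def Int_def conj_commute divide_less_eq mult.commute)
  also have "\<dots> \<le> 32 / (r / sqrt h) ^ 4" using h r by (intro g_tail) simp
  also have "(r / sqrt h) ^ 4 = r ^ 4 / h\<^sup>2"
  proof -
    have "sqrt h ^ 4 = ((sqrt h)\<^sup>2)\<^sup>2" by (simp flip: power_mult)
    then show ?thesis using h by (simp add: power_divide)
  qed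
  finally show ?thesis by simp
qed

text \<open>Chaining: a dyadic point of level \<open>l\<close> is reached from \<open>0\<close> by at most one dyadic increment of
  each level \<open>m \<le> l\<close>, and the weights \<open>(9/10)\<^sup>m/10\<close> sum to \<open>1\<close>.\<close>

lemma chaining_bound:
  assumes \<omega>: "\<omega> \<in> space M" and R: "0 < R"
    and inc: "\<And>m j. m \<le> l \<Longrightarrow> j < 2 ^ m \<Longrightarrow> heis_norm (incr (1 / 2 ^ m) j \<omega>) \<le> R * ((9 / 10) ^ m / 10)"
  shows "j \<le> 2 ^ l \<Longrightarrow> heis_norm (g (real j * (1 / 2 ^ l)) \<omega>) \<le> R * (\<Sum>m<Suc l. (9 / 10) ^ m / 10)"
  using inc
proof (induction l arbitrary: j)
  case 0
  then consider "j = 0" | "j = 1" by fastforce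
  then show ?case
  proof cases
    case 2
    then show ?thesis using 0(2)[of 0 0] \<omega> by (simp add: g_0)
  qed (use \<omega> R in \<open>simp add: g_0\<close>)
next
  case (Suc l)
  have IH: "heis_norm (g (real i * (1 / 2 ^ l)) \<omega>) \<le> R * (\<Sum>m<Suc l. (9 / 10) ^ m / 10)" if "i \<le> 2 ^ l" for i
    using that Suc.prems(2) by (intro Suc.IH) auto
  have even: "g (real (2 * i) * (1 / 2 ^ Suc l)) \<omega> = g (real i * (1 / 2 ^ l)) \<omega>" for i by simp
  have S: "R * (\<Sum>m<Suc (Suc l). (9 / 10) ^ m / 10) = R * (\<Sum>m<Suc l. (9 / 10) ^ m / 10) + R * ((9 / 10) ^ Suc l / 10)"
    by (simp add: algebra_simps)
  have pos: "0 \<le> R * ((9 / 10) ^ Suc l / 10)" using R by simp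
  show ?case
  proof (cases "even j")
    case True
    then obtain i where i: "j = 2 * i" by (elim evenE)
    then have "i \<le> 2 ^ l" using Suc.prems(1) by simp
    from IH[OF this] show ?thesis unfolding i even S using pos by linarith
  next
    case False
    then obtain i where i: "j = 2 * i + 1" by (elim oddE)
    then have il: "i \<le> 2 ^ l" "2 * i < 2 ^ Suc l" using Suc.prems(1) by simp_all
    have "g (real j * (1 / 2 ^ Suc l)) \<omega> = g (real (2 * i) * (1 / 2 ^ Suc l)) \<omega> \<odot> incr (1 / 2 ^ Suc l) (2 * i) \<omega>"
      by (simp add: i)
    then have "heis_norm (g (real j * (1 / 2 ^ Suc l)) \<omega>) \<le> heis_norm (g (real (2 * i) * (1 / 2 ^ Suc l)) \<omega>) + heis_norm (incr (1 / 2 ^ Suc l) (2 * i) \<omega>)"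
      by (simp only: heis_norm_triangle)
    also have "\<dots> \<le> R * (\<Sum>m<Suc l. (9 / 10) ^ m / 10) + R * ((9 / 10) ^ Suc l / 10)"
      using IH[OF il(1)] Suc.prems(2)[OF order_refl il(2)] unfolding even by (rule add_mono)
    finally show ?thesis unfolding S .
  qed
qed

text \<open>Union bound over the dyadic increments of all levels. Level \<open>m\<close> has
  \<open>2^m\<close> of them, each exceeding its share with probability of order
  \<open>4^(-m) (10/9)^(4 m) / R^4\<close>, so the total is a convergent geometric series.\<close>

lemma surv_tail: "\<exists>K. \<forall>R>0. 1 - K / R ^ 4 \<le> surv R 1 0"
proof -
  \<comment> \<open>This is \<open>(1/2) (10/9)^4\<close>, below 1; the weight ratio
    \<open>9/10\<close> has to exceed \<open>2^(-1/4)\<close> for that.\<close>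
  define x :: real where "x = 5000 / 6561"
  define K where "K = 320000 * (1 / (1 - x))"
  have x: "0 \<le> x" "x < 1" by (simp_all add: x_def)
  have "1 - K / R ^ 4 \<le> surv R 1 0" if R: "0 < R" for R
  proof (rule LIMSEQ_le_const)
    let ?G = "\<lambda>l. {\<omega> \<in> space M. (\<forall>j\<le>1 * 2 ^ l. 0 \<odot> g (real j * (1 / 2 ^ l)) \<omega> \<in> heis_cball R) \<and> 0 \<odot> g (real 1 * 1) \<omega> \<in> UNIV}"
    show "(\<lambda>l. prob (?G l)) \<longlonglongrightarrow> surv R 1 0"
      using stay_grid_tendsto[of 1 "heis_cball R" UNIV 1 0] closed_heis_cball by (simp add: surv_def)
    show "\<exists>N. \<forall>l\<ge>N. 1 - K / R ^ 4 \<le> prob (?G l)"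
    proof (intro exI allI impI)
      fix l
      let ?c = "\<lambda>m. R * ((9 / 10) ^ m / 10)"
      let ?B = "\<lambda>m. \<Union>j\<in>{..<2 ^ m}. {\<omega> \<in> space M. ?c m < heis_norm (incr (1 / 2 ^ m) j \<omega>)}"
      have [measurable]: "heis_cball R \<in> sets borel" by (intro borel_closed closed_heis_cball)
      have Bm: "?B m \<in> events" for m by (intro sets.finite_UN) auto
      have PB: "prob (?B m) \<le> 320000 / R ^ 4 * x ^ m" for m
      proof -
        have "prob (?B m) \<le> (\<Sum>j\<in>{..<2 ^ m}. prob {\<omega> \<in> space M. ?c m < heis_norm (incr (1 / 2 ^ m) j \<omega>)})"
          by (intro measure_UNION_le) auto
        also have "\<dots> \<le> (\<Sum>j\<in>{..<(2::nat) ^ m}. 32 * (1 / 2 ^ m)\<^sup>2 / (?c m) ^ 4)"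
          using R by (intro sum_mono incr_tail) auto
        also have "\<dots> = 2 ^ m * (32 * (1 / 2 ^ m)\<^sup>2 / (?c m) ^ 4)" by simp
        also have "\<dots> = 320000 / R ^ 4 * x ^ m"
        proof -
          have "((9 / 10 :: real) ^ m) ^ 4 = ((9 / 10) ^ 4) ^ m" by (simp only: power_mult[symmetric] mult.commute)
          then have *: "((9 / 10 :: real) ^ m) ^ 4 = (6561 / 10000) ^ m" by (simp add: power_divide)
          define y :: real where "y = (6561 / 10000) ^ m"
          have y: "0 < y" by (simp add: y_def)
          have c4: "(?c m) ^ 4 = R ^ 4 * y / 10000" unfolding y_def by (simp only: power_mult_distrib power_divide[of "(9 / 10) ^ m" 10] *) simp
          have xm: "x ^ m = 1 / (2 ^ m * y)"
            unfolding x_def y_def by (simp flip: power_mult_distrib power_one_over)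
          show ?thesis unfolding c4 xm using R y by (simp add: power2_eq_square field_simps)
        qed
        finally show ?thesis .
      qed
      have sub: "space M - (\<Union>m\<in>{..l}. ?B m) \<subseteq> ?G l"
      proof
        fix \<omega> assume \<omega>: "\<omega> \<in> space M - (\<Union>m\<in>{..l}. ?B m)"
        have "heis_norm (g (real j * (1 / 2 ^ l)) \<omega>) \<le> R" if j: "j \<le> 2 ^ l" for j
        proof -
          have "heis_norm (incr (1 / 2 ^ m) i \<omega>) \<le> ?c m" if "m \<le> l" "i < 2 ^ m" for m i
            using \<omega> that by (force simp: not_less simp del: of_nat_Suc)
          then have "heis_norm (g (real j * (1 / 2 ^ l)) \<omega>) \<le> R * (\<Sum>m<Suc l. (9 / 10) ^ m / 10)"
            using \<omega> j R by (intro chaining_bound) auto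
          also have "(\<Sum>m<Suc l. (9 / 10 :: real) ^ m / 10) = 1 - (9 / 10) ^ Suc l"
            unfolding sum_divide_distrib[symmetric] sum_gp_strict by simp
          also have "R * (1 - (9 / 10) ^ Suc l) \<le> R" using R by (simp add: mult_left_le)
          finally show ?thesis .
        qed
        then show "\<omega> \<in> ?G l" using \<omega> by simp
      qed
      have "prob (\<Union>m\<in>{..l}. ?B m) \<le> (\<Sum>m\<in>{..l}. prob (?B m))" using Bm by (intro measure_UNION_le) auto
      also have "\<dots> \<le> (\<Sum>m\<in>{..l}. 320000 / R ^ 4 * x ^ m)" by (intro sum_mono PB)
      also have "\<dots> = 320000 / R ^ 4 * (\<Sum>m\<in>{..l}. x ^ m)" by (simp add: sum_distrib_left)
      also have "\<dots> \<le> 320000 / R ^ 4 * (1 / (1 - x))"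
      proof (rule mult_left_mono)
        show "(\<Sum>m\<in>{..l}. x ^ m) \<le> 1 / (1 - x)"
          using x sum_gp0[of x l] by (simp add: divide_right_mono)
      qed (use R in simp)
      also have "\<dots> = K / R ^ 4" by (simp add: K_def)
      finally have 1: "prob (\<Union>m\<in>{..l}. ?B m) \<le> K / R ^ 4" .
      have "1 - prob (\<Union>m\<in>{..l}. ?B m) = prob (space M - (\<Union>m\<in>{..l}. ?B m))"
        using Bm by (intro prob_compl[symmetric] sets.finite_UN) auto
      also have "\<dots> \<le> prob (?G l)" by (rule finite_measure_mono[OF sub]) measurable
      finally show "1 - K / R ^ 4 \<le> prob (?G l)" using 1 by simp
    qed
  qed
  then show ?thesis by blast
qed

subsection \<open>Small balls and Chung's law\<close>

definition rmax :: "real \<Rightarrow> 'a \<Rightarrow> real" where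
  "rmax t \<omega> = Sup ((\<lambda>s. heis_norm (g s \<omega>)) ` {0..t})"

lemma Sup_heis_norm_le_iff:
  fixes p :: "real \<Rightarrow> heis"
  assumes "continuous_on {0..} p" "0 \<le> t"
  shows "Sup ((\<lambda>s. heis_norm (p s)) ` {0..t}) \<le> \<rho> \<longleftrightarrow> (\<forall>s\<in>{0..t}. heis_norm (p s) \<le> \<rho>)"
proof -
  have "compact ((\<lambda>s. heis_norm (p s)) ` {0..t})"
    using assms by (intro compact_continuous_image continuous_intros continuous_on_subset[OF assms(1)]) auto
  then have "bdd_above ((\<lambda>s. heis_norm (p s)) ` {0..t})" by (intro bounded_imp_bdd_above compact_imp_bounded)
  then show ?thesis using assms by (subst cSUP_le_iff) auto
qed

lemma rmax_le_iff:
  assumes "\<omega> \<in> space M" "0 \<le> t"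
  shows "rmax t \<omega> \<le> \<rho> \<longleftrightarrow> \<omega> \<in> surv_event \<rho> t 0"
  using Sup_heis_norm_le_iff[OF g_cont[OF assms(1)] assms(2), of \<rho>] assms by (simp add: rmax_def surv_event_iff)

text \<open>The strict bound is a countable union of closed confinements with slack
  \<open>1 / (n + 1)\<close>. The path is arbitrary because the original area, not vanishing at time
  0 everywhere, needs the lemma too.\<close>

lemma events_running_max_less:
  fixes p :: "real \<Rightarrow> 'a \<Rightarrow> heis"
  assumes p: "\<And>\<omega>. \<omega> \<in> space M \<Longrightarrow> continuous_on {0..} (\<lambda>u. p u \<omega>)" and m: "\<And>u. p u \<in> borel_measurable M"
  shows "{\<omega> \<in> space M. Sup ((\<lambda>s. heis_norm (p s \<omega>)) ` {0..1}) < \<epsilon>} \<in> events"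
proof -
  let ?S = "\<lambda>\<omega>. Sup ((\<lambda>s. heis_norm (p s \<omega>)) ` {0..1})"
  let ?E = "\<lambda>n. {\<omega> \<in> space M. \<forall>u\<in>{0..real 1 * 1}. p u \<omega> \<in> heis_cball (\<epsilon> - 1 / real (Suc n))}"
  have E: "\<omega> \<in> ?E n \<longleftrightarrow> \<omega> \<in> space M \<and> ?S \<omega> \<le> \<epsilon> - 1 / real (Suc n)" for n \<omega>
    using Sup_heis_norm_le_iff[OF p, of \<omega> 1 "\<epsilon> - 1 / real (Suc n)"] by (auto simp del: of_nat_Suc)
  have "{\<omega> \<in> space M. ?S \<omega> < \<epsilon>} = (\<Union>n. ?E n)"
  proof (intro set_eqI iffI)
    fix \<omega> assume \<omega>: "\<omega> \<in> {\<omega> \<in> space M. ?S \<omega> < \<epsilon>}"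
    then obtain n where "1 / real (Suc n) < \<epsilon> - ?S \<omega>" using nat_approx_posE[of "\<epsilon> - ?S \<omega>"] by auto
    then have "\<omega> \<in> ?E n" unfolding E using \<omega> by auto
    then show "\<omega> \<in> (\<Union>n. ?E n)" by blast
  next
    fix \<omega> assume "\<omega> \<in> (\<Union>n. ?E n)"
    then obtain n where "\<omega> \<in> ?E n" by blast
    then have "\<omega> \<in> space M" "?S \<omega> \<le> \<epsilon> - 1 / real (Suc n)" unfolding E by auto
    moreover have "0 < 1 / real (Suc n)" by simp
    ultimately have "\<omega> \<in> space M" "?S \<omega> < \<epsilon>" by linarith+
    then show "\<omega> \<in> {\<omega> \<in> space M. ?S \<omega> < \<epsilon>}" by simp
  qed
  also have "\<dots> \<in> events"
    by (intro sets.countable_UN image_subsetI sets_stay[OF p closed_heis_cball] m) auto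
  finally show ?thesis .
qed

lemma rmax_mono:
  assumes "\<omega> \<in> space M" "0 \<le> s" "s \<le> t"
  shows "rmax s \<omega> \<le> rmax t \<omega>"
proof -
  have "\<omega> \<in> surv_event (rmax t \<omega>) t 0" using rmax_le_iff[of \<omega> t "rmax t \<omega>"] assms by simp
  then show ?thesis using assms by (subst rmax_le_iff) (auto simp: surv_event_iff)
qed

text \<open>Scaling turns radius \<open>\<epsilon>\<close> at time 1 into survival in the unit ball
  up to \<open>1 / \<epsilon>^2\<close>. The strict inequality is met from below by the radius
  \<open>\<theta> * \<epsilon>\<close> with \<open>\<theta> < 1\<close>.\<close>

lemma small_ball_limit:
  assumes L: "0 < L"
    and up: "\<And>\<mu>. 0 < \<mu> \<Longrightarrow> \<mu> < L \<Longrightarrow> \<forall>\<^sub>F T in at_top. surv 1 T 0 \<le> exp (- \<mu> * T)"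
    and low: "\<And>\<mu>. L < \<mu> \<Longrightarrow> \<forall>\<^sub>F T in at_top. exp (- \<mu> * T) \<le> surv 1 T 0"
  shows "((\<lambda>\<epsilon>. - (\<epsilon>\<^sup>2) * ln (prob {\<omega> \<in> space M. rmax 1 \<omega> < \<epsilon>})) \<longlongrightarrow> L) (at_right 0)"
proof -
  let ?P = "\<lambda>\<epsilon>. prob {\<omega> \<in> space M. rmax 1 \<omega> < \<epsilon>}"
  have lim: "filterlim (\<lambda>\<epsilon>::real. 1 / (\<theta> * \<epsilon>)\<^sup>2) at_top (at_right 0)" if "0 < \<theta>" for \<theta> :: real
  proof -
    have "filterlim (\<lambda>\<epsilon>::real. (1 / \<theta>\<^sup>2) * (inverse \<epsilon>) ^ 2) at_top (at_right 0)"
      using that by (intro filterlim_tendsto_pos_mult_at_top[OF tendsto_const] filterlim_pow_at_top filterlim_inverse_at_top_right) auto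
    moreover have "1 / (\<theta> * \<epsilon>)\<^sup>2 = (1 / \<theta>\<^sup>2) * (inverse \<epsilon>) ^ 2" for \<epsilon> :: real
      by (simp add: power_mult_distrib divide_inverse power_inverse)
    ultimately show ?thesis by simp
  qed
  have PU: "?P \<epsilon> \<le> surv 1 (1 / (1 * \<epsilon>)\<^sup>2) 0" if "0 < \<epsilon>" for \<epsilon>
  proof -
    have "?P \<epsilon> \<le> prob (surv_event \<epsilon> 1 0)"
    proof (intro finite_measure_mono surv_event_events)
      show "{\<omega> \<in> space M. rmax 1 \<omega> < \<epsilon>} \<subseteq> surv_event \<epsilon> 1 0"
        using rmax_le_iff[of _ 1 \<epsilon>] by (auto intro: less_imp_le)
    qed simp
    then show ?thesis using surv_0_scaling[of \<epsilon> 1] that by (simp add: surv_eq)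
  qed
  have meas: "{\<omega> \<in> space M. rmax 1 \<omega> < \<epsilon>} \<in> events" for \<epsilon>
    unfolding rmax_def by (intro events_running_max_less g_cont) auto
  have PL: "surv 1 (1 / (\<theta> * \<epsilon>)\<^sup>2) 0 \<le> ?P \<epsilon>" if "0 < \<epsilon>" "0 < \<theta>" "\<theta> < 1" for \<epsilon> \<theta>
  proof -
    have "surv 1 (1 / (\<theta> * \<epsilon>)\<^sup>2) 0 = prob (surv_event (\<theta> * \<epsilon>) 1 0)" using surv_0_scaling[of "\<theta> * \<epsilon>" 1] that by (simp add: surv_eq)
    also have "\<dots> \<le> ?P \<epsilon>"
    proof (intro finite_measure_mono meas subsetI)
      fix \<omega> assume \<omega>: "\<omega> \<in> surv_event (\<theta> * \<epsilon>) 1 0"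
      then have sp: "\<omega> \<in> space M" by (simp add: surv_event_iff)
      then have "rmax 1 \<omega> \<le> \<theta> * \<epsilon>" using \<omega> by (subst rmax_le_iff) auto
      also have "\<dots> < \<epsilon>" using that by simp
      finally show "\<omega> \<in> {\<omega> \<in> space M. rmax 1 \<omega> < \<epsilon>}" using sp by simp
    qed
    finally show ?thesis .
  qed
  have upper: "\<forall>\<^sub>F \<epsilon> in at_right 0. 0 < ?P \<epsilon> \<and> - (\<epsilon>\<^sup>2) * ln (?P \<epsilon>) < b" if b: "L < b" for b
  proof -
    define \<mu> where "\<mu> = (L + b) / 2"
    \<comment> \<open>Close enough to 1 that the loss \<open>1 / \<theta>^2\<close> in the rate
      still leaves \<open>\<mu> / \<theta>^2 < b\<close>.\<close>
    define \<theta> where "\<theta> = sqrt ((\<mu> + b) / (2 * b))"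
    have \<mu>: "L < \<mu>" "\<mu> < b" using b by (auto simp: \<mu>_def)
    have arg: "0 < (\<mu> + b) / (2 * b)" "(\<mu> + b) / (2 * b) < 1" using \<mu> L b by (auto simp: field_simps)
    have \<theta>: "0 < \<theta>" "\<theta> < 1" "\<theta>\<^sup>2 = (\<mu> + b) / (2 * b)" using arg by (auto simp: \<theta>_def real_sqrt_lt_1_iff)
    have lt: "\<mu> / \<theta>\<^sup>2 < b" using \<mu> L unfolding \<theta>(3) by (simp add: field_simps)
    have ev: "\<forall>\<^sub>F \<epsilon> in at_right 0. exp (- \<mu> * (1 / (\<theta> * \<epsilon>)\<^sup>2)) \<le> surv 1 (1 / (\<theta> * \<epsilon>)\<^sup>2) 0"
      by (rule eventually_compose_filterlim[OF low[OF \<mu>(1)] lim[OF \<theta>(1)]])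
    show ?thesis
      using ev eventually_at_right_less[of 0]
    proof eventually_elim
      fix \<epsilon> :: real assume *: "exp (- \<mu> * (1 / (\<theta> * \<epsilon>)\<^sup>2)) \<le> surv 1 (1 / (\<theta> * \<epsilon>)\<^sup>2) 0" and \<epsilon>: "0 < \<epsilon>"
      have P: "exp (- \<mu> * (1 / (\<theta> * \<epsilon>)\<^sup>2)) \<le> ?P \<epsilon>" using PL[OF \<epsilon> \<theta>(1,2)] * by linarith
      have pos: "0 < ?P \<epsilon>" using P exp_gt_zero less_le_trans by blast
      have "- \<mu> * (1 / (\<theta> * \<epsilon>)\<^sup>2) \<le> ln (?P \<epsilon>)" using P pos by (subst ln_ge_iff) auto
      then have "\<epsilon>\<^sup>2 * (- ln (?P \<epsilon>)) \<le> \<epsilon>\<^sup>2 * (\<mu> * (1 / (\<theta> * \<epsilon>)\<^sup>2))" by (intro mult_left_mono) auto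
      also have "\<dots> = \<mu> / \<theta>\<^sup>2" using \<epsilon> by (simp add: power_mult_distrib)
      finally show "0 < ?P \<epsilon> \<and> - (\<epsilon>\<^sup>2) * ln (?P \<epsilon>) < b" using lt pos by simp
    qed
  qed
  show ?thesis
  proof (rule order_tendstoI)
    fix a assume a: "a < L"
    define \<mu> where "\<mu> = (max a 0 + L) / 2"
    have \<mu>: "0 < \<mu>" "\<mu> < L" "a < \<mu>" using a L by (auto simp: \<mu>_def)
    have ev: "\<forall>\<^sub>F \<epsilon> in at_right 0. surv 1 (1 / (1 * \<epsilon>)\<^sup>2) 0 \<le> exp (- \<mu> * (1 / (1 * \<epsilon>)\<^sup>2))"
      by (rule eventually_compose_filterlim[OF up[OF \<mu>(1,2)] lim]) simp
    \<comment> \<open>Monotonicity of \<open>ln\<close> needs a positive probability, which the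
      other half provides.\<close>
    have pos: "\<forall>\<^sub>F \<epsilon> in at_right 0. 0 < ?P \<epsilon> \<and> - (\<epsilon>\<^sup>2) * ln (?P \<epsilon>) < L + 1" by (rule upper) simp
    show "\<forall>\<^sub>F \<epsilon> in at_right 0. a < - (\<epsilon>\<^sup>2) * ln (?P \<epsilon>)"
      using ev pos eventually_at_right_less[of 0]
    proof eventually_elim
      fix \<epsilon> :: real assume *: "surv 1 (1 / (1 * \<epsilon>)\<^sup>2) 0 \<le> exp (- \<mu> * (1 / (1 * \<epsilon>)\<^sup>2))" and \<epsilon>: "0 < \<epsilon>"
        and pos: "0 < ?P \<epsilon> \<and> - (\<epsilon>\<^sup>2) * ln (?P \<epsilon>) < L + 1"
      have "?P \<epsilon> \<le> exp (- \<mu> * (1 / (1 * \<epsilon>)\<^sup>2))" using PU[OF \<epsilon>] * by linarith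
      then have "ln (?P \<epsilon>) \<le> - \<mu> * (1 / \<epsilon>\<^sup>2)" using pos by (simp add: ln_le_cancel_iff[symmetric, of _ "exp _"])
      then have "\<epsilon>\<^sup>2 * (\<mu> * (1 / \<epsilon>\<^sup>2)) \<le> \<epsilon>\<^sup>2 * (- ln (?P \<epsilon>))" by (intro mult_left_mono) auto
      then show "a < - (\<epsilon>\<^sup>2) * ln (?P \<epsilon>)" using \<epsilon> \<mu>(3) by simp
    qed
  next
    fix b assume "L < b"
    then show "\<forall>\<^sub>F \<epsilon> in at_right 0. - (\<epsilon>\<^sup>2) * ln (?P \<epsilon>) < b" using upper[of b] by (auto elim: eventually_mono)
  qed
qed

end

section \<open>Growth of the logarithms of \<open>(n!)^2\<close>\<close>

lemma ln_fact_square_le: "1 \<le> n \<Longrightarrow> ln (real ((fact n)\<^sup>2)) \<le> 2 * real n * ln (real n)"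
proof -
  assume n: "1 \<le> n"
  have "real (fact n) \<le> real n ^ n" using fact_le_power[of n, where 'a=real] by simp
  then have "ln (real (fact n)) \<le> ln (real n ^ n)" using n by (subst ln_le_cancel_iff) auto
  then have "ln (real (fact n)) \<le> real n * ln (real n)" using n by (simp add: ln_realpow)
  moreover have "ln (real ((fact n)\<^sup>2)) = 2 * ln (real (fact n))"
    using ln_realpow[of "real (fact n)" 2] by simp
  ultimately show ?thesis by simp
qed

lemma ln_ln_fact_square_le:
  assumes n: "1 \<le> n" and pos: "1 < ln (real ((fact n)\<^sup>2))"
  shows "ln (ln (real ((fact n)\<^sup>2))) \<le> 3 * real n"
proof -
  define y where "y = ln (real ((fact n)\<^sup>2))"
  have y1: "1 < y" using pos by (simp only: y_def)
  have "ln (real n) \<le> real n" using n ln_le_minus_one[of "real n"] by simp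
  then have "y \<le> 2 * real n * real n" using ln_fact_square_le[OF n, folded y_def] mult_left_mono[of "ln (real n)" "real n" "2 * real n"] by linarith
  also have "\<dots> \<le> (3 / 2 * real n)\<^sup>2" by (simp add: power2_eq_square)
  finally have y: "y \<le> (3 / 2 * real n)\<^sup>2" .
  \<comment> \<open>Passing to the square root before \<open>ln z \<le> z\<close> turns the
    quadratic bound on \<open>y\<close> into a linear one.\<close>
  have "ln y = 2 * ln (sqrt y)" using y1 by (simp add: ln_sqrt)
  also have "\<dots> \<le> 2 * sqrt y" using ln_le_minus_one[of "sqrt y"] y1 by simp
  also have "sqrt y \<le> 3 / 2 * real n" using y y1 by (intro real_le_lsqrt) auto
  finally show ?thesis by (simp add: y_def)
qed

text \<open>\<open>ln ((n!)^2) \<le> 2 n ln n\<close> grows slower than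
  \<open>n powr (1 / s)\<close> because \<open>1 / s > 1\<close>. This yields the divergent series
  of block probabilities.\<close>

lemma fact_square_powr_bound:
  assumes s: "0 < s" "s < 1"
  shows "\<forall>\<^sub>F n in sequentially. 1 / real n \<le> ln (real ((fact n)\<^sup>2)) powr (- s)"
proof -
  define \<delta> where "\<delta> = 1 / s - 1"
  have \<delta>: "0 < \<delta>" using s by (simp add: \<delta>_def field_simps)
  have "(\<lambda>n. ln (real n) / real n powr \<delta>) \<longlonglongrightarrow> 0" using lim_ln_over_power[OF \<delta>] .
  then have "\<forall>\<^sub>F n in sequentially. ln (real n) / real n powr \<delta> < 1 / 2" by (rule order_tendstoD) simp
  then show ?thesis
    using eventually_ge_at_top[of 2]
  proof eventually_elim
    fix n :: nat assume *: "ln (real n) / real n powr \<delta> < 1 / 2" and n: "2 \<le> n"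
    have "2 * ln (real n) \<le> real n powr \<delta>" using * n by (simp add: field_simps)
    then have "real n * (2 * ln (real n)) \<le> real n * real n powr \<delta>" by (intro mult_left_mono) auto
    also have "real n * real n powr \<delta> = real n powr (1 / s)" using n by (simp add: \<delta>_def powr_diff)
    finally have y: "ln (real ((fact n)\<^sup>2)) \<le> real n powr (1 / s)" using ln_fact_square_le[of n] n by (simp add: mult.assoc mult.left_commute)
    have "2 \<le> (fact n :: nat)" using n fact_mono_nat[of 2 n] by (simp add: fact_2)
    then have "1 < (fact n :: nat)\<^sup>2" using power_mono[of 2 "fact n :: nat" 2] by simp
    then have "1 < real ((fact n)\<^sup>2)" by (metis of_nat_1 of_nat_less_iff)
    then have ypos: "0 < ln (real ((fact n)\<^sup>2))" by simp
    have "1 / real n = (real n powr (1 / s)) powr (- s)" using n s by (simp add: powr_powr powr_minus_divide)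
    also have "\<dots> \<le> ln (real ((fact n)\<^sup>2)) powr (- s)" using y ypos s by (intro powr_mono2') auto
    finally show "1 / real n \<le> ln (real ((fact n)\<^sup>2)) powr (- s)" .
  qed
qed

lemma exp_ln_ln: "1 < (t::real) \<Longrightarrow> exp (- \<mu> * (ln (ln t) / d)) = ln t powr (- (\<mu> / d))"
proof -
  assume "1 < t"
  then have "ln t \<noteq> 0" using ln_gt_zero[of t] by simp
  moreover have "- \<mu> * (x / d) = - (\<mu> / d) * x" for x by simp
  ultimately show ?thesis by (simp only: powr_def if_False)
qed

section \<open>The two halves of Chung's law\<close>

context heis_bm
begin

text \<open>A maximum below \<open>a\<close> times the scale at time \<open>r^k\<close> has
  probability at most of order \<open>k powr (- s)\<close> with \<open>s > 1\<close>. Monotonicity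
  fills the gaps between the times \<open>r^k\<close>, where the normalisation loses at most
  \<open>sqrt r\<close>.\<close>

lemma AE_eventually_rmax_ge:
  assumes L: "0 < L"
    and up: "\<And>\<mu>. 0 < \<mu> \<Longrightarrow> \<mu> < L \<Longrightarrow> \<forall>\<^sub>F T in at_top. surv 1 T 0 \<le> exp (- \<mu> * T)"
    and b: "0 < b" "b < sqrt L"
  shows "AE \<omega> in M. \<forall>\<^sub>F t in at_top. b \<le> sqrt (ln (ln t) / t) * rmax t \<omega>"
proof -
  define a where "a = (b + sqrt L) / 2"
  have a: "b < a" "a < sqrt L" "0 < a" using b by (auto simp: a_def)
  have a2: "a\<^sup>2 < L" using a L by (metis less_eq_real_def power2_less_imp_less real_sqrt_ge_0_iff real_sqrt_pow2 power_strict_mono zero_less_numeral)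
  define \<mu> where "\<mu> = (a\<^sup>2 + L) / 2"
  have \<mu>: "a\<^sup>2 < \<mu>" "\<mu> < L" "0 < \<mu>" using a2 a L by (auto simp: \<mu>_def intro!: add_nonneg_pos)
  define s where "s = \<mu> / a\<^sup>2"
  have s: "1 < s" using \<mu> a by (simp add: s_def)
  \<comment> \<open>The loss \<open>sqrt r\<close> between consecutive times lowers \<open>a\<close>
    exactly to \<open>b\<close>.\<close>
  define r where "r = (a / b)\<^sup>2"
  have r: "1 < r" using a b by (simp add: r_def)
  have lr: "0 < ln r" using r by simp
  define E where "E k = surv_event (a * sqrt (r ^ k / ln (ln (r ^ k)))) (r ^ k) 0" for k
  have E: "E k \<in> events" for k unfolding E_def using r by (intro surv_event_events) simp
  have lnk: "ln (r ^ k) = real k * ln r" for k using r by (simp add: ln_realpow)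
  have lim1: "filterlim (\<lambda>k. real k * ln r) at_top sequentially"
    using lr by (intro filterlim_at_top_mult_tendsto_pos[OF tendsto_const] filterlim_real_sequentially) auto
  then have lim2: "filterlim (\<lambda>k. ln (ln (r ^ k))) at_top sequentially"
    unfolding lnk by (rule filterlim_compose[OF ln_at_top])
  have lim3: "filterlim (\<lambda>k. ln (ln (r ^ k)) / a\<^sup>2) at_top sequentially"
    using filterlim_at_top_mult_tendsto_pos[OF tendsto_const[of "1 / a\<^sup>2"] _ lim2] a by simp
  have ev1: "\<forall>\<^sub>F k in sequentially. 0 < ln (ln (r ^ k))" using lim2 by (simp add: filterlim_at_top_dense)
  have ev2: "\<forall>\<^sub>F k in sequentially. 1 < real k * ln r" using lim1 by (simp add: filterlim_at_top_dense)
  have ev3: "\<forall>\<^sub>F k in sequentially. surv 1 (ln (ln (r ^ k)) / a\<^sup>2) 0 \<le> exp (- \<mu> * (ln (ln (r ^ k)) / a\<^sup>2))"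
    by (rule eventually_compose_filterlim[OF up[OF \<mu>(3,2)] lim3])
  have "\<forall>\<^sub>F k in sequentially. norm (prob (E k)) \<le> ln r powr (- s) * real k powr (- s)"
    using ev1 ev2 ev3
  proof eventually_elim
    fix k assume *: "0 < ln (ln (r ^ k))" "1 < real k * ln r" "surv 1 (ln (ln (r ^ k)) / a\<^sup>2) 0 \<le> exp (- \<mu> * (ln (ln (r ^ k)) / a\<^sup>2))"
    have "k \<noteq> 0" using *(2) by (intro notI) simp
    then have rk: "1 < r ^ k" using r by simp
    let ?R = "a * sqrt (r ^ k / ln (ln (r ^ k)))"
    have R: "0 < ?R" using a r * by simp
    have R2: "?R\<^sup>2 = a\<^sup>2 * (r ^ k / ln (ln (r ^ k)))" using * r by (simp add: power_mult_distrib)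
    have "r ^ k / ?R\<^sup>2 = ln (ln (r ^ k)) / a\<^sup>2" unfolding R2 using r * a by simp
    then have "prob (E k) = surv 1 (ln (ln (r ^ k)) / a\<^sup>2) 0"
      unfolding E_def using surv_0_scaling[OF R, of "r ^ k"] r by (simp add: surv_eq)
    also have "\<dots> \<le> ln (r ^ k) powr (- s)"
      using *(3) exp_ln_ln[OF rk, of \<mu> "a\<^sup>2"] by (simp add: s_def)
    also have "\<dots> = ln r powr (- s) * real k powr (- s)" unfolding lnk using lr by (simp add: powr_mult mult.commute)
    finally show "norm (prob (E k)) \<le> ln r powr (- s) * real k powr (- s)" by simp
  qed
  moreover have "summable (\<lambda>k. ln r powr (- s) * real k powr (- s))"
    using s by (intro summable_mult) (simp add: summable_real_powr_iff)
  ultimately have "summable (\<lambda>k. prob (E k))" by (rule summable_comparison_test_ev)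
  then have "AE \<omega> in M. \<forall>\<^sub>F k in sequentially. \<omega> \<in> space M - E k"
    using E by (intro borel_cantelli_AE1) (auto simp: less_top[symmetric])
  then show ?thesis
  proof (rule AE_mp, intro AE_I2 impI)
    fix \<omega> assume sp: "\<omega> \<in> space M" and out: "\<forall>\<^sub>F k in sequentially. \<omega> \<in> space M - E k"
    from ev1 out have "\<forall>\<^sub>F k in sequentially. 0 < ln (ln (r ^ k)) \<and> \<omega> \<notin> E k" by eventually_elim simp
    then obtain k0 where k0: "\<And>k. k0 \<le> k \<Longrightarrow> 0 < ln (ln (r ^ k)) \<and> \<omega> \<notin> E k" by (auto simp: eventually_sequentially)
    show "\<forall>\<^sub>F t in at_top. b \<le> sqrt (ln (ln t) / t) * rmax t \<omega>"
      using eventually_ge_at_top[of "r ^ Suc k0"]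
    proof eventually_elim
      fix t assume t: "r ^ Suc k0 \<le> t"
      obtain m where "t < r ^ m" using real_arch_pow[OF r] by blast
      then have ex: "\<exists>m. t < r ^ m" by blast
      \<comment> \<open>Gives consecutive powers with
        \<open>r^k \<le> t < r^(k + 1)\<close>.\<close>
      define m where "m = (LEAST m. t < r ^ m)"
      have m: "t < r ^ m" unfolding m_def using ex by (rule LeastI_ex)
      have "Suc k0 < m"
      proof (rule ccontr)
        assume "\<not> Suc k0 < m"
        then have "r ^ m \<le> r ^ Suc k0" using r by (intro power_increasing) auto
        then show False using t m by linarith
      qed
      define k where "k = m - 1"
      have k: "m = Suc k" "k0 \<le> k" using \<open>Suc k0 < m\<close> by (auto simp: k_def)
      have "\<not> t < r ^ k" using not_less_Least[of k "\<lambda>m. t < r ^ m"] k by (simp add: m_def)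
      then have rt: "r ^ k \<le> t" by simp
      have tr: "t \<le> r * r ^ k" using m k by simp
      have ll: "0 < ln (ln (r ^ k))" and nE: "\<omega> \<notin> E k" using k0[OF k(2)] by auto
      have rk0: "0 < r ^ k" using r by simp
      have tpos: "0 < t" using rk0 rt by linarith
      have "k \<noteq> 0" using ll by (intro notI) simp
      then have "1 < r ^ k" using r by (intro one_less_power) auto
      then have lk: "0 < ln (r ^ k)" by (rule ln_gt_zero)
      have mono: "ln (ln (r ^ k)) \<le> ln (ln t)"
      proof -
        have le: "ln (r ^ k) \<le> ln t" using rk0 rt by (subst ln_le_cancel_iff) auto
        then show ?thesis using lk by (subst ln_le_cancel_iff) auto
      qed
      have "a * sqrt (r ^ k / ln (ln (r ^ k))) \<le> rmax (r ^ k) \<omega>"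
        using nE rmax_le_iff[OF sp, of "r ^ k" "a * sqrt (r ^ k / ln (ln (r ^ k)))"] rk0 by (auto simp: E_def)
      also have "\<dots> \<le> rmax t \<omega>" using rk0 rt by (intro rmax_mono sp) auto
      finally have 1: "a * sqrt (r ^ k / ln (ln (r ^ k))) \<le> rmax t \<omega>" .
      have 2: "sqrt (ln (ln (r ^ k)) / (r * r ^ k)) \<le> sqrt (ln (ln t) / t)"
        using mono ll tr tpos by (intro real_sqrt_le_mono frac_le) auto
      have "sqrt (ln (ln (r ^ k)) / (r * r ^ k)) * (a * sqrt (r ^ k / ln (ln (r ^ k)))) \<le> sqrt (ln (ln t) / t) * rmax t \<omega>"
        using 1 2 ll rk0 a tpos mono by (intro mult_mono) auto
      moreover have "sqrt (ln (ln (r ^ k)) / (r * r ^ k)) * (a * sqrt (r ^ k / ln (ln (r ^ k)))) = b"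
      proof -
        have "sqrt (ln (ln (r ^ k)) / (r * r ^ k)) * (a * sqrt (r ^ k / ln (ln (r ^ k)))) = a * sqrt ((ln (ln (r ^ k)) / (r * r ^ k)) * (r ^ k / ln (ln (r ^ k))))"
          by (simp only: real_sqrt_mult mult_ac)
        also have "(ln (ln (r ^ k)) / (r * r ^ k)) * (r ^ k / ln (ln (r ^ k))) = (b / a)\<^sup>2"
          using ll rk0 a b by (simp add: r_def power_divide)
        finally show ?thesis using a b by simp
      qed
      ultimately show "b \<le> sqrt (ln (ln t) / t) * rmax t \<omega>" by simp
    qed
  qed
qed

text \<open>The increments after \<open>\<tau> k\<close> stay within \<open>a * \<rho> k\<close>
  infinitely often, and the path before \<open>\<tau> k\<close> eventually stays within
  \<open>\<eta> * \<rho> k\<close>. Subadditivity adds the two radii to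
  \<open>b * \<rho> k\<close>.\<close>

lemma AE_frequently_rmax_le:
  assumes L: "0 < L"
    and low: "\<And>\<mu>. L < \<mu> \<Longrightarrow> \<forall>\<^sub>F T in at_top. exp (- \<mu> * T) \<le> surv 1 T 0"
    and b: "sqrt L < b"
  shows "AE \<omega> in M. \<exists>\<^sub>F t in at_top. sqrt (ln (ln t) / t) * rmax t \<omega> \<le> b"
proof -
  define a where "a = (b + sqrt L) / 2"
  have sL: "0 < sqrt L" using L by simp
  have a: "sqrt L < a" "a < b" using b by (auto simp: a_def)
  then have a0: "0 < a" using sL by linarith
  note a = a a0
  have a2: "L < a\<^sup>2" using power_strict_mono[OF a(1), of 2] L by simp
  define \<mu> where "\<mu> = (L + a\<^sup>2) / 2"
  have \<mu>: "L < \<mu>" "\<mu> < a\<^sup>2" using a2 by (auto simp: \<mu>_def)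
  define s where "s = \<mu> / a\<^sup>2"
  have s: "0 < s" "s < 1" using \<mu> a L by (auto simp: s_def)
  define \<eta> where "\<eta> = b - a"
  have \<eta>: "0 < \<eta>" using a by (simp add: \<eta>_def)
  define \<tau> :: "nat \<Rightarrow> nat" where "\<tau> k = (fact k)\<^sup>2" for k
  define ll where "ll k = ln (ln (real (\<tau> (Suc k))))" for k
  define \<rho> where "\<rho> k = sqrt (real (\<tau> (Suc k)) / ll k)" for k
  have \<tau>_pos: "0 < real (\<tau> k)" for k by (simp add: \<tau>_def)
  have \<tau>_Suc: "real (\<tau> (Suc k)) = (real (Suc k))\<^sup>2 * real (\<tau> k)" for k
  proof -
    have "(fact (Suc k) :: nat)\<^sup>2 = (Suc k)\<^sup>2 * (fact k)\<^sup>2" by (simp only: fact_Suc of_nat_id power_mult_distrib)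
    then show ?thesis by (simp only: \<tau>_def of_nat_mult of_nat_power)
  qed
  have \<tau>_le: "\<tau> k \<le> \<tau> (Suc k)" for k unfolding \<tau>_def by (intro power_mono fact_mono) auto
  have \<tau>_ge: "real k \<le> real (\<tau> k)" for k
  proof -
    have "k \<le> fact k" by (rule fact_ge_self)
    also have "fact k \<le> (fact k :: nat)\<^sup>2" by (simp add: power2_eq_square)
    finally have "k \<le> \<tau> k" by (simp only: \<tau>_def)
    then show ?thesis by (simp only: of_nat_le_iff)
  qed
  have lim0: "filterlim (\<lambda>k. real (\<tau> (Suc k))) at_top sequentially"
  proof (rule filterlim_at_top_mono[OF filterlim_real_sequentially])
    have "real k \<le> real (\<tau> (Suc k))" for k using \<tau>_ge[of "Suc k"] by simp
    then show "\<forall>\<^sub>F k in sequentially. real k \<le> real (\<tau> (Suc k))" by simp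
  qed
  then have lim1: "filterlim (\<lambda>k. ln (real (\<tau> (Suc k)))) at_top sequentially" by (rule filterlim_compose[OF ln_at_top])
  then have lim2: "filterlim ll at_top sequentially" unfolding ll_def by (rule filterlim_compose[OF ln_at_top])
  have lim3: "filterlim (\<lambda>k. ll k / a\<^sup>2) at_top sequentially"
    using filterlim_at_top_mult_tendsto_pos[OF tendsto_const[of "1 / a\<^sup>2"] _ lim2] a by simp
  have ev1: "\<forall>\<^sub>F k in sequentially. 1 < ln (real (\<tau> (Suc k)))" using lim1 by (simp add: filterlim_at_top_dense)
  have ev2: "\<forall>\<^sub>F k in sequentially. exp (- \<mu> * (ll k / a\<^sup>2)) \<le> surv 1 (ll k / a\<^sup>2) 0"
    by (rule eventually_compose_filterlim[OF low[OF \<mu>(1)] lim3])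
  have ev3: "\<forall>\<^sub>F k in sequentially. 1 / real (Suc k) \<le> ln (real (\<tau> (Suc k))) powr (- s)"
    using fact_square_powr_bound[OF s] unfolding \<tau>_def by (rule eventually_compose_filterlim[OF _ filterlim_Suc])
  obtain k0 where k0: "\<And>k. k0 \<le> k \<Longrightarrow> 1 < ln (real (\<tau> (Suc k)))"
      "\<And>k. k0 \<le> k \<Longrightarrow> exp (- \<mu> * (ll k / a\<^sup>2)) \<le> surv 1 (ll k / a\<^sup>2) 0"
      "\<And>k. k0 \<le> k \<Longrightarrow> 1 / real (Suc k) \<le> ln (real (\<tau> (Suc k))) powr (- s)"
    using eventually_conj[OF ev1 eventually_conj[OF ev2 ev3]] by (auto simp: eventually_sequentially)
  have ll_pos: "0 < ll k" if "k0 \<le> k" for k using k0(1)[OF that] by (simp add: ll_def)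
  have \<rho>_pos: "0 < \<rho> k" if "k0 \<le> k" for k using ll_pos[OF that] \<tau>_pos[of "Suc k"] by (simp add: \<rho>_def)
  have \<rho>2: "(\<rho> k)\<^sup>2 = real (\<tau> (Suc k)) / ll k" if "k0 \<le> k" for k using ll_pos[OF that] by (simp add: \<rho>_def)

  define B where "B k = fut_event (heis_cball (a * \<rho> k)) UNIV (real (\<tau> k) * 1) (real (\<tau> (Suc k) - \<tau> k) * 1) (\<lambda>_. 0)" for k
  have B_filt: "B k \<in> sets (filt 1 (\<tau> (Suc k)))" for k
    using fut_event_filt[of 1 "heis_cball (a * \<rho> k)" UNIV "\<tau> k" "\<tau> (Suc k) - \<tau> k" 0] \<tau>_le[of k] closed_heis_cball by (simp add: B_def)
  have B_ge: "1 / real (Suc k) \<le> surv (a * \<rho> k) (real (\<tau> (Suc k) - \<tau> k)) 0" if k: "k0 \<le> k" for k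
  proof -
    have \<tau>1: "1 < real (\<tau> (Suc k))"
      using k0(1)[OF k] \<tau>_pos[of "Suc k"] by (metis less_trans ln_gt_zero_iff zero_less_one)
    have "1 / real (Suc k) \<le> exp (- \<mu> * (ll k / a\<^sup>2))"
      using k0(3)[OF k] exp_ln_ln[OF \<tau>1, of \<mu> "a\<^sup>2"] by (simp only: ll_def s_def)
    also have "\<dots> \<le> surv 1 (ll k / a\<^sup>2) 0" by (rule k0(2)[OF k])
    also have "ll k / a\<^sup>2 = real (\<tau> (Suc k)) / (a * \<rho> k)\<^sup>2"
      using ll_pos[OF k] \<tau>_pos[of "Suc k"] by (simp add: power_mult_distrib \<rho>2[OF k])
    also have "surv 1 \<dots> 0 = surv (a * \<rho> k) (real (\<tau> (Suc k))) 0"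
      using \<rho>_pos[OF k] a \<tau>_pos[of "Suc k"] by (intro surv_0_scaling[symmetric]) auto
    also have "\<dots> \<le> surv (a * \<rho> k) (real (\<tau> (Suc k) - \<tau> k)) 0" by (intro surv_antimono) auto
    finally show ?thesis .
  qed
  \<comment> \<open>Instead of a second Borel--Cantelli lemma, the Markov property bounds the
    probability that all blocks fail by the telescoping product of \<open>1 - 1 / (k + 1)\<close>,
    which tends to 0.\<close>
  have io: "AE \<omega> in M. \<exists>k\<ge>k1. \<omega> \<in> B k" if k1: "k0 \<le> k1" "0 < k1" for k1
  proof -
    define G where "G j = (\<Inter>i\<in>{..<j}. space M - B (k1 + i)) \<inter> space M" for j
    have G: "G j \<in> sets (filt 1 (\<tau> (k1 + j))) \<and> prob (G j) \<le> real k1 / real (k1 + j)" for j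
    proof (induction j)
      case 0
      have "space M \<in> sets (filt 1 (\<tau> k1))" using sets.top[of "filt 1 (\<tau> k1)"] by simp
      then show ?case using k1 by (simp add: G_def prob_space)
    next
      case (Suc j)
      let ?k = "k1 + j"
      have eq: "G (Suc j) = G j - B ?k" by (auto simp: G_def lessThan_Suc)
      have Gf: "G j \<in> sets (filt 1 (\<tau> ?k))" using Suc.IH by simp
      have f1: "G j \<in> sets (filt 1 (\<tau> (Suc ?k)))" using Suc.IH filt_mono[OF \<tau>_le[of ?k], of 1] by blast
      have f2: "G (Suc j) \<in> sets (filt 1 (\<tau> (k1 + Suc j)))" unfolding eq using f1 B_filt[of ?k] by simp
      have GE: "G j \<in> events" "B ?k \<in> events" using Gf B_filt filt_subset by blast+
      have "prob (G j \<inter> B ?k) = prob (G j) * surv (a * \<rho> ?k) (real (\<tau> (Suc ?k) - \<tau> ?k)) 0"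
        using markov_const[OF _ Gf closed_heis_cball, of UNIV "a * \<rho> ?k" "\<tau> (Suc ?k) - \<tau> ?k" 0] by (simp add: B_def surv_def)
      moreover have "prob (G j - B ?k) = prob (G j) - prob (G j \<inter> B ?k)" using GE by (intro finite_measure_Diff') auto
      moreover have "prob (G j) * (1 / real (Suc ?k)) \<le> prob (G j) * surv (a * \<rho> ?k) (real (\<tau> (Suc ?k) - \<tau> ?k)) 0"
        using B_ge[of ?k] k1 by (intro mult_left_mono) auto
      ultimately have "prob (G (Suc j)) \<le> prob (G j) * (1 - 1 / real (Suc ?k))" unfolding eq by (simp add: algebra_simps)
      also have "\<dots> \<le> real k1 / real ?k * (1 - 1 / real (Suc ?k))" using Suc.IH by (intro mult_right_mono) auto
      also have "\<dots> = real k1 / real (k1 + Suc j)"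
      proof -
        define x where "x = real ?k"
        have x: "0 < x" "real (Suc ?k) = x + 1" "real (k1 + Suc j) = x + 1" using k1 by (auto simp: x_def)
        have "1 - 1 / (x + 1) = x / (x + 1)" using x(1) by (simp add: field_simps)
        then show ?thesis unfolding x x_def[symmetric] using x(1) by simp
      qed
      finally show ?case using f2 by simp
    qed
    have "(\<Inter>j. G j) \<in> null_sets M"
    proof -
      have GE: "G j \<in> events" for j using G[of j] filt_subset by blast
      have "prob (\<Inter>j. G j) \<le> real k1 / real (k1 + j)" for j
        using G[of j] finite_measure_mono[of "\<Inter>j. G j" "G j"] GE[of j] by (meson INT_lower UNIV_I order_trans)
      moreover have "(\<lambda>j. real k1 / real (k1 + j)) \<longlonglongrightarrow> 0"
        by (intro tendsto_divide_0[OF tendsto_const] filterlim_at_top_imp_at_infinity filterlim_compose[OF filterlim_real_sequentially])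
           (auto intro: filterlim_at_top_mono[OF filterlim_ident])
      ultimately have "prob (\<Inter>j. G j) \<le> 0" by (intro LIMSEQ_le_const) auto
      then have "prob (\<Inter>j. G j) = 0" by (simp add: antisym)
      moreover have "(\<Inter>j. G j) \<in> events" using GE by auto
      ultimately show ?thesis by (auto simp: null_sets_def emeasure_eq_measure)
    qed
    then show ?thesis
    proof (rule AE_I')
      show "{\<omega> \<in> space M. \<not> (\<exists>k\<ge>k1. \<omega> \<in> B k)} \<subseteq> (\<Inter>j. G j)" by (auto simp: G_def)
    qed
  qed
  obtain K where K: "\<And>R. 0 < R \<Longrightarrow> 1 - K / R ^ 4 \<le> surv R 1 0" using surv_tail by blast
  \<comment> \<open>The path has left the small ball already before the block begins.\<close>
  define D where "D k = space M - surv_event (\<eta> * \<rho> k) (real (\<tau> k)) 0" for k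
  have DE: "D k \<in> events" for k unfolding D_def by (intro sets.compl_sets surv_event_events) simp
  have K0: "0 \<le> K"
  proof -
    have "1 - K / 1 ^ 4 \<le> surv 1 1 0" by (rule K) simp
    then show ?thesis using surv_bounds(2)[of 1 1 0] by simp
  qed
  \<comment> \<open>At unit time the radius is \<open>R\<close> with
    \<open>R^2 = \<eta>^2 (k + 1)^2 / ll k\<close>. As \<open>ll k \<le> 3 (k + 1)\<close>, the tail
    \<open>K / R^4\<close> is \<open>O((k + 1)^(-2))\<close>, hence summable.\<close>
  have D_le: "norm (prob (D k)) \<le> 9 * K / \<eta> ^ 4 * inverse ((real (Suc k))\<^sup>2)" if k: "k0 \<le> k" for k
  proof -
    define R where "R = \<eta> * \<rho> k / sqrt (real (\<tau> k))"
    have R: "0 < R" using \<eta> \<rho>_pos[OF k] \<tau>_pos[of k] by (simp add: R_def)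
    have R2: "R\<^sup>2 = \<eta>\<^sup>2 * (real (Suc k))\<^sup>2 / ll k"
      using \<tau>_pos[of k] by (simp add: R_def power_mult_distrib power_divide \<rho>2[OF k] \<tau>_Suc)
    have "surv (\<eta> * \<rho> k) (real (\<tau> k)) 0 = surv 1 (real (\<tau> k) / (\<eta> * \<rho> k)\<^sup>2) 0"
      using \<eta> \<rho>_pos[OF k] \<tau>_pos[of k] by (intro surv_0_scaling) auto
    also have "real (\<tau> k) / (\<eta> * \<rho> k)\<^sup>2 = 1 / R\<^sup>2" using \<tau>_pos[of k] by (simp add: R_def power_divide)
    also have "surv 1 (1 / R\<^sup>2) 0 = surv R 1 0" using R by (intro surv_0_scaling[symmetric]) auto
    finally have eq: "prob (surv_event (\<eta> * \<rho> k) (real (\<tau> k)) 0) = surv R 1 0" by (simp add: surv_eq)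
    have "prob (D k) = 1 - surv R 1 0"
      unfolding D_def eq[symmetric] by (intro prob_compl surv_event_events) simp
    also have "\<dots> \<le> K / R ^ 4" using K[OF R] by simp
    also have "R ^ 4 = \<eta> ^ 4 * (real (Suc k)) ^ 4 / (ll k)\<^sup>2"
    proof -
      have "R ^ 4 = (R\<^sup>2)\<^sup>2" by simp
      then show ?thesis unfolding R2 by (simp add: power_mult_distrib power_divide del: of_nat_Suc)
    qed
    also have "K / (\<eta> ^ 4 * (real (Suc k)) ^ 4 / (ll k)\<^sup>2) = K * (ll k)\<^sup>2 / (\<eta> ^ 4 * (real (Suc k)) ^ 4)" by simp
    also have "\<dots> \<le> K * (3 * real (Suc k))\<^sup>2 / (\<eta> ^ 4 * (real (Suc k)) ^ 4)"
    proof (intro divide_right_mono mult_left_mono power_mono K0)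
      show "ll k \<le> 3 * real (Suc k)"
        using ln_ln_fact_square_le[of "Suc k"] k0(1)[OF k] by (simp add: ll_def \<tau>_def)
      show "0 \<le> ll k" using ll_pos[OF k] by simp
    qed (use \<eta> in auto)
    also have "\<dots> = 9 * K / \<eta> ^ 4 * inverse ((real (Suc k))\<^sup>2)"
      by (simp add: power_mult_distrib divide_simps power4_eq_xxxx power2_eq_square del: of_nat_Suc)
    finally show ?thesis by simp
  qed
  have "summable (\<lambda>k. prob (D k))"
  proof (rule summable_comparison_test)
    show "\<exists>N. \<forall>k\<ge>N. norm (prob (D k)) \<le> 9 * K / \<eta> ^ 4 * inverse ((real (Suc k))\<^sup>2)" using D_le by blast
    have "summable (\<lambda>k. inverse ((real (Suc k))\<^sup>2))"
      by (subst summable_Suc_iff) (rule inverse_power_summable, simp)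
    then show "summable (\<lambda>k. 9 * K / \<eta> ^ 4 * inverse ((real (Suc k))\<^sup>2))" by (rule summable_mult)
  qed
  then have "AE \<omega> in M. \<forall>\<^sub>F k in sequentially. \<omega> \<in> space M - D k"
    using DE by (intro borel_cantelli_AE1) (auto simp: less_top[symmetric])
  moreover have "AE \<omega> in M. \<forall>i. \<exists>k\<ge>Suc (k0 + i). \<omega> \<in> B k" unfolding AE_all_countable by (intro allI io) auto
  ultimately show ?thesis
  proof eventually_elim
    fix \<omega> assume ev: "\<forall>\<^sub>F k in sequentially. \<omega> \<in> space M - D k" and inf: "\<forall>i. \<exists>k\<ge>Suc (k0 + i). \<omega> \<in> B k"
    obtain N where N: "\<And>k. N \<le> k \<Longrightarrow> \<omega> \<in> space M - D k" using ev by (auto simp: eventually_sequentially)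
    show "\<exists>\<^sub>F t in at_top. sqrt (ln (ln t) / t) * rmax t \<omega> \<le> b"
      unfolding frequently_def eventually_at_top_linorder
    proof safe
      fix t0 :: real assume *: "\<forall>t\<ge>t0. \<not> sqrt (ln (ln t) / t) * rmax t \<omega> \<le> b"
      obtain n0 :: nat where n0: "t0 \<le> real n0" using real_arch_simple by blast
      obtain k where k: "Suc (k0 + (N + n0)) \<le> k" "\<omega> \<in> B k" using inf by blast
      then have kk: "k0 \<le> k" "N \<le> k" "n0 \<le> k" by auto
      have sp: "\<omega> \<in> space M" and S: "\<omega> \<in> surv_event (\<eta> * \<rho> k) (real (\<tau> k)) 0" using N[OF kk(2)] by (auto simp: D_def)
      have F: "heis_norm (- g (real (\<tau> k)) \<omega> \<odot> g (real (\<tau> k) + v) \<omega>) \<le> a * \<rho> k" if "v \<in> {0..real (\<tau> (Suc k) - \<tau> k)}" for v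
        using k(2) that by (simp add: B_def fut_event_def)
      have "heis_norm (g u \<omega>) \<le> b * \<rho> k" if u: "u \<in> {0..real (\<tau> (Suc k))}" for u
      proof (cases "u \<le> real (\<tau> k)")
        case True
        then have "heis_norm (g u \<omega>) \<le> \<eta> * \<rho> k" using S u by (auto simp: surv_event_iff)
        also have "\<dots> \<le> b * \<rho> k" using \<rho>_pos[OF kk(1)] a \<eta>_def by (intro mult_right_mono) auto
        finally show ?thesis .
      next
        case False
        have "heis_norm (g (real (\<tau> k)) \<omega>) \<le> \<eta> * \<rho> k" using S by (auto simp: surv_event_iff)
        moreover have "heis_norm (- g (real (\<tau> k)) \<omega> \<odot> g u \<omega>) \<le> a * \<rho> k"
          using F[of "u - real (\<tau> k)"] False u \<tau>_le[of k] by (simp add: of_nat_diff)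
        moreover have "heis_norm (g u \<omega>) \<le> heis_norm (g (real (\<tau> k)) \<omega>) + heis_norm (- g (real (\<tau> k)) \<omega> \<odot> g u \<omega>)"
          using heis_norm_triangle[of "g (real (\<tau> k)) \<omega>" "- g (real (\<tau> k)) \<omega> \<odot> g u \<omega>"] by simp
        ultimately show ?thesis by (simp add: \<eta>_def algebra_simps)
      qed
      then have "rmax (real (\<tau> (Suc k))) \<omega> \<le> b * \<rho> k" using sp by (subst rmax_le_iff) (auto simp: surv_event_iff)
      then have "sqrt (ll k / real (\<tau> (Suc k))) * rmax (real (\<tau> (Suc k))) \<omega> \<le> sqrt (ll k / real (\<tau> (Suc k))) * (b * \<rho> k)"
        using ll_pos[OF kk(1)] by (intro mult_left_mono) auto
      also have "\<dots> = b * sqrt (ll k / real (\<tau> (Suc k)) * (real (\<tau> (Suc k)) / ll k))"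
        unfolding \<rho>_def by (simp only: real_sqrt_mult mult_ac)
      also have "ll k / real (\<tau> (Suc k)) * (real (\<tau> (Suc k)) / ll k) = 1"
        using ll_pos[OF kk(1)] \<tau>_pos[of "Suc k"] by simp
      finally have "sqrt (ln (ln (real (\<tau> (Suc k)))) / real (\<tau> (Suc k))) * rmax (real (\<tau> (Suc k))) \<omega> \<le> b" by (simp add: ll_def)
      moreover have "t0 \<le> real (\<tau> (Suc k))"
      proof -
        have "real n0 \<le> real (Suc k)" using kk by simp
        then show ?thesis using n0 \<tau>_ge[of "Suc k"] by linarith
      qed
      ultimately show False using * by blast
    qed
  qed
qed

text \<open>Both halves hold almost surely for each fixed \<open>b\<close>; countably many values
  tending to \<open>sqrt L\<close> from either side determine the lower limit.\<close>

theorem chung_law: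
  assumes L: "0 < L"
    and up: "\<And>\<mu>. 0 < \<mu> \<Longrightarrow> \<mu> < L \<Longrightarrow> \<forall>\<^sub>F T in at_top. surv 1 T 0 \<le> exp (- \<mu> * T)"
    and low: "\<And>\<mu>. L < \<mu> \<Longrightarrow> \<forall>\<^sub>F T in at_top. exp (- \<mu> * T) \<le> surv 1 T 0"
  shows "AE \<omega> in M. Liminf at_top (\<lambda>t. ereal (sqrt (ln (ln t) / t) * rmax t \<omega>)) = ereal (sqrt L)"
proof -
  define c where "c = sqrt L"
  have c: "0 < c" using L by (simp add: c_def)
  \<comment> \<open>The shift by 2 keeps the bound positive for \<open>n = 0\<close>.\<close>
  have "AE \<omega> in M. \<forall>\<^sub>F t in at_top. c * (1 - 1 / real (n + 2)) \<le> sqrt (ln (ln t) / t) * rmax t \<omega>" for n :: nat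
  proof (rule AE_eventually_rmax_ge[OF L up])
    show "0 < c * (1 - 1 / real (n + 2))" using c by simp
    show "c * (1 - 1 / real (n + 2)) < sqrt L" using c by (simp add: c_def)
  qed
  then have 1: "AE \<omega> in M. \<forall>n::nat. \<forall>\<^sub>F t in at_top. c * (1 - 1 / real (n + 2)) \<le> sqrt (ln (ln t) / t) * rmax t \<omega>"
    unfolding AE_all_countable by blast
  have "AE \<omega> in M. \<exists>\<^sub>F t in at_top. sqrt (ln (ln t) / t) * rmax t \<omega> \<le> c + 1 / real (Suc n)" for n :: nat
    by (rule AE_frequently_rmax_le[OF L low]) (simp_all add: c_def)
  then have 2: "AE \<omega> in M. \<forall>n::nat. \<exists>\<^sub>F t in at_top. sqrt (ln (ln t) / t) * rmax t \<omega> \<le> c + 1 / real (Suc n)"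
    unfolding AE_all_countable by blast
  from 1 2 show ?thesis
  proof eventually_elim
    fix \<omega> assume ev: "\<forall>n::nat. \<forall>\<^sub>F t in at_top. c * (1 - 1 / real (n + 2)) \<le> sqrt (ln (ln t) / t) * rmax t \<omega>"
      and fr: "\<forall>n::nat. \<exists>\<^sub>F t in at_top. sqrt (ln (ln t) / t) * rmax t \<omega> \<le> c + 1 / real (Suc n)"
    let ?X = "\<lambda>t. ereal (sqrt (ln (ln t) / t) * rmax t \<omega>)"
    show "Liminf at_top ?X = ereal (sqrt L)"
    proof (rule antisym)
      have "Liminf at_top ?X \<le> ereal (c + 1 / real (Suc n))" for n
      proof (rule ccontr)
        assume "\<not> Liminf at_top ?X \<le> ereal (c + 1 / real (Suc n))"
        then have "ereal (c + 1 / real (Suc n)) < Liminf at_top ?X" by simp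
        then have "\<forall>\<^sub>F t in at_top. ereal (c + 1 / real (Suc n)) < ?X t" by (rule less_LiminfD)
        then have "\<forall>\<^sub>F t in at_top. \<not> sqrt (ln (ln t) / t) * rmax t \<omega> \<le> c + 1 / real (Suc n)"
          by eventually_elim (simp del: of_nat_Suc)
        then show False using fr unfolding frequently_def by blast
      qed
      moreover have "(\<lambda>n. ereal (c + 1 / real (Suc n))) \<longlonglongrightarrow> ereal (c + 0)"
        by (intro tendsto_ereal tendsto_add tendsto_const) (rule LIMSEQ_Suc[OF lim_1_over_n])
      ultimately have "Liminf at_top ?X \<le> ereal (c + 0)" by (intro LIMSEQ_le_const) blast+
      then show "Liminf at_top ?X \<le> ereal (sqrt L)" by (simp add: c_def)
      have "ereal (c * (1 - 1 / real (n + 2))) \<le> Liminf at_top ?X" for n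
        using ev by (intro Liminf_bounded) simp
      moreover have "(\<lambda>n. ereal (c * (1 - 1 / real (n + 2)))) \<longlonglongrightarrow> ereal (c * (1 - 0))"
        by (intro tendsto_ereal tendsto_mult tendsto_diff tendsto_const) (rule LIMSEQ_ignore_initial_segment[OF lim_1_over_n])
      ultimately have "ereal (c * (1 - 0)) \<le> Liminf at_top ?X" by (intro LIMSEQ_le_const2) blast+
      then show "ereal (sqrt L) \<le> Liminf at_top ?X" by (simp add: c_def)
    qed
  qed
qed

end

section \<open>From a given area process to the abstract path\<close>

sublocale levy_bm \<subseteq> heis_bm M heis_path
proof
  show "heis_path t \<in> borel_measurable M" for t by (rule heis_path_meas)
  show "continuous_on {0..} (\<lambda>t. heis_path t \<omega>)" if "\<omega> \<in> space M" for \<omega>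
    unfolding heis_path_def using that by (intro continuous_on_Pair W_cont A_cont)
  show "heis_path 0 \<omega> = 0" if "\<omega> \<in> space M" for \<omega>
    using that by (simp add: heis_path_def W_0 A_0 zero_prod_def)
qed (rule indep_heis_incr distr_heis_incr heis_path_support heis_path_tail; assumption)+

text \<open>At time 0 every Riemann sum vanishes, so the limit in probability is 0 almost
  surely.\<close>

lemma (in planar_bm) levy_area_0:
  assumes "levy_area M W A"
  shows "AE \<omega> in M. A 0 \<omega> = 0"
proof -
  have [measurable]: "A 0 \<in> borel_measurable M" using assms by (simp add: levy_area_def)
  have "AE \<omega> in M. \<bar>2 * A 0 \<omega>\<bar> \<le> 1 / real (Suc i)" for i
  proof -
    have "(\<lambda>n. prob {\<omega> \<in> space M. \<bar>levy_riemann_sum W 0 n \<omega> - 2 * A 0 \<omega>\<bar> > 1 / real (Suc i)}) \<longlonglongrightarrow> 0"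
      using assms by (simp add: levy_area_def)
    moreover have "levy_riemann_sum W 0 n \<omega> = 0" for n \<omega> by (simp add: levy_riemann_sum_def)
    ultimately have "prob {\<omega> \<in> space M. \<bar>2 * A 0 \<omega>\<bar> > 1 / real (Suc i)} = 0"
      by (simp add: LIMSEQ_const_iff)
    then have "{\<omega> \<in> space M. \<bar>2 * A 0 \<omega>\<bar> > 1 / real (Suc i)} \<in> null_sets M"
      by (auto simp: null_sets_def emeasure_eq_measure)
    then show ?thesis by (rule AE_I') auto
  qed
  then have "AE \<omega> in M. \<forall>i. \<bar>2 * A 0 \<omega>\<bar> \<le> 1 / real (Suc i)" unfolding AE_all_countable by blast
  then show ?thesis
  proof eventually_elim
    fix \<omega> assume *: "\<forall>i. \<bar>2 * A 0 \<omega>\<bar> \<le> 1 / real (Suc i)"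
    show "A 0 \<omega> = 0"
    proof (rule ccontr)
      assume "A 0 \<omega> \<noteq> 0"
      then obtain i where "1 / real (Suc i) < \<bar>2 * A 0 \<omega>\<bar>" using nat_approx_posE[of "\<bar>2 * A 0 \<omega>\<bar>"] by auto
      then show False using *[rule_format, of i] by linarith
    qed
  qed
qed

lemma (in planar_bm) levy_bm_normalized:
  assumes A: "levy_area M W A"
  shows "levy_bm M W (\<lambda>t \<omega>. A t \<omega> - A 0 \<omega>)"
proof
  have [measurable]: "A t \<in> borel_measurable M" for t using A by (simp add: levy_area_def)
  show "(\<lambda>\<omega>. A t \<omega> - A 0 \<omega>) \<in> borel_measurable M" for t by measurable
  show "continuous_on {0..} (\<lambda>t. A t \<omega> - A 0 \<omega>)" if "\<omega> \<in> space M" for \<omega>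
    using A that by (intro continuous_intros) (auto simp: levy_area_def)
  show "tendsto_prob (\<lambda>n. area_sum (2 ^ n) t) (\<lambda>\<omega>. 2 * (A t \<omega> - A 0 \<omega>))" if t: "0 \<le> t" for t
    unfolding tendsto_prob_def
  proof (intro allI impI)
    fix \<delta> :: real assume "0 < \<delta>"
    then have "(\<lambda>n. prob {\<omega> \<in> space M. \<bar>area_sum (2 ^ n) t \<omega> - 2 * A t \<omega>\<bar> > \<delta>}) \<longlonglongrightarrow> 0"
      using A t by (simp add: levy_area_def levy_riemann_sum_eq)
    moreover have "prob {\<omega> \<in> space M. \<bar>area_sum (2 ^ n) t \<omega> - 2 * A t \<omega>\<bar> > \<delta>}
        = prob {\<omega> \<in> space M. dist (area_sum (2 ^ n) t \<omega>) (2 * (A t \<omega> - A 0 \<omega>)) > \<delta>}" for n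
    proof (rule finite_measure_eq_AE)
      show "AE \<omega> in M. \<omega> \<in> {\<omega> \<in> space M. \<bar>area_sum (2 ^ n) t \<omega> - 2 * A t \<omega>\<bar> > \<delta>} \<longleftrightarrow>
         \<omega> \<in> {\<omega> \<in> space M. dist (area_sum (2 ^ n) t \<omega>) (2 * (A t \<omega> - A 0 \<omega>)) > \<delta>}"
        using levy_area_0[OF A] by eventually_elim (simp add: dist_real_def)
    qed measurable
    ultimately show "(\<lambda>n. prob {\<omega> \<in> space M. dist (area_sum (2 ^ n) t \<omega>) (2 * (A t \<omega> - A 0 \<omega>)) > \<delta>}) \<longlonglongrightarrow> 0"
      by simp
  qed
qed simp

theorem theorem3p2:
  fixes M :: "'a measure" and W :: "real \<Rightarrow> 'a \<Rightarrow> real \<times> real" and A :: "real \<Rightarrow> 'a \<Rightarrow> real"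
  assumes "brownian_motion_2d M W"
    and "levy_area M W A"
  shows "\<exists>c::real. 0 < c \<and>
           (AE \<omega> in M. Liminf at_top (\<lambda>t. ereal (sqrt (ln (ln t) / t) * heis_running_max W A t \<omega>))
                        = ereal c) \<and>
           ((\<lambda>\<epsilon>. - (\<epsilon>\<^sup>2) * ln (measure M {\<omega>\<in>space M. heis_running_max W A 1 \<omega> < \<epsilon>}))
              \<longlongrightarrow> c\<^sup>2) (at_right 0)"
proof -
  interpret planar_bm M W by unfold_locales (rule assms(1))
  interpret levy_bm M W "\<lambda>t \<omega>. A t \<omega> - A 0 \<omega>" by (rule levy_bm_normalized[OF assms(2)])
  have [measurable]: "A t \<in> borel_measurable M" for t using assms(2) by (simp add: levy_area_def)
  obtain L where L: "0 < L"
    and up: "\<And>\<mu>. 0 < \<mu> \<Longrightarrow> \<mu> < L \<Longrightarrow> \<forall>\<^sub>F T in at_top. surv 1 T 0 \<le> exp (- \<mu> * T)"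
    and low: "\<And>\<mu>. L < \<mu> \<Longrightarrow> \<forall>\<^sub>F T in at_top. exp (- \<mu> * T) \<le> surv 1 T 0"
    using surv_rate by blast
  \<comment> \<open>Where \<open>A 0\<close> vanishes, the given path and the normalised one
    coincide at all times; both conclusions are transferred along this almost sure event.\<close>
  have eq: "heis_running_max W A t \<omega> = rmax t \<omega>" if "A 0 \<omega> = 0" for t \<omega>
    using that by (simp add: heis_running_max_def rmax_def heis_path_def)
  have A0: "AE \<omega> in M. A 0 \<omega> = 0" by (rule levy_area_0[OF assms(2)])
  have "AE \<omega> in M. Liminf at_top (\<lambda>t. ereal (sqrt (ln (ln t) / t) * rmax t \<omega>)) = ereal (sqrt L)"
    by (rule chung_law[OF L up low])
  then have "AE \<omega> in M. Liminf at_top (\<lambda>t. ereal (sqrt (ln (ln t) / t) * heis_running_max W A t \<omega>)) = ereal (sqrt L)"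
    using A0 by eventually_elim (simp only: eq)
  moreover have "prob {\<omega> \<in> space M. heis_running_max W A 1 \<omega> < \<epsilon>} = prob {\<omega> \<in> space M. rmax 1 \<omega> < \<epsilon>}" for \<epsilon>
  proof (rule measure_eq_AE)
    show "AE \<omega> in M. \<omega> \<in> {\<omega> \<in> space M. heis_running_max W A 1 \<omega> < \<epsilon>} \<longleftrightarrow> \<omega> \<in> {\<omega> \<in> space M. rmax 1 \<omega> < \<epsilon>}"
      using A0 by eventually_elim (simp add: eq)
    show "{\<omega> \<in> space M. rmax 1 \<omega> < \<epsilon>} \<in> events"
      unfolding rmax_def by (intro events_running_max_less g_cont g_meas)
    show "{\<omega> \<in> space M. heis_running_max W A 1 \<omega> < \<epsilon>} \<in> events"
      unfolding heis_running_max_def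
    proof (rule events_running_max_less)
      show "continuous_on {0..} (\<lambda>u. (W u \<omega>, A u \<omega>))" if "\<omega> \<in> space M" for \<omega>
        using assms(2) that by (intro continuous_on_Pair W_cont) (auto simp: levy_area_def)
      show "(\<lambda>\<omega>. (W u \<omega>, A u \<omega>)) \<in> borel_measurable M" for u by (intro borel_measurable_Pair) measurable
    qed
  qed
  moreover have "((\<lambda>\<epsilon>. - (\<epsilon>\<^sup>2) * ln (prob {\<omega> \<in> space M. rmax 1 \<omega> < \<epsilon>})) \<longlongrightarrow> L) (at_right 0)"
    by (rule small_ball_limit[OF L up low])
  ultimately show ?thesis
    using L by (intro exI[of _ "sqrt L"]) simp
qed

end
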